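(* For all $i=0,\dots,n$, $$Y^\pi_{t_i}=u^\pi_i\big(X^\pi_{t_0},\dots,X^\pi_{t_i};\Delta B_{t_{i+1}},\dots,\Delta B_{t_n}\big),$$ $$Z^{\pi,1}_{t_i}=v^\pi_i\big(X^\pi_{t_0},\dots,X^\pi_{t_i};\Delta B_{t_{i+1}},\dots,\Delta B_{t_n}\big).$$
   Context: Probabilistic setting. $T>0$ is a fixed terminal time; $(W_t)_{0\le t\le T}$ and $(B_t)_{0\le t\le T}$ are two independent standard Brownian motions on a probability space $(\Omega,\mathcal F,\mathbb P)$ with values in $\mathbb R^d$ and $\mathbb R$ respectively. $\mathcal N$ is the class of $\mathbb P$-null sets, $\mathcal F^W_{0,t}=\sigma(W_r-W_0;0\le r\le t)$, $\mathcal F^B_{t,T}=\sigma(B_r-B_t;t\le r\le T)$, and $\mathcal F_t=\mathcal F^W_{0,t}\vee\mathcal F^B_{t,T}\vee\mathcal N$. $M^2([0,T],\mathbb R)$ is the set of real-valued jointly measurable processes $(\varphi_t)_{t\in[0,T]}$ such that $\varphi_t$ is $\mathcal F_t$-measurable for almost every $t$ and $\mathbb E\int_0^T|\varphi_t|^2dt<\infty$. $\mathcal C^k_b$ denotes functions of class $\mathcal C^k$ bounded together with their partial derivatives up to order $k$. For simplicity, the $Y$ and $Z$ processes are assumed to be real-valued. Coefficients. $x\in\mathbb R^d$; $b:\mathbb R^d\to\mathbb R^d$ and $\sigma:\mathbb R^d\to\mathbb R^{d\times d}$ are of class $\mathcal C^3_b$; $\phi:\mathbb R^d\to\mathbb R$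 is of class $\mathcal C^2_b$. The maps $f,g:\Omega\times[0,T]\times\mathbb R^d\times\mathbb R\times\mathbb R\to\mathbb R$ are jointly measurable (the argument $\omega\in\Omega$ is omitted from the notation), for every $(x,y,z)\in\mathbb R^{d+2}$ the processes $f(\cdot,x,y,z)$ and $g(\cdot,x,y,z)$ belong to $M^2([0,T],\mathbb R)$, and: (i) there are constants $L_f,L_g\ge0$ and $\alpha\in[0,1)$ such that for every $\omega\in\Omega$, $t,t'\in[0,T]$, $x,x'\in\mathbb R^d$, $y,y'\in\mathbb R$, $z,z'\in\mathbb R$, $|f(t,x,y,z)-f(t',x',y',z')|^2\le L_f(|t-t'|+|x-x'|^2+|y-y'|^2+|z-z'|^2)$ and $|g(t,x,y,z)-g(t',x',y',z')|^2\le L_g(|t-t'|+|x-x'|^2+|y-y'|^2)+\alpha|z-z'|^2$; (ii) for all $s\in[0,T]$, $f(s,\cdot)$ and $g(s,\cdot)$ are of class $\mathcal C^3$ with bounded partial derivatives up to order 3, uniformly in time; (iii) $\sup_{r\in[0,T]}|f(r,0,0,0)|+\sup_{r\in[0,T]}|g(r,0,0,0)|<\infty$; (iv) for every $\omega\in\Omega$, $\sup_{t,x,y,z}|\partial_z g(t,x,y,z)|<1$. Scheme. Let $\pi=\{0=t_0<t_1<\dots<t_n=T\}$ be any subdivision of $[0,T]$, and put $\Delta t_i=t_i-t_{i-1}$, $\Delta B_{t_i}=B_{t_i}-B_{t_{i-1}}$, $\Delta W_{t_i}=W_{t_i}-W_{t_{i-1}}$. The Euler scheme is $X^\pi_t=x+\int_0^tb(X^\pi_{s_\pi})ds+\int_0^t\sigma(X^\pi_{s_\pi})dW_s$,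 with $s_\pi=\max\{t_i:t_i\le s\}$. For $t_{i-1}\le t\le t_i$ let $\mathcal G^i_t=\sigma(W_r-W_0;0\le r\le t)\vee\sigma(B_r-B_{t_{i-1}};t_{i-1}\le r\le T)$, and set $\mathcal G_t=\mathcal G^i_t$ for $t_{i-1}\le t<t_i$. The $(\mathcal G_t)$-adapted process $(Y^\pi_t,Z^\pi_t)_{0\le t\le T}$ is defined recursively backward: $Y^\pi_{t_n}=\phi(X^\pi_{t_n})$, $Z^{\pi,1}_{t_n}=0$; for $i=n-1,\dots,0$, $Z^{\pi,1}_{t_i}=\frac1{\Delta t_{i+1}}\mathbb E\big(\int_{t_i}^{t_{i+1}}Z^\pi_rdr\,\big|\,\mathcal F_{t_i}\big)$; and for $i=n,\dots,1$, with $\Theta^{\pi,1}_{t_i}=(X^\pi_{t_i},Y^\pi_{t_i},Z^{\pi,1}_{t_i})$, $$Y^\pi_t=Y^\pi_{t_i}+f(t_i,\Theta^{\pi,1}_{t_i})\Delta t_i+g(t_i,\Theta^{\pi,1}_{t_i})\Delta B_{t_i}-\int_t^{t_i}Z^\pi_rdW_r,\qquad t\in[t_{i-1},t_i).$$ On each interval $[t_{i-1},t_i)$ such a pair is obtained from the martingale representation theorem: $Y^\pi_t=M^i_t:=\mathbb E\big(Y^\pi_{t_i}+f(t_i,\Theta^{\pi,1}_{t_i})\Delta t_i+g(t_i,\Theta^{\pi,1}_{t_i})\Delta B_{t_i}\,\big|\,\mathcal G^i_t\big)$ and $Z^\pi_t=N^i_t$, where $N^i$ is the $(\mathcal G^i_t)$-adapted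 square integrable process with $M^i_t=M^i_{t_{i-1}}+\int_{t_{i-1}}^tN^i_sdW_s$. Functions $u^\pi_i,v^\pi_i$. For $x\in\mathbb R^d$ and $s<t$ set $X_t(s,x)=x+(t-s)b(x)+\sigma(x)(W_t-W_s)$. For $(x_0,\dots,x_i;x_{i+1},\dots,x_n)\in\mathbb R^{(i+1)d}\times\mathbb R^{n-i}$ (so $x_0,\dots,x_i\in\mathbb R^d$ and $x_{i+1},\dots,x_n\in\mathbb R$) write $\mathbf x^i=(x_0,\dots,x_i)$, $\mathbf x_{i+1}=(x_{i+1},\dots,x_n)$, $\mathbf x_{n+1}=\emptyset$. The functions $u^\pi_i,v^\pi_i:\mathbb R^{(i+1)d}\times\mathbb R^{n-i}\to\mathbb R$ and the random variables $U^\pi_i,V^\pi_i:\mathbb R^{(i+1)d}\times\Omega\times\mathbb R^{n-i-1}\to\mathbb R$ are defined by backward induction: $u^\pi_n(x_0,\dots,x_n)=\phi(x_n)$, $v^\pi_n(x_0,\dots,x_n)=0$, and for $i=n-1,\dots,0$, writing $\chi=X_{t_{i+1}}(t_i,x_i)$, $$U^\pi_i(\mathbf x^i,\omega,\mathbf x_{i+2})=u^\pi_{i+1}(\mathbf x^i,\chi,\mathbf x_{i+2})+f\big(t_{i+1},\chi,u^\pi_{i+1}(\mathbf x^i,\chi,\mathbf x_{i+2}),v^\pi_{i+1}(\mathbf x^i,\chi,\mathbf x_{i+2})\big)\Delta t_{i+1},$$ $$V^\pi_i(\mathbf x^i,\omega,\mathbf x_{i+2})=g\big(t_{i+1},\chi,u^\pi_{i+1}(\mathbf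 x^i,\chi,\mathbf x_{i+2}),v^\pi_{i+1}(\mathbf x^i,\chi,\mathbf x_{i+2})\big),$$ $$u^\pi_i(\mathbf x^i;\mathbf x_{i+1})=\mathbb E\,U^\pi_i(\mathbf x^i,\omega,\mathbf x_{i+2})+x_{i+1}\,\mathbb E\,V^\pi_i(\mathbf x^i,\omega,\mathbf x_{i+2}),$$ $$v^\pi_i(\mathbf x^i;\mathbf x_{i+1})=\frac1{\Delta t_{i+1}}\mathbb E\big(U^\pi_i(\mathbf x^i,\omega,\mathbf x_{i+2})\Delta W_{t_{i+1}}\big)+\frac{x_{i+1}}{\Delta t_{i+1}}\mathbb E\big(V^\pi_i(\mathbf x^i,\omega,\mathbf x_{i+2})\Delta W_{t_{i+1}}\big),$$ where expectations are over $\omega$ with the $x_j$ fixed.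
   Formalization: The random maps f(t_i,·), g(t_i,·) together with ΔW_{t_i} are assumed independent of F_{t_{i-1}} (automatic if f, g do not depend on ω; the claim can fail otherwise); for d>1, Z, Z^{π,1}, v_i and the z-argument of f, g take values in R^d. *)

theory Defs
  imports "HOL-Probability.Probability"
begin

section \<open>Differentiability classes\<close>

definition partial_deriv ::
  "'a::euclidean_space \<Rightarrow> ('a \<Rightarrow> 'b::real_normed_vector) \<Rightarrow> 'a \<Rightarrow> 'b"
  where "partial_deriv e F x = vector_derivative (\<lambda>h. F (x + h *\<^sub>R e)) (at 0)"

text \<open>Iterated partial derivatives along a list of basis vectors; the order of the partial
  derivative is the length of the list.\<close>

definition iter_partial ::
  "'a::euclidean_space list \<Rightarrow> ('a \<Rightarrow> 'b::real_normed_vector) \<Rightarrow> 'a \<Rightarrow> 'b"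
  where "iter_partial es F = foldr partial_deriv es F"

definition class_C :: "nat \<Rightarrow> ('a::euclidean_space \<Rightarrow> 'b::real_normed_vector) \<Rightarrow> bool"
  where "class_C k F \<longleftrightarrow>
    (\<forall>es e x. set es \<subseteq> Basis \<and> e \<in> Basis \<and> length es < k \<longrightarrow>
        (\<lambda>h. iter_partial es F (x + h *\<^sub>R e)) differentiable (at 0)) \<and>
    (\<forall>es. set es \<subseteq> Basis \<and> length es \<le> k \<longrightarrow> continuous_on UNIV (iter_partial es F))"

definition class_Cb :: "nat \<Rightarrow> ('a::euclidean_space \<Rightarrow> 'b::real_normed_vector) \<Rightarrow> bool"
  where "class_Cb k F \<longleftrightarrow> class_C k F \<and>
    (\<forall>es. set es \<subseteq> Basis \<and> length es \<le> k \<longrightarrow> bounded (range (iter_partial es F)))"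

text \<open>A time-dependent function of class \<open>C\<^sup>k\<close> in space whose partial derivatives of orders
  \<open>1, \<dots>, k\<close> (but not necessarily the function itself) are bounded uniformly in time.\<close>

definition class_C_bdd_derivs ::
  "nat \<Rightarrow> real set \<Rightarrow> (real \<Rightarrow> 'a::euclidean_space \<Rightarrow> 'b::real_normed_vector) \<Rightarrow> bool"
  where "class_C_bdd_derivs k I F \<longleftrightarrow> (\<forall>s\<in>I. class_C k (F s)) \<and>
    (\<exists>C. \<forall>s\<in>I. \<forall>es x. set es \<subseteq> Basis \<and> 1 \<le> length es \<and> length es \<le> k \<longrightarrow>
        norm (iter_partial es (F s) x) \<le> C)"


section \<open>Sigma-algebras\<close>

definition preimage_events :: "'w measure \<Rightarrow> ('w \<Rightarrow> 'b::topological_space) set \<Rightarrow> 'w set set"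
  where "preimage_events M \<X> = {X -` A \<inter> space M |X A. X \<in> \<X> \<and> A \<in> sets borel}"

definition incr_events ::
  "'w measure \<Rightarrow> (real \<Rightarrow> 'w \<Rightarrow> 'b::real_normed_vector) \<Rightarrow> real \<Rightarrow> real set \<Rightarrow> 'w set set"
  where "incr_events M W s I = preimage_events M ((\<lambda>r \<omega>. W r \<omega> - W s \<omega>) ` I)"

definition sigalg_FW ::
  "'w measure \<Rightarrow> (real \<Rightarrow> 'w \<Rightarrow> 'a::real_normed_vector) \<Rightarrow> real \<Rightarrow> 'w measure"
  where "sigalg_FW M W s = sigma (space M) (incr_events M W 0 {0..s} \<union> null_sets M)"

text \<open>\<open>sigalg_F\<close> is not monotone in time, hence not a filtration.\<close>

definition sigalg_F ::
  "'w measure \<Rightarrow> real \<Rightarrow> (real \<Rightarrow> 'w \<Rightarrow> 'a::real_normed_vector) \<Rightarrow> (real \<Rightarrow> 'w \<Rightarrow> real)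
    \<Rightarrow> real \<Rightarrow> 'w measure"
  where "sigalg_F M T W B s =
    sigma (space M) (incr_events M W 0 {0..s} \<union> incr_events M B s {s..T} \<union> null_sets M)"

text \<open>With \<open>c = t\<^sub>i\<^sub>-\<^sub>1\<close> this is the filtration \<open>(\<G>\<^sup>i\<^sub>s)\<close> of the \<open>i\<close>-th interval.\<close>

definition sigalg_G ::
  "'w measure \<Rightarrow> real \<Rightarrow> (real \<Rightarrow> 'w \<Rightarrow> 'a::real_normed_vector) \<Rightarrow> (real \<Rightarrow> 'w \<Rightarrow> real)
    \<Rightarrow> real \<Rightarrow> real \<Rightarrow> 'w measure"
  where "sigalg_G M T W B c s =
    sigma (space M) (incr_events M W 0 {0..s} \<union> incr_events M B c {c..T})"

definition indep_sigalg :: "'w measure \<Rightarrow> 'w measure \<Rightarrow> 'w measure \<Rightarrow> bool"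
  where "indep_sigalg M F G \<longleftrightarrow> prob_space.indep_set M (sets F) (sets G)"


section \<open>Brownian motion and the space of square integrable processes\<close>

definition brownian_motion ::
  "'w measure \<Rightarrow> real \<Rightarrow> (real \<Rightarrow> 'w \<Rightarrow> 'a::euclidean_space) \<Rightarrow> bool"
  where "brownian_motion M T W \<longleftrightarrow>
    (\<forall>s\<in>{0..T}. W s \<in> borel_measurable M) \<and>
    (AE \<omega> in M. W 0 \<omega> = 0) \<and>
    (AE \<omega> in M. continuous_on {0..T} (\<lambda>s. W s \<omega>)) \<and>
    (\<forall>s r. 0 \<le> s \<and> s < r \<and> r \<le> T \<longrightarrow>
      indep_sigalg M (sigma (space M) (preimage_events M (W ` {0..s})))
                     (sigma (space M) (preimage_events M {\<lambda>\<omega>. W r \<omega> - W s \<omega>})) \<and>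
      distributed M lborel (\<lambda>\<omega>. W r \<omega> - W s \<omega>)
        (\<lambda>x. ennreal (\<Prod>e\<in>Basis. normal_density 0 (sqrt (r - s)) (x \<bullet> e))))"

definition indep_processes ::
  "'w measure \<Rightarrow> real \<Rightarrow> (real \<Rightarrow> 'w \<Rightarrow> 'a::topological_space)
    \<Rightarrow> (real \<Rightarrow> 'w \<Rightarrow> 'b::topological_space) \<Rightarrow> bool"
  where "indep_processes M T W B \<longleftrightarrow>
    indep_sigalg M (sigma (space M) (preimage_events M (W ` {0..T})))
                   (sigma (space M) (preimage_events M (B ` {0..T})))"

definition space_M2 ::
  "'w measure \<Rightarrow> real \<Rightarrow> (real \<Rightarrow> 'w measure) \<Rightarrow> (real \<Rightarrow> 'w \<Rightarrow> real) set"
  where "space_M2 M T F = {p.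
    (\<lambda>(s, \<omega>). p s \<omega>) \<in> borel_measurable (restrict_space borel {0..T} \<Otimes>\<^sub>M M) \<and>
    (AE s in lborel. s \<in> {0..T} \<longrightarrow> p s \<in> borel_measurable (F s)) \<and>
    (\<integral>\<^sup>+\<omega>. (\<integral>\<^sup>+s\<in>{0..T}. ennreal ((p s \<omega>)\<^sup>2) \<partial>lborel) \<partial>M) < \<infinity>}"

definition cond_exp_vec ::
  "'w measure \<Rightarrow> 'w measure \<Rightarrow> ('w \<Rightarrow> real^'d) \<Rightarrow> 'w \<Rightarrow> real^'d"
  where "cond_exp_vec M F X \<omega> = (\<chi> j. real_cond_exp M F (\<lambda>\<omega>'. X \<omega>' $ j) \<omega>)"


section \<open>The Ito integral\<close>

text \<open>A simple integrand on \<open>(a, b]\<close> is given by a partition \<open>a = p 0 \<le> \<dots> \<le> p m = b\<close> and bounded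
  random vectors \<open>\<xi> j\<close>, known at time \<open>p j\<close>; it equals \<open>\<xi> j\<close> on \<open>(p j, p (j + 1)]\<close>.\<close>

definition simple_integrand ::
  "'w measure \<Rightarrow> (real \<Rightarrow> 'w measure) \<Rightarrow> real \<Rightarrow> real
    \<Rightarrow> nat \<Rightarrow> (nat \<Rightarrow> real) \<Rightarrow> (nat \<Rightarrow> 'w \<Rightarrow> 'a::euclidean_space) \<Rightarrow> bool"
  where "simple_integrand M \<FF> a b m p \<xi> \<longleftrightarrow>
    p 0 = a \<and> p m = b \<and> (\<forall>j<m. p j \<le> p (Suc j)) \<and>
    (\<forall>j<m. \<xi> j \<in> borel_measurable (\<FF> (p j)) \<and> bounded (\<xi> j ` space M))"

definition simple_process ::
  "nat \<Rightarrow> (nat \<Rightarrow> real) \<Rightarrow> (nat \<Rightarrow> 'w \<Rightarrow> 'a::euclidean_space) \<Rightarrow> real \<Rightarrow> 'w \<Rightarrow> 'a"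
  where "simple_process m p \<xi> s \<omega> = (\<Sum>j<m. indicator {p j<..p (Suc j)} s *\<^sub>R \<xi> j \<omega>)"

definition simple_ito ::
  "(real \<Rightarrow> 'w \<Rightarrow> 'a::euclidean_space) \<Rightarrow> nat \<Rightarrow> (nat \<Rightarrow> real) \<Rightarrow> (nat \<Rightarrow> 'w \<Rightarrow> 'a) \<Rightarrow> 'w \<Rightarrow> real"
  where "simple_ito W m p \<xi> \<omega> = (\<Sum>j<m. \<xi> j \<omega> \<bullet> (W (p (Suc j)) \<omega> - W (p j) \<omega>))"

text \<open>\<open>I\<close> is (a version of) \<open>\<integral>\<^sub>a\<^sup>b H\<^sub>s \<bullet> dW\<^sub>s\<close>: the process \<open>H\<close> is jointly measurable, adapted to the
  filtration \<open>\<FF>\<close> and square integrable, and \<open>I\<close> is the limit in mean square of the integrals of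
  simple integrands which approximate \<open>H\<close> in mean square. The value of \<open>H\<close> at the single time \<open>b\<close>
  is irrelevant and is not constrained.\<close>

definition has_ito_integral ::
  "'w measure \<Rightarrow> (real \<Rightarrow> 'w measure) \<Rightarrow> (real \<Rightarrow> 'w \<Rightarrow> 'a::euclidean_space) \<Rightarrow> real \<Rightarrow> real
    \<Rightarrow> (real \<Rightarrow> 'w \<Rightarrow> 'a) \<Rightarrow> ('w \<Rightarrow> real) \<Rightarrow> bool"
  where "has_ito_integral M \<FF> W a b H I \<longleftrightarrow>
    (\<lambda>(s, \<omega>). H s \<omega>) \<in> borel_measurable (restrict_space borel {a..<b} \<Otimes>\<^sub>M M) \<and>
    (\<forall>s\<in>{a..<b}. H s \<in> borel_measurable (\<FF> s)) \<and>
    (\<integral>\<^sup>+\<omega>. (\<integral>\<^sup>+s\<in>{a..<b}. ennreal ((norm (H s \<omega>))\<^sup>2) \<partial>lborel) \<partial>M) < \<infinity> \<and>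
    I \<in> borel_measurable M \<and>
    (\<exists>m p \<xi>. (\<forall>k. simple_integrand M \<FF> a b (m k) (p k) (\<xi> k)) \<and>
      (\<lambda>k. \<integral>\<^sup>+\<omega>. (\<integral>\<^sup>+s\<in>{a..<b}.
            ennreal ((norm (H s \<omega> - simple_process (m k) (p k) (\<xi> k) s \<omega>))\<^sup>2) \<partial>lborel) \<partial>M)
        \<longlonglongrightarrow> 0 \<and>
      (\<lambda>k. \<integral>\<^sup>+\<omega>. ennreal ((I \<omega> - simple_ito W (m k) (p k) (\<xi> k) \<omega>)\<^sup>2) \<partial>M) \<longlonglongrightarrow> 0)"


section \<open>The discretization scheme\<close>

definition subdivision :: "real \<Rightarrow> nat \<Rightarrow> (nat \<Rightarrow> real) \<Rightarrow> bool"
  where "subdivision T n t \<longleftrightarrow> t 0 = 0 \<and> t n = T \<and> (\<forall>i<n. t i < t (Suc i))"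

definition grid_floor :: "nat \<Rightarrow> (nat \<Rightarrow> real) \<Rightarrow> real \<Rightarrow> real"
  where "grid_floor n t s = Max {t i |i. i \<le> n \<and> t i \<le> s}"

definition dt :: "(nat \<Rightarrow> real) \<Rightarrow> nat \<Rightarrow> real"
  where "dt t i = t i - t (i - 1)"

definition dP :: "(nat \<Rightarrow> real) \<Rightarrow> (real \<Rightarrow> 'w \<Rightarrow> 'b::real_normed_vector) \<Rightarrow> nat \<Rightarrow> 'w \<Rightarrow> 'b"
  where "dP t P i \<omega> = P (t i) \<omega> - P (t (i - 1)) \<omega>"

text \<open>The \<open>k\<close>-th component of \<open>\<integral> \<sigma>(X) dW\<close> is the integral of the \<open>k\<close>-th row of \<open>\<sigma>(X)\<close>.\<close>

definition euler_X ::
  "'w measure \<Rightarrow> real \<Rightarrow> nat \<Rightarrow> (nat \<Rightarrow> real) \<Rightarrow> (real \<Rightarrow> 'w \<Rightarrow> real^'d)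
    \<Rightarrow> (real^'d \<Rightarrow> real^'d) \<Rightarrow> (real^'d \<Rightarrow> real^'d^'d) \<Rightarrow> real^'d \<Rightarrow> (real \<Rightarrow> 'w \<Rightarrow> real^'d) \<Rightarrow> bool"
  where "euler_X M T n t W b \<sigma> x0 X \<longleftrightarrow>
    (\<forall>r\<in>{0..T}. X r \<in> borel_measurable (sigalg_FW M W r) \<and>
      (\<exists>I :: 'w \<Rightarrow> real^'d.
        (\<forall>k. has_ito_integral M (sigalg_FW M W) W 0 r
               (\<lambda>s \<omega>. \<sigma> (X (grid_floor n t s) \<omega>) $ k) (\<lambda>\<omega>. I \<omega> $ k)) \<and>
        (AE \<omega> in M. X r \<omega> =
           x0 + (LINT s:{0..r}|lborel. b (X (grid_floor n t s) \<omega>)) + I \<omega>)))"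

text \<open>\<open>Z1 i\<close> is the random vector \<open>Z\<^sup>\<pi>\<^sup>,\<^sup>1\<close> at time \<open>t\<^sub>i\<close>. Since \<open>W\<close> is \<open>d\<close>-dimensional and \<open>Y\<close> is real,
  \<open>Z\<close> is a vector in \<open>\<real>\<^sup>d\<close> and \<open>\<integral> Z dW\<close> means \<open>\<integral> Z \<bullet> dW\<close>; for \<open>d = 1\<close> all processes are real.\<close>

definition backward_scheme ::
  "'w measure \<Rightarrow> real \<Rightarrow> nat \<Rightarrow> (nat \<Rightarrow> real) \<Rightarrow> (real \<Rightarrow> 'w \<Rightarrow> real^'d) \<Rightarrow> (real \<Rightarrow> 'w \<Rightarrow> real)
    \<Rightarrow> (real^'d \<Rightarrow> real)
    \<Rightarrow> ('w \<Rightarrow> real \<Rightarrow> real^'d \<Rightarrow> real \<Rightarrow> real^'d \<Rightarrow> real)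
    \<Rightarrow> ('w \<Rightarrow> real \<Rightarrow> real^'d \<Rightarrow> real \<Rightarrow> real^'d \<Rightarrow> real)
    \<Rightarrow> (real \<Rightarrow> 'w \<Rightarrow> real^'d)
    \<Rightarrow> (real \<Rightarrow> 'w \<Rightarrow> real) \<Rightarrow> (real \<Rightarrow> 'w \<Rightarrow> real^'d) \<Rightarrow> (nat \<Rightarrow> 'w \<Rightarrow> real^'d) \<Rightarrow> bool"
  where "backward_scheme M T n t W B \<phi> f g X Y Z Z1 \<longleftrightarrow>
    (AE \<omega> in M. Y (t n) \<omega> = \<phi> (X (t n) \<omega>)) \<and>
    (AE \<omega> in M. Z1 n \<omega> = 0) \<and>
    (\<forall>i<n. Z1 i \<in> borel_measurable (sigalg_F M T W B (t i)) \<and>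
      (AE \<omega> in M. Z1 i \<omega> = (1 / dt t (i + 1)) *\<^sub>R
         cond_exp_vec M (sigalg_F M T W B (t i))
           (\<lambda>\<omega>'. LINT r:{t i..t (i + 1)}|lborel. Z r \<omega>') \<omega>)) \<and>
    (\<forall>i\<in>{1..n}. \<forall>s\<in>{t (i - 1)..<t i}.
      Y s \<in> borel_measurable (sigalg_G M T W B (t (i - 1)) s) \<and>
      (\<exists>I. has_ito_integral M (sigalg_G M T W B (t (i - 1))) W s (t i) Z I \<and>
        (AE \<omega> in M. Y s \<omega> =
            Y (t i) \<omega>
          + f \<omega> (t i) (X (t i) \<omega>) (Y (t i) \<omega>) (Z1 i \<omega>) * dt t i
          + g \<omega> (t i) (X (t i) \<omega>) (Y (t i) \<omega>) (Z1 i \<omega>) * dP t B i \<omega>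
          - I \<omega>)))"


section \<open>The functions \<open>u\<^sub>i\<close> and \<open>v\<^sub>i\<close>\<close>

text \<open>The tuples \<open>(x\<^sub>0, \<dots>, x\<^sub>i)\<close> and \<open>(x\<^sub>i\<^sub>+\<^sub>1, \<dots>, x\<^sub>n)\<close> are given by maps \<open>xs\<close> and \<open>ys\<close> on the natural
  numbers, of which only the entries \<open>xs 0, \<dots>, xs i\<close> and \<open>ys (i + 1), \<dots>, ys n\<close> matter.
  Appending \<open>\<chi>\<close> to \<open>(x\<^sub>0, \<dots>, x\<^sub>i)\<close> is the update \<open>xs(i + 1 := \<chi>)\<close>.\<close>

definition euler_step ::
  "(real \<Rightarrow> 'w \<Rightarrow> real^'d) \<Rightarrow> (real^'d \<Rightarrow> real^'d) \<Rightarrow> (real^'d \<Rightarrow> real^'d^'d)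
    \<Rightarrow> real \<Rightarrow> real \<Rightarrow> real^'d \<Rightarrow> 'w \<Rightarrow> real^'d"
  where "euler_step W b \<sigma> s r x \<omega> = x + (r - s) *\<^sub>R b x + \<sigma> x *v (W r \<omega> - W s \<omega>)"

text \<open>\<open>UU\<close> and \<open>VV\<close> are the random variables \<open>U\<^sub>i\<close> and \<open>V\<^sub>i\<close> built from \<open>(u', v') = (u\<^sub>i\<^sub>+\<^sub>1, v\<^sub>i\<^sub>+\<^sub>1)\<close>.\<close>

definition UU ::
  "(nat \<Rightarrow> real) \<Rightarrow> (real \<Rightarrow> 'w \<Rightarrow> real^'d) \<Rightarrow> (real^'d \<Rightarrow> real^'d) \<Rightarrow> (real^'d \<Rightarrow> real^'d^'d)
    \<Rightarrow> ('w \<Rightarrow> real \<Rightarrow> real^'d \<Rightarrow> real \<Rightarrow> real^'d \<Rightarrow> real) \<Rightarrow> nat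
    \<Rightarrow> ((nat \<Rightarrow> real^'d) \<Rightarrow> (nat \<Rightarrow> real) \<Rightarrow> real) \<Rightarrow> ((nat \<Rightarrow> real^'d) \<Rightarrow> (nat \<Rightarrow> real) \<Rightarrow> real^'d)
    \<Rightarrow> (nat \<Rightarrow> real^'d) \<Rightarrow> 'w \<Rightarrow> (nat \<Rightarrow> real) \<Rightarrow> real"
  where "UU t W b \<sigma> f i u' v' xs \<omega> ys =
    (let x' = euler_step W b \<sigma> (t i) (t (i + 1)) (xs i) \<omega>; xs' = xs(i + 1 := x')
     in u' xs' ys + f \<omega> (t (i + 1)) x' (u' xs' ys) (v' xs' ys) * dt t (i + 1))"

definition VV ::
  "(nat \<Rightarrow> real) \<Rightarrow> (real \<Rightarrow> 'w \<Rightarrow> real^'d) \<Rightarrow> (real^'d \<Rightarrow> real^'d) \<Rightarrow> (real^'d \<Rightarrow> real^'d^'d)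
    \<Rightarrow> ('w \<Rightarrow> real \<Rightarrow> real^'d \<Rightarrow> real \<Rightarrow> real^'d \<Rightarrow> real) \<Rightarrow> nat
    \<Rightarrow> ((nat \<Rightarrow> real^'d) \<Rightarrow> (nat \<Rightarrow> real) \<Rightarrow> real) \<Rightarrow> ((nat \<Rightarrow> real^'d) \<Rightarrow> (nat \<Rightarrow> real) \<Rightarrow> real^'d)
    \<Rightarrow> (nat \<Rightarrow> real^'d) \<Rightarrow> 'w \<Rightarrow> (nat \<Rightarrow> real) \<Rightarrow> real"
  where "VV t W b \<sigma> g i u' v' xs \<omega> ys =
    (let x' = euler_step W b \<sigma> (t i) (t (i + 1)) (xs i) \<omega>; xs' = xs(i + 1 := x')
     in g \<omega> (t (i + 1)) x' (u' xs' ys) (v' xs' ys))"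

text \<open>\<open>uv_back \<dots> k = (u\<^sub>n\<^sub>-\<^sub>k, v\<^sub>n\<^sub>-\<^sub>k)\<close>, so that the backward induction is a recursion on \<open>k\<close>.\<close>

primrec uv_back ::
  "'w measure \<Rightarrow> nat \<Rightarrow> (nat \<Rightarrow> real) \<Rightarrow> (real \<Rightarrow> 'w \<Rightarrow> real^'d)
    \<Rightarrow> (real^'d \<Rightarrow> real^'d) \<Rightarrow> (real^'d \<Rightarrow> real^'d^'d) \<Rightarrow> (real^'d \<Rightarrow> real)
    \<Rightarrow> ('w \<Rightarrow> real \<Rightarrow> real^'d \<Rightarrow> real \<Rightarrow> real^'d \<Rightarrow> real)
    \<Rightarrow> ('w \<Rightarrow> real \<Rightarrow> real^'d \<Rightarrow> real \<Rightarrow> real^'d \<Rightarrow> real) \<Rightarrow> nat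
    \<Rightarrow> ((nat \<Rightarrow> real^'d) \<Rightarrow> (nat \<Rightarrow> real) \<Rightarrow> real) \<times> ((nat \<Rightarrow> real^'d) \<Rightarrow> (nat \<Rightarrow> real) \<Rightarrow> real^'d)"
  where
    "uv_back M n t W b \<sigma> \<phi> f g 0 = ((\<lambda>xs ys. \<phi> (xs n)), (\<lambda>xs ys. 0))"
  | "uv_back M n t W b \<sigma> \<phi> f g (Suc k) =
      (let i = n - Suc k;
           u' = fst (uv_back M n t W b \<sigma> \<phi> f g k);
           v' = snd (uv_back M n t W b \<sigma> \<phi> f g k);
           U = UU t W b \<sigma> f i u' v';
           V = VV t W b \<sigma> g i u' v'
       in ((\<lambda>xs ys. (\<integral>\<omega>. U xs \<omega> ys \<partial>M) + ys (i + 1) * (\<integral>\<omega>. V xs \<omega> ys \<partial>M)),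
           (\<lambda>xs ys. (1 / dt t (i + 1)) *\<^sub>R (\<integral>\<omega>. U xs \<omega> ys *\<^sub>R dP t W (i + 1) \<omega> \<partial>M)
                  + (ys (i + 1) / dt t (i + 1)) *\<^sub>R (\<integral>\<omega>. V xs \<omega> ys *\<^sub>R dP t W (i + 1) \<omega> \<partial>M))))"

definition u_pi ::
  "'w measure \<Rightarrow> nat \<Rightarrow> (nat \<Rightarrow> real) \<Rightarrow> (real \<Rightarrow> 'w \<Rightarrow> real^'d)
    \<Rightarrow> (real^'d \<Rightarrow> real^'d) \<Rightarrow> (real^'d \<Rightarrow> real^'d^'d) \<Rightarrow> (real^'d \<Rightarrow> real)
    \<Rightarrow> ('w \<Rightarrow> real \<Rightarrow> real^'d \<Rightarrow> real \<Rightarrow> real^'d \<Rightarrow> real)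
    \<Rightarrow> ('w \<Rightarrow> real \<Rightarrow> real^'d \<Rightarrow> real \<Rightarrow> real^'d \<Rightarrow> real) \<Rightarrow> nat
    \<Rightarrow> (nat \<Rightarrow> real^'d) \<Rightarrow> (nat \<Rightarrow> real) \<Rightarrow> real"
  where "u_pi M n t W b \<sigma> \<phi> f g i = fst (uv_back M n t W b \<sigma> \<phi> f g (n - i))"

definition v_pi ::
  "'w measure \<Rightarrow> nat \<Rightarrow> (nat \<Rightarrow> real) \<Rightarrow> (real \<Rightarrow> 'w \<Rightarrow> real^'d)
    \<Rightarrow> (real^'d \<Rightarrow> real^'d) \<Rightarrow> (real^'d \<Rightarrow> real^'d^'d) \<Rightarrow> (real^'d \<Rightarrow> real)
    \<Rightarrow> ('w \<Rightarrow> real \<Rightarrow> real^'d \<Rightarrow> real \<Rightarrow> real^'d \<Rightarrow> real)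
    \<Rightarrow> ('w \<Rightarrow> real \<Rightarrow> real^'d \<Rightarrow> real \<Rightarrow> real^'d \<Rightarrow> real) \<Rightarrow> nat
    \<Rightarrow> (nat \<Rightarrow> real^'d) \<Rightarrow> (nat \<Rightarrow> real) \<Rightarrow> real^'d"
  where "v_pi M n t W b \<sigma> \<phi> f g i = snd (uv_back M n t W b \<sigma> \<phi> f g (n - i))"


section \<open>Conditions on the random coefficients\<close>

definition joint_measurable_coeff ::
  "'w measure \<Rightarrow> real \<Rightarrow> ('w \<Rightarrow> real \<Rightarrow> real^'d \<Rightarrow> real \<Rightarrow> real^'d \<Rightarrow> real) \<Rightarrow> bool"
  where "joint_measurable_coeff M T f \<longleftrightarrow>
    (\<lambda>(\<omega>, s, x, y, z). f \<omega> s x y z)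
      \<in> borel_measurable (M \<Otimes>\<^sub>M restrict_space borel {0..T} \<Otimes>\<^sub>M borel \<Otimes>\<^sub>M borel \<Otimes>\<^sub>M borel)"

definition grad_z ::
  "('w \<Rightarrow> real \<Rightarrow> real^'d \<Rightarrow> real \<Rightarrow> real^'d \<Rightarrow> real)
    \<Rightarrow> 'w \<Rightarrow> real \<Rightarrow> real^'d \<Rightarrow> real \<Rightarrow> real^'d \<Rightarrow> real^'d"
  where "grad_z g \<omega> s x y z = (\<chi> j. partial_deriv (axis j 1) (\<lambda>z'. g \<omega> s x y z') z)"

text \<open>The functions \<open>u\<^sub>i\<close>, \<open>v\<^sub>i\<close> are defined by plain expectations, whereas \<open>Y\<close>, \<open>Z1\<close> are conditional
  expectations given \<open>\<F>\<close> at time \<open>t\<^sub>i\<close>. For coefficients \<open>f\<close>, \<open>g\<close> which depend on the whole past of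
  \<open>W\<close> or the whole future of \<open>B\<close> these do not agree: take \<open>b = \<sigma> = \<phi> = g = 0\<close>, \<open>d = 1\<close>, \<open>n \<ge> 2\<close> and
  \<open>f(\<omega>, s, x, y, z) = \<integral>\<^sub>0\<^sup>s cos W\<^sub>r dr\<close>; then \<open>u\<^sub>n\<^sub>-\<^sub>1\<close> is a constant, but \<open>Y\<close> at time \<open>t\<^sub>n\<^sub>-\<^sub>1\<close> is not.
  The condition below excludes this. If \<open>f\<close> and \<open>g\<close> do not
  depend on \<open>\<omega>\<close>, it follows from the independence of the increments of \<open>W\<close> and of \<open>W\<close> and \<open>B\<close>.\<close>

definition coeff_sigalg ::
  "'w measure \<Rightarrow> (nat \<Rightarrow> real) \<Rightarrow> (real \<Rightarrow> 'w \<Rightarrow> real^'d)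
    \<Rightarrow> ('w \<Rightarrow> real \<Rightarrow> real^'d \<Rightarrow> real \<Rightarrow> real^'d \<Rightarrow> real)
    \<Rightarrow> ('w \<Rightarrow> real \<Rightarrow> real^'d \<Rightarrow> real \<Rightarrow> real^'d \<Rightarrow> real) \<Rightarrow> nat \<Rightarrow> 'w measure"
  where "coeff_sigalg M t W f g i = sigma (space M)
    (preimage_events M {(\<lambda>\<omega>. f \<omega> (t i) x y z) |x y z. True} \<union>
     preimage_events M {(\<lambda>\<omega>. g \<omega> (t i) x y z) |x y z. True} \<union>
     preimage_events M {dP t W i})"

definition coeffs_indep_of_F ::
  "'w measure \<Rightarrow> real \<Rightarrow> nat \<Rightarrow> (nat \<Rightarrow> real) \<Rightarrow> (real \<Rightarrow> 'w \<Rightarrow> real^'d) \<Rightarrow> (real \<Rightarrow> 'w \<Rightarrow> real)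
    \<Rightarrow> ('w \<Rightarrow> real \<Rightarrow> real^'d \<Rightarrow> real \<Rightarrow> real^'d \<Rightarrow> real)
    \<Rightarrow> ('w \<Rightarrow> real \<Rightarrow> real^'d \<Rightarrow> real \<Rightarrow> real^'d \<Rightarrow> real) \<Rightarrow> bool"
  where "coeffs_indep_of_F M T n t W B f g \<longleftrightarrow>
    (\<forall>i\<in>{1..n}. indep_sigalg M (coeff_sigalg M t W f g i) (sigalg_F M T W B (t (i - 1))))"

end

theory Submission
  imports Defs
begin

text \<open>The proof is by backward induction on the grid. One step is the scheme
  \<open>Y\<^sub>i = R - \<integral> Z dW\<close>, where \<open>R = U\<^sub>i + \<Delta>B\<^sub>i\<^sub>+\<^sub>1 V\<^sub>i\<close> by the induction hypothesis and by
  \<open>X\<^sub>i\<^sub>+\<^sub>1 = euler_step X\<^sub>i\<close>. Conditioning on \<open>\<F>\<close> at time \<open>t\<^sub>i\<close> annihilates the stochastic integral, and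
  since \<open>R\<close> is a function of \<open>\<F>\<close>-measurable variables and of quantities independent of \<open>\<F>\<close>, its
  conditional expectation is a plain expectation with the \<open>\<F>\<close>-measurable variables frozen, that is
  \<open>u\<^sub>i\<close>. Multiplying the same equation by \<open>\<Delta>W\<^sub>i\<^sub>+\<^sub>1\<close> first, the covariance of the two stochastic
  integrals \<open>\<integral> Z dW\<close> and \<open>\<Delta>W\<^sub>i\<^sub>+\<^sub>1\<close> turns the left-hand side into \<open>E (\<integral> Z dr | \<F>)\<close>, which gives
  \<open>v\<^sub>i\<close>. The integrability that this needs follows from the bound
  \<open>\<bar>u\<^sub>i\<bar> + \<bar>v\<^sub>i\<bar> \<le> K (1 + \<bar>x\<^sub>i\<bar>) (1 + \<bar>x\<^sub>i\<^sub>+\<^sub>1\<bar>) \<dots> (1 + \<bar>x\<^sub>n\<bar>)\<close>.\<close>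

text \<open>The coefficients are random, and membership in \<open>space_M2\<close> with the Hoelder
  bound in time gives only second moments of \<open>f\<close> and \<open>g\<close> at a grid time;
  the other inputs have moments of every order. The growth bound is therefore arranged so that each
  backward step costs a single factor \<open>noise\<close>, which dominates everything random in
  that step and is merely square integrable. It is independent of \<open>sigalg_F\<close> at the
  left end of the step, hence of the polynomial weight, and no higher moment of it is ever needed. A
  second obstacle is that stochastic integrals are given only as mean square limits, over several
  different filtrations. They are all moved to one larger filtration, and their properties are
  obtained by passing to the limit in identities for elementary integrands, tested against events of
  the past. The process \<open>Z\<close> is never computed: only the zero mean of its integral and
  the covariance with the increment of \<open>W\<close> enter. In the equation multiplied by this
  increment the term with \<open>Y\<close> at the left end drops out, because that value is known
  before the increment begins.\<close>

lemma preimage_events_measurable: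
  assumes "preimage_events M \<X> \<subseteq> sets N" "space N = space M" "X \<in> \<X>"
  shows "X \<in> borel_measurable N"
proof (rule measurableI)
  fix A :: "'b set" assume "A \<in> sets borel"
  then have "X -` A \<inter> space M \<in> preimage_events M \<X>"
    using assms(3) unfolding preimage_events_def by blast
  then show "X -` A \<inter> space N \<in> sets N" using assms(1,2) by auto
qed simp

lemma preimage_events_subset_Pow: "preimage_events M \<X> \<subseteq> Pow (space M)"
  unfolding preimage_events_def by auto

lemma measurable_sigma_preimage_events:
  "X \<in> \<X> \<Longrightarrow> X \<in> borel_measurable (sigma (space M) (preimage_events M \<X>))"
  by (rule preimage_events_measurable[of M \<X>]) (auto simp: preimage_events_subset_Pow)

lemma preimage_events_subset_sets:
  assumes "space N = space M" "\<And>X. X \<in> \<X> \<Longrightarrow> X \<in> borel_measurable N"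
  shows "preimage_events M \<X> \<subseteq> sets N"
  unfolding preimage_events_def assms(1)[symmetric]
  using assms(2) by (auto intro: measurable_sets)

lemma sets_sigma_subset:
  assumes "\<A> \<subseteq> sets N" "space N = space M"
  shows "sets (sigma (space M) \<A>) \<subseteq> sets N"
proof -
  have "\<A> \<subseteq> Pow (space M)"
    using assms sets.space_closed[of N] by simp
  then show ?thesis
    using assms sets.sigma_sets_subset[of \<A> N] by simp
qed

lemma subalgebra_sigma:
  assumes "\<A> \<subseteq> sets N" "space N = space M"
  shows "subalgebra N (sigma (space M) \<A>)"
  unfolding subalgebra_def using sets_sigma_subset[OF assms] assms(2) by (simp add: space_measure_of_conv)

text \<open>The events of \<open>X\<close> lie in \<open>F\<close> and those of \<open>Y\<close> in
  \<open>G\<close>, and independence passes to smaller families. Since \<open>indep_set\<close>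
  includes that both families consist of events, measurability over \<open>M\<close> comes with
  it.\<close>

lemma (in prob_space) indep_var_of_indep_sigalg:
  assumes "indep_sigalg M F G" "space F = space M" "space G = space M"
    "X \<in> measurable F N1" "Y \<in> measurable G N2"
  shows "indep_var N1 X N2 Y"
proof -
  have i: "indep_set (sets F) (sets G)" using assms(1) unfolding indep_sigalg_def .
  then have sub: "sets F \<subseteq> events" "sets G \<subseteq> events" by (auto simp: indep_sets2_eq)
  have F: "subalgebra M F" and G: "subalgebra M G" using sub assms by (auto simp: subalgebra_def)
  have 1: "sigma_sets (space M) {X -` A \<inter> space M |A. A \<in> sets N1} \<subseteq> sets F"
    using assms(2,4) by (intro sets.sigma_sets_subset[of _ F, unfolded assms(2)])
      (auto simp flip: assms(2) intro: measurable_sets)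
  have 2: "sigma_sets (space M) {Y -` A \<inter> space M |A. A \<in> sets N2} \<subseteq> sets G"
    using assms(3,5) by (intro sets.sigma_sets_subset[of _ G, unfolded assms(3)])
      (auto simp flip: assms(3) intro: measurable_sets)
  show ?thesis
    unfolding indep_var_eq
  proof (intro conjI)
    show "indep_set (sigma_sets (space M) {X -` A \<inter> space M |A. A \<in> sets N1})
      (sigma_sets (space M) {Y -` A \<inter> space M |A. A \<in> sets N2})"
      using 1 2 sub indep_setD[OF i] by (intro indep_setI) (blast intro: order_trans)+
  qed (use measurable_from_subalg[OF F assms(4)] measurable_from_subalg[OF G assms(5)] in auto)
qed

section \<open>Random variables with moments of all orders\<close>

definition finite_moments :: "'w measure \<Rightarrow> ('w \<Rightarrow> real) \<Rightarrow> bool"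
  where "finite_moments M X \<longleftrightarrow> X \<in> borel_measurable M \<and> (\<forall>k::nat. integrable M (\<lambda>\<omega>. \<bar>X \<omega>\<bar> ^ k))"

lemma finite_moments_measurable: "finite_moments M X \<Longrightarrow> X \<in> borel_measurable M"
  unfolding finite_moments_def by simp

lemma finite_moments_bound:
  assumes "finite_moments M Y" "X \<in> borel_measurable M" "AE \<omega> in M. \<bar>X \<omega>\<bar> \<le> \<bar>Y \<omega>\<bar>"
  shows "finite_moments M X"
  unfolding finite_moments_def
proof (intro conjI allI assms)
  fix k :: nat
  show "integrable M (\<lambda>\<omega>. \<bar>X \<omega>\<bar> ^ k)"
    by (rule Bochner_Integration.integrable_bound[of M "\<lambda>\<omega>. \<bar>Y \<omega>\<bar> ^ k"])
      (use assms in \<open>auto simp: finite_moments_def simp del: power_abs intro!: power_mono\<close>)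
qed

text \<open>A moment of order \<open>k\<close> of a product needs order \<open>2 * k\<close> of the
  factors; demanding all orders at once is what makes the class closed under products.\<close>

lemma finite_moments_mult:
  assumes "finite_moments M X" "finite_moments M Y"
  shows "finite_moments M (\<lambda>\<omega>. X \<omega> * Y \<omega>)"
  unfolding finite_moments_def
proof (intro conjI allI)
  have [measurable]: "X \<in> borel_measurable M" "Y \<in> borel_measurable M"
    using assms by (auto simp: finite_moments_def)
  show "(\<lambda>\<omega>. X \<omega> * Y \<omega>) \<in> borel_measurable M" by measurable
  fix k :: nat
  have *: "\<bar>a * b\<bar> ^ k \<le> \<bar>a\<bar> ^ (2 * k) + \<bar>b\<bar> ^ (2 * k)" for a b :: real
  proof -
    have "2 * (\<bar>a\<bar> ^ k * \<bar>b\<bar> ^ k) \<le> (\<bar>a\<bar> ^ k)\<^sup>2 + (\<bar>b\<bar> ^ k)\<^sup>2"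
      using sum_squares_bound[of "\<bar>a\<bar> ^ k" "\<bar>b\<bar> ^ k"] by (simp add: mult.assoc)
    then have "2 * \<bar>a * b\<bar> ^ k \<le> \<bar>a\<bar> ^ (2 * k) + \<bar>b\<bar> ^ (2 * k)"
      unfolding power_even_eq by (simp add: abs_mult power_mult_distrib)
    moreover have "0 \<le> \<bar>a * b\<bar> ^ k" by simp
    ultimately show ?thesis by linarith
  qed
  show "integrable M (\<lambda>\<omega>. \<bar>X \<omega> * Y \<omega>\<bar> ^ k)"
    by (rule Bochner_Integration.integrable_bound[of M "\<lambda>\<omega>. \<bar>X \<omega>\<bar> ^ (2 * k) + \<bar>Y \<omega>\<bar> ^ (2 * k)"])
      (use assms * in \<open>auto simp: finite_moments_def\<close>)
qed

lemma finite_moments_add: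
  assumes "finite_moments M X" "finite_moments M Y"
  shows "finite_moments M (\<lambda>\<omega>. X \<omega> + Y \<omega>)"
  unfolding finite_moments_def
proof (intro conjI allI)
  have [measurable]: "X \<in> borel_measurable M" "Y \<in> borel_measurable M"
    using assms by (auto simp: finite_moments_def)
  show "(\<lambda>\<omega>. X \<omega> + Y \<omega>) \<in> borel_measurable M" by measurable
  fix k :: nat
  have *: "\<bar>a + b\<bar> ^ k \<le> 2 ^ k * (\<bar>a\<bar> ^ k + \<bar>b\<bar> ^ k)" for a b :: real
  proof -
    have "\<bar>a + b\<bar> ^ k \<le> (2 * max \<bar>a\<bar> \<bar>b\<bar>) ^ k" by (rule power_mono) auto
    also have "\<dots> \<le> 2 ^ k * (\<bar>a\<bar> ^ k + \<bar>b\<bar> ^ k)"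
      by (auto simp: power_mult_distrib max_def)
    finally show ?thesis .
  qed
  show "integrable M (\<lambda>\<omega>. \<bar>X \<omega> + Y \<omega>\<bar> ^ k)"
    by (rule Bochner_Integration.integrable_bound[of M "\<lambda>\<omega>. 2 ^ k * (\<bar>X \<omega>\<bar> ^ k + \<bar>Y \<omega>\<bar> ^ k)"])
      (use assms * in \<open>auto simp: finite_moments_def\<close>)
qed

lemma (in prob_space) finite_moments_bounded:
  assumes "X \<in> borel_measurable M" "\<And>\<omega>. \<omega> \<in> space M \<Longrightarrow> \<bar>X \<omega>\<bar> \<le> C"
  shows "finite_moments M X"
proof -
  have "finite_moments M (\<lambda>\<omega>. C)" by (simp add: finite_moments_def)
  then show ?thesis by (rule finite_moments_bound) (use assms in force)+
qed

lemma finite_moments_abs: "finite_moments M X \<Longrightarrow> finite_moments M (\<lambda>\<omega>. \<bar>X \<omega>\<bar>)"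
  unfolding finite_moments_def by auto

lemma (in prob_space) finite_moments_sum:
  assumes "\<And>i. i \<in> A \<Longrightarrow> finite_moments M (X i)"
  shows "finite_moments M (\<lambda>\<omega>. \<Sum>i\<in>A. X i \<omega>)"
  using assms
  by (induction A rule: infinite_finite_induct)
    (auto intro: finite_moments_add finite_moments_bounded[of _ 0])

lemma (in prob_space) finite_moments_prod:
  assumes "\<And>i. i \<in> A \<Longrightarrow> finite_moments M (X i)"
  shows "finite_moments M (\<lambda>\<omega>. \<Prod>i\<in>A. X i \<omega>)"
  using assms
  by (induction A rule: infinite_finite_induct)
    (auto intro: finite_moments_mult finite_moments_bounded[of _ 1])

lemma finite_moments_integrable:
  assumes "finite_moments M X" shows "integrable M X"
proof -
  have "integrable M (\<lambda>\<omega>. \<bar>X \<omega>\<bar> ^ 1)" "X \<in> borel_measurable M"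
    using assms unfolding finite_moments_def by blast+
  then show ?thesis by (simp add: integrable_abs_iff)
qed

lemma finite_moments_square_integrable:
  assumes "finite_moments M X" shows "integrable M (\<lambda>\<omega>. (X \<omega>)\<^sup>2)"
  using assms unfolding finite_moments_def by (metis (no_types, lifting) Bochner_Integration.integrable_cong power2_abs)

lemma (in prob_space) finite_moments_norm:
  fixes X :: "'a \<Rightarrow> 'b::euclidean_space"
  assumes "X \<in> borel_measurable M" "\<And>e. e \<in> Basis \<Longrightarrow> finite_moments M (\<lambda>\<omega>. X \<omega> \<bullet> e)"
  shows "finite_moments M (\<lambda>\<omega>. norm (X \<omega>))"
proof (rule finite_moments_bound)
  show "finite_moments M (\<lambda>\<omega>. \<Sum>e\<in>Basis. \<bar>X \<omega> \<bullet> e\<bar>)"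
    by (intro finite_moments_sum finite_moments_abs assms)
  show "AE \<omega> in M. \<bar>norm (X \<omega>)\<bar> \<le> \<bar>\<Sum>e\<in>Basis. \<bar>X \<omega> \<bullet> e\<bar>\<bar>"
    by (auto intro!: order_trans[OF norm_le_l1])
qed (use assms in simp)

section \<open>Gaussian increments\<close>

abbreviation gauss_density :: "real \<Rightarrow> 'a::euclidean_space \<Rightarrow> ennreal"
  where "gauss_density \<rho> x \<equiv> ennreal (\<Prod>e\<in>Basis. normal_density 0 \<rho> (x \<bullet> e))"

text \<open>Density and integrand are products over the coordinates and \<open>lborel\<close> is a
  product measure, so Tonelli splits the integral.\<close>

lemma (in prob_space) gaussian_vector_nn_integral:
  fixes D :: "'a \<Rightarrow> 'b::euclidean_space"
  assumes D: "distributed M lborel D (gauss_density \<rho>)"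
    and [measurable]: "\<And>e. F e \<in> borel_measurable borel" and nn: "\<And>e x. 0 \<le> F e x"
  shows "(\<integral>\<^sup>+\<omega>. ennreal (\<Prod>e\<in>Basis. F e (D \<omega> \<bullet> e)) \<partial>M)
    = (\<Prod>e\<in>Basis. \<integral>\<^sup>+x. ennreal (normal_density 0 \<rho> x * F e x) \<partial>lborel)"
proof -
  have "(\<integral>\<^sup>+\<omega>. ennreal (\<Prod>e\<in>Basis. F e (D \<omega> \<bullet> e)) \<partial>M) =
     (\<integral>\<^sup>+x. ennreal (\<Prod>e\<in>Basis. normal_density 0 \<rho> (x \<bullet> e)) * ennreal (\<Prod>e\<in>Basis. F e (x \<bullet> e)) \<partial>lborel)"
    by (rule distributed_nn_integral[OF D, symmetric]) simp
  also have "\<dots> = (\<integral>\<^sup>+x. (\<Prod>e\<in>Basis. ennreal (normal_density 0 \<rho> (x \<bullet> e) * F e (x \<bullet> e))) \<partial>lborel)"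
    by (simp add: prod_ennreal nn ennreal_mult[symmetric] prod_nonneg prod.distrib)
  also have "\<dots> = (\<Prod>e\<in>Basis. \<integral>\<^sup>+x. ennreal (normal_density 0 \<rho> x * F e x) \<partial>lborel)"
    by (rule nn_integral_lborel_prod) (auto simp: nn)
  finally show ?thesis .
qed

text \<open>The indicator of a box is a product of one-dimensional indicators. Marginals and
  independence of the components are both read off from this formula.\<close>

lemma (in prob_space) gaussian_box:
  fixes D :: "'a \<Rightarrow> 'b::euclidean_space"
  assumes D: "distributed M lborel D (gauss_density \<rho>)"
    and [measurable]: "\<And>e. A e \<in> sets borel"
  shows "emeasure M {\<omega>\<in>space M. \<forall>e\<in>Basis. D \<omega> \<bullet> e \<in> A e}
    = (\<Prod>e\<in>Basis. emeasure (density lborel (normal_density 0 \<rho>)) (A e))"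
proof -
  have [measurable]: "D \<in> borel_measurable M"
    using distributed_measurable[OF D] by simp
  have "emeasure M {\<omega>\<in>space M. \<forall>e\<in>Basis. D \<omega> \<bullet> e \<in> A e}
    = (\<integral>\<^sup>+\<omega>. indicator {\<omega>\<in>space M. \<forall>e\<in>Basis. D \<omega> \<bullet> e \<in> A e} \<omega> \<partial>M)"
    by (intro nn_integral_indicator[symmetric]) measurable
  also have "\<dots> = (\<integral>\<^sup>+\<omega>. ennreal (\<Prod>e\<in>Basis. indicator (A e) (D \<omega> \<bullet> e)) \<partial>M)"
  proof (rule nn_integral_cong)
    fix \<omega> assume "\<omega> \<in> space M"
    show "indicator {\<omega>\<in>space M. \<forall>e\<in>Basis. D \<omega> \<bullet> e \<in> A e} \<omega> = ennreal (\<Prod>e\<in>Basis. indicator (A e) (D \<omega> \<bullet> e))"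
    proof (cases "\<forall>e\<in>Basis. D \<omega> \<bullet> e \<in> A e")
      case True
      then have "(\<Prod>e\<in>Basis. indicator (A e) (D \<omega> \<bullet> e)) = (1::real)" by (intro prod.neutral) simp
      with True \<open>\<omega> \<in> space M\<close> show ?thesis by simp
    next
      case False
      then have "(\<Prod>e\<in>Basis. indicator (A e) (D \<omega> \<bullet> e)) = (0::real)" by (auto simp: indicator_def)
      then show ?thesis using False by (simp del: prod_zero_iff)
    qed
  qed
  also have "\<dots> = (\<Prod>e\<in>Basis. \<integral>\<^sup>+x. ennreal (normal_density 0 \<rho> x * indicator (A e) x) \<partial>lborel)"
    by (rule gaussian_vector_nn_integral[OF D]) auto
  also have "\<dots> = (\<Prod>e\<in>Basis. emeasure (density lborel (normal_density 0 \<rho>)) (A e))"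
    by (simp add: emeasure_density ennreal_mult' ennreal_indicator)
  finally show ?thesis .
qed

lemma (in prob_space) gaussian_component:
  fixes D :: "'a \<Rightarrow> 'b::euclidean_space"
  assumes D: "distributed M lborel D (gauss_density \<rho>)"
    and "0 < \<rho>" and c: "c \<in> Basis"
  shows "distributed M lborel (\<lambda>\<omega>. D \<omega> \<bullet> c) (\<lambda>x. ennreal (normal_density 0 \<rho> x))"
  unfolding distributed_def
proof (intro conjI)
  have [measurable]: "D \<in> borel_measurable M"
    using distributed_measurable[OF D] by simp
  show "(\<lambda>\<omega>. D \<omega> \<bullet> c) \<in> measurable M lborel" by simp
  interpret N: prob_space "density lborel (normal_density 0 \<rho>)"
    by (rule prob_space_normal_density[OF \<open>0 < \<rho>\<close>])
  show "distr M lborel (\<lambda>\<omega>. D \<omega> \<bullet> c) = density lborel (\<lambda>x. ennreal (normal_density 0 \<rho> x))"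
  proof (rule measure_eqI)
    fix A assume "A \<in> sets (distr M lborel (\<lambda>\<omega>. D \<omega> \<bullet> c))"
    then have A: "A \<in> sets borel" by simp
    \<comment> \<open>Only the side \<open>c\<close> of the box is restricted; every other factor is
      the total mass 1.\<close>
    have "(\<lambda>\<omega>. D \<omega> \<bullet> c) -` A \<inter> space M = {\<omega>\<in>space M. \<forall>e\<in>Basis. D \<omega> \<bullet> e \<in> (if e = c then A else UNIV)}"
      using c by auto
    then show "emeasure (distr M lborel (\<lambda>\<omega>. D \<omega> \<bullet> c)) A =
      emeasure (density lborel (\<lambda>x. ennreal (normal_density 0 \<rho> x))) A"
      using gaussian_box[OF D, of "\<lambda>e. if e = c then A else UNIV"] A c N.emeasure_space_1
      by (simp add: emeasure_distr if_distrib[of "emeasure _"] prod.delta cong: if_cong)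
  qed simp
qed simp

lemma (in prob_space) gaussian_component_moments:
  fixes D :: "'a \<Rightarrow> 'b::euclidean_space"
  assumes D: "distributed M lborel D (gauss_density \<rho>)"
    and "0 < \<rho>" and e: "e \<in> Basis"
  shows "finite_moments M (\<lambda>\<omega>. D \<omega> \<bullet> e)"
  unfolding finite_moments_def
proof (intro conjI allI)
  have "D \<in> borel_measurable M" using distributed_measurable[OF D] by simp
  then show "(\<lambda>\<omega>. D \<omega> \<bullet> e) \<in> borel_measurable M" by simp
  fix k :: nat
  have "integrable lborel (\<lambda>x. normal_density 0 \<rho> x * \<bar>x\<bar> ^ k)"
    using integrable_normal_moment_abs[OF \<open>0 < \<rho>\<close>, of 0 k] by simp
  then show "integrable M (\<lambda>\<omega>. \<bar>D \<omega> \<bullet> e\<bar> ^ k)"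
    by (subst distributed_integrable[OF gaussian_component[OF D \<open>0 < \<rho>\<close> e], symmetric]) auto
qed

lemma (in prob_space) gaussian_norm_moments:
  fixes D :: "'a \<Rightarrow> 'b::euclidean_space"
  assumes D: "distributed M lborel D (gauss_density \<rho>)"
    and "0 < \<rho>"
  shows "finite_moments M (\<lambda>\<omega>. norm (D \<omega>))"
  using distributed_measurable[OF D] gaussian_component_moments[OF assms]
  by (intro finite_moments_norm) auto

text \<open>A box restricted in two directions only has the product of the two marginal
  probabilities, and the families of preimages are stable under intersection.\<close>

lemma (in prob_space) gaussian_components_indep:
  fixes D :: "'a \<Rightarrow> 'b::euclidean_space"
  assumes D: "distributed M lborel D (gauss_density \<rho>)"
    and "0 < \<rho>" and c: "c \<in> Basis" "d \<in> Basis" "c \<noteq> d"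
  shows "indep_var borel (\<lambda>\<omega>. D \<omega> \<bullet> c) borel (\<lambda>\<omega>. D \<omega> \<bullet> d)"
proof -
  let ?p = "\<lambda>e A. (\<lambda>\<omega>. D \<omega> \<bullet> e) -` A \<inter> space M" and ?\<mu> = "density lborel (normal_density 0 \<rho>)"
  have [measurable]: "D \<in> borel_measurable M"
    using distributed_measurable[OF D] by simp
  interpret N: prob_space ?\<mu> by (rule prob_space_normal_density[OF \<open>0 < \<rho>\<close>])
  have *: "prob (?p c A \<inter> ?p d B) = prob (?p c A) * prob (?p d B)" if A: "A \<in> sets borel" "B \<in> sets borel" for A B
  proof -
    define E where "E e = (if e = c then A else if e = d then B else UNIV)" for e
    have "?p c A \<inter> ?p d B = {\<omega>\<in>space M. \<forall>e\<in>Basis. D \<omega> \<bullet> e \<in> E e}"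
      using c by (auto simp: E_def)
    then have "emeasure M (?p c A \<inter> ?p d B) = (\<Prod>e\<in>Basis. emeasure ?\<mu> (E e))"
      using gaussian_box[OF D, of E] A by (simp add: E_def)
    also have "\<dots> = (\<Prod>e\<in>Basis. (if e = c then emeasure ?\<mu> A else 1) * (if e = d then emeasure ?\<mu> B else 1))"
      using c N.emeasure_space_1 by (intro prod.cong) (auto simp: E_def)
    also have "\<dots> = emeasure ?\<mu> A * emeasure ?\<mu> B"
      using c by (simp add: prod.distrib)
    also have "\<dots> = emeasure M (?p c A) * emeasure M (?p d B)"
      using distributed_emeasure[OF gaussian_component[OF D \<open>0 < \<rho>\<close> c(1)], of A]
        distributed_emeasure[OF gaussian_component[OF D \<open>0 < \<rho>\<close> c(2)], of B] A
      by (simp add: emeasure_density)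
    finally show ?thesis by (simp add: emeasure_eq_measure ennreal_mult[symmetric])
  qed
  have Int: "Int_stable {X -` A \<inter> space M |A. A \<in> sets borel}" for X :: "'a \<Rightarrow> real"
  proof (rule Int_stableI)
    fix a b assume "a \<in> {X -` A \<inter> space M |A. A \<in> sets borel}" "b \<in> {X -` A \<inter> space M |A. A \<in> sets borel}"
    then obtain A B where "a = X -` A \<inter> space M" "b = X -` B \<inter> space M" "A \<in> sets borel" "B \<in> sets borel" by blast
    then show "a \<inter> b \<in> {X -` A \<inter> space M |A. A \<in> sets borel}"
      by (intro CollectI exI[of _ "A \<inter> B"]) auto
  qed
  have "indep_set {?p c A |A. A \<in> sets borel} {?p d A |A. A \<in> sets borel}"
    by (rule indep_setI) (auto simp: *)
  from indep_set_sigma_sets[OF this Int Int]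
  show ?thesis
    unfolding indep_var_eq by auto
qed

section \<open>Brownian increments relative to a filtration\<close>

locale bm_filtration = prob_space M for M :: "'w measure" +
  fixes T :: real and W :: "real \<Rightarrow> 'w \<Rightarrow> 'a::euclidean_space" and H :: "real \<Rightarrow> 'w measure"
  assumes subalgebra_H: "\<And>s. 0 \<le> s \<Longrightarrow> s \<le> T \<Longrightarrow> subalgebra M (H s)"
    and H_mono: "\<And>s r. 0 \<le> s \<Longrightarrow> s \<le> r \<Longrightarrow> r \<le> T \<Longrightarrow> subalgebra (H r) (H s)"
    and incr_H: "\<And>s r. 0 \<le> s \<Longrightarrow> s \<le> r \<Longrightarrow> r \<le> T \<Longrightarrow> (\<lambda>\<omega>. W r \<omega> - W s \<omega>) \<in> borel_measurable (H r)"
    and incr_indep: "\<And>s r. 0 \<le> s \<Longrightarrow> s < r \<Longrightarrow> r \<le> T \<Longrightarrow>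
      indep_sigalg M (H s) (sigma (space M) (preimage_events M {\<lambda>\<omega>. W r \<omega> - W s \<omega>}))"
    and incr_gauss: "\<And>s r. 0 \<le> s \<Longrightarrow> s < r \<Longrightarrow> r \<le> T \<Longrightarrow> distributed M lborel (\<lambda>\<omega>. W r \<omega> - W s \<omega>)
        (gauss_density (sqrt (r - s)))"
begin

lemma space_H: "0 \<le> s \<Longrightarrow> s \<le> T \<Longrightarrow> space (H s) = space M"
  using subalgebra_H by (auto simp: subalgebra_def)

lemma measurable_H: "0 \<le> s \<Longrightarrow> s \<le> T \<Longrightarrow> X \<in> measurable (H s) N \<Longrightarrow> X \<in> measurable M N"
  using measurable_from_subalg[OF subalgebra_H] .

lemma measurable_H_mono:
  "0 \<le> s \<Longrightarrow> s \<le> r \<Longrightarrow> r \<le> T \<Longrightarrow> X \<in> measurable (H s) N \<Longrightarrow> X \<in> measurable (H r) N"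
  using measurable_from_subalg[OF H_mono] .

abbreviation dW :: "real \<Rightarrow> real \<Rightarrow> 'w \<Rightarrow> 'a"
  where "dW s r \<omega> \<equiv> W r \<omega> - W s \<omega>"

lemma incr_measurable: "0 \<le> s \<Longrightarrow> s \<le> r \<Longrightarrow> r \<le> T \<Longrightarrow> dW s r \<in> borel_measurable M"
  by (rule measurable_H[OF _ _ incr_H]) auto

lemma incr_component:
  assumes "0 \<le> s" "s < r" "r \<le> T" "e \<in> Basis"
  shows "distributed M lborel (\<lambda>\<omega>. dW s r \<omega> \<bullet> e) (\<lambda>x. ennreal (normal_density 0 (sqrt (r - s)) x))"
  using assms by (intro gaussian_component[OF incr_gauss]) auto

lemma finite_moments_incr_component:
  assumes "0 \<le> s" "s \<le> r" "r \<le> T" "e \<in> Basis"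
  shows "finite_moments M (\<lambda>\<omega>. dW s r \<omega> \<bullet> e)"
proof (cases "s = r")
  case True
  then show ?thesis by (auto intro!: finite_moments_bounded[of _ 0])
next
  case False
  then have "s < r" using assms by simp
  then show ?thesis
    using assms gaussian_component_moments[OF incr_gauss[of s r]] by simp
qed

lemma finite_moments_incr:
  assumes "0 \<le> s" "s \<le> r" "r \<le> T"
  shows "finite_moments M (\<lambda>\<omega>. norm (dW s r \<omega>))"
  by (rule finite_moments_norm) (use assms incr_measurable finite_moments_incr_component in auto)

lemma expectation_incr:
  assumes "0 \<le> s" "s \<le> r" "r \<le> T" "e \<in> Basis"
  shows "expectation (\<lambda>\<omega>. dW s r \<omega> \<bullet> e) = 0"
proof (cases "s = r")
  case False
  then have "s < r" using assms by simp
  have "expectation (\<lambda>\<omega>. dW s r \<omega> \<bullet> e) = (\<integral>x. normal_density 0 (sqrt (r - s)) x * x \<partial>lborel)"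
    by (subst distributed_integral[OF incr_component[OF assms(1) \<open>s < r\<close> assms(3,4)], symmetric]) auto
  also have "\<dots> = 0"
    using integral_normal_moment_nz_1[of "sqrt (r - s)" 0] \<open>s < r\<close> by simp
  finally show ?thesis .
qed simp

lemma expectation_incr_incr:
  assumes "0 \<le> s" "s \<le> r" "r \<le> T" "e \<in> Basis" "d \<in> Basis"
  shows "expectation (\<lambda>\<omega>. (dW s r \<omega> \<bullet> e) * (dW s r \<omega> \<bullet> d)) = (if e = d then r - s else 0)"
proof (cases "s = r")
  case False
  then have "s < r" using assms by simp
  show ?thesis
  proof (cases "e = d")
    case True
    have "expectation (\<lambda>\<omega>. (dW s r \<omega> \<bullet> e)\<^sup>2) = (\<integral>x. normal_density 0 (sqrt (r - s)) x * x\<^sup>2 \<partial>lborel)"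
      by (subst distributed_integral[OF incr_component[OF assms(1) \<open>s < r\<close> assms(3,4)], symmetric]) auto
    also have "\<dots> = r - s"
      using integral_normal_moment_even[of "sqrt (r - s)" 0 1] \<open>s < r\<close> by (simp add: fact_2)
    finally show ?thesis using True by (simp add: power2_eq_square)
  next
    case False
    have "indep_var borel (\<lambda>\<omega>. dW s r \<omega> \<bullet> e) borel (\<lambda>\<omega>. dW s r \<omega> \<bullet> d)"
      using gaussian_components_indep[OF incr_gauss[OF assms(1) \<open>s < r\<close> assms(3)]] assms False \<open>s < r\<close> by simp
    from indep_var_lebesgue_integral[OF this]
    show ?thesis
      using assms False by (simp add: expectation_incr finite_moments_integrable finite_moments_incr_component)
  qed
qed simp

lemma incr_indep_var:
  assumes "0 \<le> s" "s < r" "r \<le> T" "\<zeta> \<in> measurable (H s) N1" "F \<in> measurable borel N2"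
  shows "indep_var N1 \<zeta> N2 (\<lambda>\<omega>. F (dW s r \<omega>))"
proof (rule indep_var_of_indep_sigalg[OF incr_indep[OF assms(1-3)]])
  have "dW s r \<in> borel_measurable (sigma (space M) (preimage_events M {\<lambda>\<omega>. dW s r \<omega>}))"
    by (rule measurable_sigma_preimage_events) simp
  from measurable_compose[OF this assms(5)]
  show "(\<lambda>\<omega>. F (dW s r \<omega>)) \<in> measurable (sigma (space M) (preimage_events M {\<lambda>\<omega>. dW s r \<omega>})) N2" .
qed (use assms space_H in \<open>auto simp: space_measure_of_conv\<close>)

text \<open>Independence factorizes the expectation and the increment is centred. The case
  \<open>s = r\<close> is included because partitions of simple integrands may contain empty
  intervals.\<close>

lemma
  assumes "0 \<le> s" "s \<le> r" "r \<le> T" "e \<in> Basis" "\<zeta> \<in> borel_measurable (H s)" "integrable M \<zeta>"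
  shows integrable_mult_incr: "integrable M (\<lambda>\<omega>. \<zeta> \<omega> * (dW s r \<omega> \<bullet> e))" (is ?A)
    and expectation_mult_incr: "expectation (\<lambda>\<omega>. \<zeta> \<omega> * (dW s r \<omega> \<bullet> e)) = 0" (is ?B)
proof -
  have "?A \<and> ?B"
  proof (cases "s = r")
    case False
    then have "s < r" using assms by simp
    have i: "indep_var borel \<zeta> borel (\<lambda>\<omega>. dW s r \<omega> \<bullet> e)"
      by (rule incr_indep_var) (use assms \<open>s < r\<close> in auto)
    show ?thesis
      using indep_var_integrable[OF i] indep_var_lebesgue_integral[OF i] assms
      by (simp add: expectation_incr finite_moments_integrable finite_moments_incr_component)
  qed simp
  then show ?A ?B by auto
qed

text \<open>Independence again, now with the second moments of the increment: distinct coordinates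
  are uncorrelated and each has variance \<open>r - s\<close>.\<close>

lemma
  assumes "0 \<le> s" "s \<le> r" "r \<le> T" "e \<in> Basis" "d \<in> Basis" "\<zeta> \<in> borel_measurable (H s)" "integrable M \<zeta>"
  shows integrable_mult_incr_incr:
      "integrable M (\<lambda>\<omega>. \<zeta> \<omega> * ((dW s r \<omega> \<bullet> e) * (dW s r \<omega> \<bullet> d)))" (is ?A)
    and expectation_mult_incr_incr:
      "expectation (\<lambda>\<omega>. \<zeta> \<omega> * ((dW s r \<omega> \<bullet> e) * (dW s r \<omega> \<bullet> d)))
       = (if e = d then r - s else 0) * expectation \<zeta>" (is ?B)
proof -
  have "?A \<and> ?B"
  proof (cases "s = r")
    case False
    then have "s < r" using assms by simp
    have i: "indep_var borel \<zeta> borel (\<lambda>\<omega>. (dW s r \<omega> \<bullet> e) * (dW s r \<omega> \<bullet> d))"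
      by (rule incr_indep_var) (use assms \<open>s < r\<close> in auto)
    have "integrable M (\<lambda>\<omega>. (dW s r \<omega> \<bullet> e) * (dW s r \<omega> \<bullet> d))"
      using assms by (intro finite_moments_integrable finite_moments_mult finite_moments_incr_component) auto
    then show ?thesis
      using indep_var_integrable[OF i] indep_var_lebesgue_integral[OF i] assms
      by (simp add: expectation_incr_incr)
  qed simp
  then show ?A ?B by auto
qed

definition bdd_at :: "real \<Rightarrow> ('w \<Rightarrow> 'a) \<Rightarrow> bool"
  where "bdd_at s \<xi> \<longleftrightarrow> \<xi> \<in> borel_measurable (H s) \<and> bounded (\<xi> ` space M)"

lemma bdd_at_mono: "bdd_at s \<xi> \<Longrightarrow> 0 \<le> s \<Longrightarrow> s \<le> r \<Longrightarrow> r \<le> T \<Longrightarrow> bdd_at r \<xi>"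
  unfolding bdd_at_def using measurable_H_mono by blast

lemma bdd_at_component:
  assumes "bdd_at s \<xi>" "0 \<le> s" "s \<le> T"
  shows "finite_moments M (\<lambda>\<omega>. \<xi> \<omega> \<bullet> e)" "(\<lambda>\<omega>. \<xi> \<omega> \<bullet> e) \<in> borel_measurable (H s)"
proof -
  have h: "\<xi> \<in> borel_measurable (H s)" using assms(1) by (simp add: bdd_at_def)
  then show "(\<lambda>\<omega>. \<xi> \<omega> \<bullet> e) \<in> borel_measurable (H s)" by simp
  have "\<xi> \<in> borel_measurable M" using measurable_H[OF assms(2,3) h] .
  moreover obtain C where C: "\<And>\<omega>. \<omega> \<in> space M \<Longrightarrow> norm (\<xi> \<omega>) \<le> C"
    using assms(1) unfolding bdd_at_def bounded_iff by auto
  have "\<bar>\<xi> \<omega> \<bullet> e\<bar> \<le> C * norm e" if "\<omega> \<in> space M" for \<omega>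
    using Cauchy_Schwarz_ineq2[of "\<xi> \<omega>" e] mult_right_mono[OF C[OF that], of "norm e"] by simp
  ultimately show "finite_moments M (\<lambda>\<omega>. \<xi> \<omega> \<bullet> e)"
    by (intro finite_moments_bounded) auto
qed

lemma inner_incr_expand: "\<xi> \<omega> \<bullet> dW s r \<omega> = (\<Sum>e\<in>Basis. (\<xi> \<omega> \<bullet> e) * (dW s r \<omega> \<bullet> e))"
  by (rule euclidean_inner)

lemma finite_moments_inner_incr:
  assumes "0 \<le> p" "p \<le> s" "s \<le> r" "r \<le> T" "bdd_at p \<xi>"
  shows "finite_moments M (\<lambda>\<omega>. \<xi> \<omega> \<bullet> dW s r \<omega>)"
  unfolding inner_incr_expand using assms
  by (intro finite_moments_sum finite_moments_mult finite_moments_incr_component bdd_at_component(1)[where s=p]) auto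

text \<open>After expansion along \<open>Basis\<close>, each factor
  \<open>\<zeta> \<omega> * (\<xi> \<omega> \<bullet> e)\<close> is known at \<open>s\<close> and
  multiplies a centred independent component.\<close>

lemma expectation_inner_incr:
  assumes "0 \<le> s" "s \<le> r" "r \<le> T" "bdd_at s \<xi>" "\<zeta> \<in> borel_measurable (H s)" "finite_moments M \<zeta>"
  shows "expectation (\<lambda>\<omega>. \<zeta> \<omega> * (\<xi> \<omega> \<bullet> dW s r \<omega>)) = 0"
proof -
  have *: "integrable M (\<lambda>\<omega>. \<zeta> \<omega> * (\<xi> \<omega> \<bullet> e))" "(\<lambda>\<omega>. \<zeta> \<omega> * (\<xi> \<omega> \<bullet> e)) \<in> borel_measurable (H s)" for e
    using assms bdd_at_component[OF assms(4)]
    by (auto intro!: finite_moments_integrable finite_moments_mult borel_measurable_times)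
  have "expectation (\<lambda>\<omega>. \<zeta> \<omega> * (\<xi> \<omega> \<bullet> dW s r \<omega>))
    = expectation (\<lambda>\<omega>. \<Sum>e\<in>Basis. (\<zeta> \<omega> * (\<xi> \<omega> \<bullet> e)) * (dW s r \<omega> \<bullet> e))"
    unfolding inner_incr_expand by (simp add: sum_distrib_left mult.assoc)
  also have "\<dots> = (\<Sum>e\<in>Basis. expectation (\<lambda>\<omega>. (\<zeta> \<omega> * (\<xi> \<omega> \<bullet> e)) * (dW s r \<omega> \<bullet> e)))"
    using assms * by (intro Bochner_Integration.integral_sum integrable_mult_incr) auto
  also have "\<dots> = 0"
    using assms * by (intro sum.neutral ballI expectation_mult_incr) auto
  finally show ?thesis .
qed

text \<open>The first factor is known when the second increment begins, so it can play the role of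
  \<open>\<zeta>\<close> in \<open>expectation_inner_incr\<close>.\<close>

lemma bilinear_disjoint:
  assumes "0 \<le> p" "p \<le> s" "s \<le> r" "r \<le> s'" "s' \<le> r'" "r' \<le> T" "bdd_at p \<xi>" "bdd_at p' \<eta>" "0 \<le> p'" "p' \<le> s'"
  shows "expectation (\<lambda>\<omega>. (\<xi> \<omega> \<bullet> dW s r \<omega>) * (\<eta> \<omega> \<bullet> dW s' r' \<omega>)) = 0"
proof (rule expectation_inner_incr)
  show "bdd_at s' \<eta>" using assms by (auto intro: bdd_at_mono)
  show "finite_moments M (\<lambda>\<omega>. \<xi> \<omega> \<bullet> dW s r \<omega>)"
    using assms by (intro finite_moments_inner_incr) auto
  have "\<xi> \<in> borel_measurable (H s')" using bdd_at_mono[OF assms(7), of s'] assms by (simp add: bdd_at_def)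
  moreover have "dW s r \<in> borel_measurable (H s')"
    using assms by (intro measurable_H_mono[OF _ _ _ incr_H]) auto
  ultimately show "(\<lambda>\<omega>. \<xi> \<omega> \<bullet> dW s r \<omega>) \<in> borel_measurable (H s')" by simp
qed (use assms in auto)

text \<open>Expanding both inner products gives a double sum over \<open>Basis\<close> of which only
  the diagonal survives, each term with the factor \<open>r - s\<close>.\<close>

lemma bilinear_same:
  assumes "0 \<le> s" "s \<le> r" "r \<le> T" "bdd_at s \<xi>" "bdd_at s \<eta>"
  shows "expectation (\<lambda>\<omega>. (\<xi> \<omega> \<bullet> dW s r \<omega>) * (\<eta> \<omega> \<bullet> dW s r \<omega>))
    = (r - s) * expectation (\<lambda>\<omega>. \<xi> \<omega> \<bullet> \<eta> \<omega>)"
proof -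
  let ?D = "\<lambda>\<omega>. dW s r \<omega>"
  have *: "integrable M (\<lambda>\<omega>. (\<xi> \<omega> \<bullet> e) * (\<eta> \<omega> \<bullet> d))"
      "(\<lambda>\<omega>. (\<xi> \<omega> \<bullet> e) * (\<eta> \<omega> \<bullet> d)) \<in> borel_measurable (H s)" for e d
    using assms bdd_at_component[OF assms(4)] bdd_at_component[OF assms(5)]
    by (auto intro!: finite_moments_integrable finite_moments_mult borel_measurable_times)
  have i: "integrable M (\<lambda>\<omega>. ((\<xi> \<omega> \<bullet> e) * (\<eta> \<omega> \<bullet> d)) * ((?D \<omega> \<bullet> e) * (?D \<omega> \<bullet> d)))" if "e \<in> Basis" "d \<in> Basis" for e d
    using assms that * by (intro integrable_mult_incr_incr) auto
  have "expectation (\<lambda>\<omega>. (\<xi> \<omega> \<bullet> ?D \<omega>) * (\<eta> \<omega> \<bullet> ?D \<omega>))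
    = expectation (\<lambda>\<omega>. \<Sum>e\<in>Basis. \<Sum>d\<in>Basis. ((\<xi> \<omega> \<bullet> e) * (\<eta> \<omega> \<bullet> d)) * ((?D \<omega> \<bullet> e) * (?D \<omega> \<bullet> d)))"
    unfolding inner_incr_expand sum_product by (simp only: mult_ac)
  also have "\<dots> = (\<Sum>e\<in>Basis. \<Sum>d\<in>Basis. expectation (\<lambda>\<omega>. ((\<xi> \<omega> \<bullet> e) * (\<eta> \<omega> \<bullet> d)) * ((?D \<omega> \<bullet> e) * (?D \<omega> \<bullet> d))))"
    using i by (simp add: Bochner_Integration.integral_sum Bochner_Integration.integrable_sum)
  also have "\<dots> = (\<Sum>e\<in>Basis. \<Sum>d\<in>Basis. (if e = d then r - s else 0) * expectation (\<lambda>\<omega>. (\<xi> \<omega> \<bullet> e) * (\<eta> \<omega> \<bullet> d)))"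
    using assms * by (intro sum.cong refl expectation_mult_incr_incr) auto
  also have "\<dots> = (\<Sum>e\<in>Basis. (r - s) * expectation (\<lambda>\<omega>. (\<xi> \<omega> \<bullet> e) * (\<eta> \<omega> \<bullet> e)))"
    by (simp add: if_distrib[of "\<lambda>x. x * _"] cong: if_cong)
  also have "\<dots> = (r - s) * expectation (\<lambda>\<omega>. \<xi> \<omega> \<bullet> \<eta> \<omega>)"
    using *(1) by (subst euclidean_inner) (simp add: sum_distrib_left Bochner_Integration.integral_sum)
  finally show ?thesis .
qed

text \<open>All statements about stochastic integrals below (isometry, uniqueness, covariance) reduce to
  this formula by linearity.\<close>

lemma bilinear_incr:
  assumes "0 \<le> p" "p \<le> q" "q \<le> T" "bdd_at p \<xi>" "0 \<le> p'" "p' \<le> q'" "q' \<le> T" "bdd_at p' \<eta>"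
  shows "expectation (\<lambda>\<omega>. (\<xi> \<omega> \<bullet> dW p q \<omega>) * (\<eta> \<omega> \<bullet> dW p' q' \<omega>))
    = measure lborel ({p<..q} \<inter> {p'<..q'}) * expectation (\<lambda>\<omega>. \<xi> \<omega> \<bullet> \<eta> \<omega>)"
proof -
  consider "q \<le> p'" | "q' \<le> p" | "p' < q" "p < q'" by linarith
  then show ?thesis
  proof cases
    case 1
    then have "{p<..q} \<inter> {p'<..q'} = {}" by auto
    then show ?thesis using 1 assms by (simp add: bilinear_disjoint[of p p q p' q' \<xi> p'])
  next
    case 2
    then have "{p<..q} \<inter> {p'<..q'} = {}" by auto
    then show ?thesis
      using 2 assms bilinear_disjoint[of p' p' q' p q \<eta> p \<xi>] by (simp add: mult.commute)
  next
    case 3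
    \<comment> \<open>Both intervals are cut at the ends of their overlap \<open>{m<..l}\<close>. Of
      the nine resulting products only the one with both factors over the overlap can have a nonzero
      mean.\<close>
    define m where "m = max p p'"
    define l where "l = min q q'"
    have ml: "m \<le> l" "0 \<le> m" "p \<le> m" "p' \<le> m" "l \<le> q" "l \<le> q'" "l \<le> T"
      using 3 assms by (auto simp: m_def l_def)
    have eq: "{p<..q} \<inter> {p'<..q'} = {m<..l}" by (auto simp: m_def l_def)
    let ?a = "\<lambda>s r \<omega>. \<xi> \<omega> \<bullet> dW s r \<omega>"
    let ?b = "\<lambda>s r \<omega>. \<eta> \<omega> \<bullet> dW s r \<omega>"
    let ?E = "\<lambda>s r s' r'. expectation (\<lambda>\<omega>. ?a s r \<omega> * ?b s' r' \<omega>)"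
    have int: "integrable M (\<lambda>\<omega>. ?a s r \<omega> * ?b s' r' \<omega>)"
      if "p \<le> s" "s \<le> r" "r \<le> T" "p' \<le> s'" "s' \<le> r'" "r' \<le> T" for s r s' r'
      using that assms
      by (intro finite_moments_integrable finite_moments_mult finite_moments_inner_incr[where p=p] finite_moments_inner_incr[where p=p']) auto
    have split: "?a p q \<omega> * ?b p' q' \<omega> =
      ?a p m \<omega> * ?b p' m \<omega> + ?a p m \<omega> * ?b m l \<omega> + ?a p m \<omega> * ?b l q' \<omega> +
      (?a m l \<omega> * ?b p' m \<omega> + ?a m l \<omega> * ?b m l \<omega> + ?a m l \<omega> * ?b l q' \<omega>) +
      (?a l q \<omega> * ?b p' m \<omega> + ?a l q \<omega> * ?b m l \<omega> + ?a l q \<omega> * ?b l q' \<omega>)" for \<omega>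
      by (simp add: inner_diff_right algebra_simps)
    have lhs: "?E p q p' q' = ?E p m p' m + ?E p m m l + ?E p m l q' + (?E m l p' m + ?E m l m l + ?E m l l q') +
       (?E l q p' m + ?E l q m l + ?E l q l q')"
      unfolding split using ml assms by (simp add: int)
    \<comment> \<open>Here the two pieces end at the same time \<open>m\<close> and need not be
      disjoint, but one of them is empty, since \<open>m\<close> is one of the two left ends. The
      same happens on the right at \<open>l\<close>.\<close>
    have z1: "?E p m p' m = 0"
    proof -
      have "p = m \<or> p' = m" by (auto simp: m_def)
      then show ?thesis by auto
    qed
    have z2: "?E l q l q' = 0"
    proof -
      have "q = l \<or> q' = l" by (auto simp: l_def)
      then show ?thesis by auto
    qed
    have z3: "?E p m m l = 0" "?E p m l q' = 0" "?E m l l q' = 0"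
      using ml assms
        bilinear_disjoint[of p p m m l \<xi> p' \<eta>] bilinear_disjoint[of p p m l q' \<xi> p' \<eta>]
        bilinear_disjoint[of p m l l q' \<xi> p' \<eta>] by auto
    have z4: "?E m l p' m = 0" "?E l q p' m = 0" "?E l q m l = 0"
      using ml assms
        bilinear_disjoint[of p' p' m m l \<eta> p \<xi>] bilinear_disjoint[of p' p' m l q \<eta> p \<xi>]
        bilinear_disjoint[of p' m l l q \<eta> p \<xi>] by (auto simp: mult.commute)
    have "?E m l m l = (l - m) * expectation (\<lambda>\<omega>. \<xi> \<omega> \<bullet> \<eta> \<omega>)"
      using ml assms by (intro bilinear_same bdd_at_mono[OF assms(4)] bdd_at_mono[OF assms(8)]) auto
    then show ?thesis
      using ml lhs z1 z2 z3 z4 eq by simp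
  qed
qed

end

section \<open>Mean square convergence\<close>

abbreviation L2_sq :: "'b measure \<Rightarrow> ('b \<Rightarrow> 'c::real_normed_vector) \<Rightarrow> ennreal"
  where "L2_sq N f \<equiv> \<integral>\<^sup>+x. ennreal ((norm (f x))\<^sup>2) \<partial>N"

text \<open>Cauchy-Schwarz in \<open>ennreal\<close> presupposes no integrability, so it first
  yields integrability and then the bound for the integral.\<close>

lemma
  fixes f g :: "'b \<Rightarrow> 'c::euclidean_space"
  assumes [measurable]: "f \<in> borel_measurable N" "g \<in> borel_measurable N"
    and f: "L2_sq N f < \<infinity>" and g: "L2_sq N g < \<infinity>"
  shows integrable_inner_L2: "integrable N (\<lambda>x. f x \<bullet> g x)" (is ?A)
    and integral_inner_L2_le: "ennreal ((\<integral>x. f x \<bullet> g x \<partial>N)\<^sup>2)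
      \<le> L2_sq N f * L2_sq N g" (is ?B)
proof -
  let ?p = "\<integral>\<^sup>+x. ennreal (norm (f x) * norm (g x)) \<partial>N"
  have CS: "?p\<^sup>2 \<le> L2_sq N f * L2_sq N g"
    using Cauchy_Schwarz_nn_integral[of "\<lambda>x. ennreal (norm (f x))" N "\<lambda>x. ennreal (norm (g x))"]
    by (simp add: ennreal_mult[symmetric] ennreal_power)
  also have "\<dots> < \<infinity>" using f g by (simp add: ennreal_mult_less_top)
  finally have fin: "?p < \<infinity>" by (simp add: power_less_top_ennreal)
  have le: "(\<integral>\<^sup>+x. ennreal (norm (f x \<bullet> g x)) \<partial>N) \<le> ?p"
    by (intro nn_integral_mono ennreal_leI) (auto simp: Cauchy_Schwarz_ineq2)
  show A: ?A
    using le fin by (auto simp: integrable_iff_bounded intro: le_less_trans)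
  have "ennreal \<bar>\<integral>x. f x \<bullet> g x \<partial>N\<bar> \<le> (\<integral>\<^sup>+x. ennreal (norm (f x \<bullet> g x)) \<partial>N)"
    using integral_norm_bound_ennreal[OF A] by simp
  also have "\<dots> \<le> ?p" by (rule le)
  finally have "(ennreal \<bar>\<integral>x. f x \<bullet> g x \<partial>N\<bar>)\<^sup>2 \<le> ?p\<^sup>2" by (intro power_mono) auto
  then show ?B using CS by (simp add: ennreal_power)
qed

text \<open>A substitute for the triangle inequality that avoids square roots in
  \<open>ennreal\<close>; it is the integrated form of
  \<open>(a + b)\<^sup>2 \<le> 2 * a\<^sup>2 + 2 * b\<^sup>2\<close>.\<close>

lemma nn_integral_norm_square_diff_le:
  fixes f g h :: "'b \<Rightarrow> 'c::euclidean_space"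
  assumes [measurable]: "f \<in> borel_measurable N" "g \<in> borel_measurable N" "h \<in> borel_measurable N"
  shows "L2_sq N (\<lambda>x. f x - h x)
    \<le> 2 * L2_sq N (\<lambda>x. f x - g x) + 2 * L2_sq N (\<lambda>x. g x - h x)"
proof -
  have *: "(norm (f x - h x))\<^sup>2 \<le> 2 * (norm (f x - g x))\<^sup>2 + 2 * (norm (g x - h x))\<^sup>2" for x
  proof -
    have "norm (f x - h x) \<le> norm (f x - g x) + norm (g x - h x)"
      using norm_triangle_ineq[of "f x - g x" "g x - h x"] by simp
    then have "(norm (f x - h x))\<^sup>2 \<le> (norm (f x - g x) + norm (g x - h x))\<^sup>2" by (intro power_mono) auto
    also have "\<dots> \<le> 2 * (norm (f x - g x))\<^sup>2 + 2 * (norm (g x - h x))\<^sup>2"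
      using sum_squares_bound[of "norm (f x - g x)" "norm (g x - h x)"] by (simp add: power2_sum)
    finally show ?thesis .
  qed
  have "L2_sq N (\<lambda>x. f x - h x)
    \<le> (\<integral>\<^sup>+x. 2 * ennreal ((norm (f x - g x))\<^sup>2) + 2 * ennreal ((norm (g x - h x))\<^sup>2) \<partial>N)"
  proof (rule nn_integral_mono)
    fix x
    show "ennreal ((norm (f x - h x))\<^sup>2) \<le> 2 * ennreal ((norm (f x - g x))\<^sup>2) + 2 * ennreal ((norm (g x - h x))\<^sup>2)"
      using ennreal_leI[OF *[of x]] by (simp add: ennreal_mult')
  qed
  also have "\<dots> = 2 * L2_sq N (\<lambda>x. f x - g x) + 2 * L2_sq N (\<lambda>x. g x - h x)"
    by (simp add: nn_integral_add nn_integral_cmult)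
  finally show ?thesis .
qed

text \<open>Strong convergence implies weak convergence: the squared error is at most
  \<open>L2_sq\<close> of the difference times the finite \<open>L2_sq N g\<close>.\<close>

lemma tendsto_integral_inner_L2:
  fixes f g :: "'b \<Rightarrow> 'c::euclidean_space"
  assumes [measurable]: "f \<in> borel_measurable N" "g \<in> borel_measurable N" "\<And>k. F k \<in> borel_measurable N"
    and f: "L2_sq N f < \<infinity>" and g: "L2_sq N g < \<infinity>"
    and F: "\<And>k. L2_sq N (F k) < \<infinity>"
    and lim: "(\<lambda>k. L2_sq N (\<lambda>x. f x - F k x)) \<longlonglongrightarrow> 0"
  shows "(\<lambda>k. \<integral>x. F k x \<bullet> g x \<partial>N) \<longlonglongrightarrow> (\<integral>x. f x \<bullet> g x \<partial>N)"
proof -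
  let ?G = "L2_sq N g"
  let ?d = "\<lambda>k. (\<integral>x. f x \<bullet> g x \<partial>N) - (\<integral>x. F k x \<bullet> g x \<partial>N)"
  have fin: "L2_sq N (\<lambda>x. f x - F k x) < \<infinity>" for k
    using nn_integral_norm_square_diff_le[of f N "\<lambda>_. 0" "F k"] f F[of k]
    by (auto intro: le_less_trans simp: ennreal_mult_less_top)
  have "?d k = (\<integral>x. (f x - F k x) \<bullet> g x \<partial>N)" for k
    using integrable_inner_L2[OF assms(1,2) f g] integrable_inner_L2[OF assms(3,2) F g]
    by (simp add: inner_diff_left)
  then have le: "ennreal ((?d k)\<^sup>2) \<le> L2_sq N (\<lambda>x. f x - F k x) * ?G" for k
    using integral_inner_L2_le[OF _ assms(2) fin[of k] g] by simp
  have "(\<lambda>k. L2_sq N (\<lambda>x. f x - F k x) * ?G) \<longlonglongrightarrow> 0 * ?G"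
    using g by (intro tendsto_mult_ennreal lim tendsto_const) auto
  then have lim0: "(\<lambda>k. L2_sq N (\<lambda>x. f x - F k x) * ?G) \<longlonglongrightarrow> 0" by simp
  have "(\<lambda>k. ennreal ((?d k)\<^sup>2)) \<longlonglongrightarrow> ennreal 0"
    unfolding ennreal_0
    by (rule tendsto_sandwich[OF always_eventually always_eventually tendsto_const lim0]) (use le in auto)
  then have "(\<lambda>k. (?d k)\<^sup>2) \<longlonglongrightarrow> 0"
    by (subst (asm) tendsto_ennreal_iff) auto
  then have "?d \<longlonglongrightarrow> 0" by simp
  from tendsto_diff[OF tendsto_const[of "\<integral>x. f x \<bullet> g x \<partial>N"] this] show ?thesis by simp
qed

section \<open>Ito isometry\<close>

context bm_filtration
begin

text \<open>In contrast to \<open>simple_integrand\<close>, the index set is arbitrary and the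
  intervals may overlap. A difference of two integrands over different partitions is then of the
  same kind, without a common refinement.\<close>

definition elementary :: "'j set \<Rightarrow> ('j \<Rightarrow> real) \<Rightarrow> ('j \<Rightarrow> real) \<Rightarrow> ('j \<Rightarrow> 'w \<Rightarrow> 'a) \<Rightarrow> bool"
  where "elementary J p q \<xi> \<longleftrightarrow> finite J \<and> (\<forall>j\<in>J. 0 \<le> p j \<and> p j \<le> q j \<and> q j \<le> T \<and> bdd_at (p j) (\<xi> j))"

definition el_process :: "'j set \<Rightarrow> ('j \<Rightarrow> real) \<Rightarrow> ('j \<Rightarrow> real) \<Rightarrow> ('j \<Rightarrow> 'w \<Rightarrow> 'a) \<Rightarrow> real \<Rightarrow> 'w \<Rightarrow> 'a"
  where "el_process J p q \<xi> s \<omega> = (\<Sum>j\<in>J. indicator {p j<..q j} s *\<^sub>R \<xi> j \<omega>)"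

definition el_ito :: "'j set \<Rightarrow> ('j \<Rightarrow> real) \<Rightarrow> ('j \<Rightarrow> real) \<Rightarrow> ('j \<Rightarrow> 'w \<Rightarrow> 'a) \<Rightarrow> 'w \<Rightarrow> real"
  where "el_ito J p q \<xi> \<omega> = (\<Sum>j\<in>J. \<xi> j \<omega> \<bullet> dW (p j) (q j) \<omega>)"

lemma finite_moments_el_ito:
  assumes "elementary J p q \<xi>"
  shows "finite_moments M (el_ito J p q \<xi>)"
  using assms unfolding el_ito_def elementary_def
  by (auto intro!: finite_moments_sum finite_moments_inner_incr[where p = "p _"])

lemma el_process_measurable:
  assumes "elementary J p q \<xi>"
  shows "(\<lambda>(s, \<omega>). el_process J p q \<xi> s \<omega>) \<in> borel_measurable (borel \<Otimes>\<^sub>M M)"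
proof -
  have m: "\<xi> j \<in> borel_measurable M" if "j \<in> J" for j
    using assms that unfolding elementary_def bdd_at_def
    by (intro measurable_H[of "p j"]) force+
  show ?thesis
    unfolding el_process_def split_beta'
    using m by (intro borel_measurable_sum borel_measurable_scaleR) (auto intro: measurable_compose[OF measurable_snd])
qed

text \<open>By \<open>bilinear_incr\<close> a pair of terms contributes the length of the overlap of
  its intervals times a mean inner product, and this length is the time integral of the product of
  the two indicators.\<close>

lemma el_ito_inner:
  assumes "elementary J p q \<xi>" "elementary K p' q' \<eta>"
  shows "expectation (\<lambda>\<omega>. el_ito J p q \<xi> \<omega> * el_ito K p' q' \<eta> \<omega>)
    = expectation (\<lambda>\<omega>. \<integral>s. el_process J p q \<xi> s \<omega> \<bullet> el_process K p' q' \<eta> s \<omega> \<partial>lborel)" (is ?E)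
    and "integrable M (\<lambda>\<omega>. \<integral>s. el_process J p q \<xi> s \<omega> \<bullet> el_process K p' q' \<eta> s \<omega> \<partial>lborel)" (is ?I)
    and "integrable lborel (\<lambda>s. el_process J p q \<xi> s \<omega> \<bullet> el_process K p' q' \<eta> s \<omega>)" (is ?L)
proof -
  have J: "\<And>j. j \<in> J \<Longrightarrow> 0 \<le> p j \<and> p j \<le> q j \<and> q j \<le> T \<and> bdd_at (p j) (\<xi> j)"
    and K: "\<And>j. j \<in> K \<Longrightarrow> 0 \<le> p' j \<and> p' j \<le> q' j \<and> q' j \<le> T \<and> bdd_at (p' j) (\<eta> j)"
    using assms unfolding elementary_def by auto
  have lm: "emeasure lborel ({p i<..q i} \<inter> {p' j<..q' j}) < \<infinity>" for i j
    by (rule le_less_trans[OF emeasure_mono[of _ "{p i..q i}"]])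
      (auto simp: emeasure_lborel_Icc_eq)
  have exp: "el_process J p q \<xi> s \<omega> \<bullet> el_process K p' q' \<eta> s \<omega> =
     (\<Sum>i\<in>J. \<Sum>j\<in>K. indicator ({p i<..q i} \<inter> {p' j<..q' j}) s * (\<xi> i \<omega> \<bullet> \<eta> j \<omega>))" for s \<omega>
    unfolding el_process_def
    by (subst sum.swap)
      (simp add: inner_sum_left inner_sum_right indicator_inter_arith sum_distrib_left mult_ac del: Int_greaterThanAtMost)
  have int1: "integrable lborel (\<lambda>s. indicator ({p i<..q i} \<inter> {p' j<..q' j}) s * (\<xi> i \<omega> \<bullet> \<eta> j \<omega>))" for i j \<omega>
    using lm by (intro integrable_mult_left) (auto simp: integrable_indicator_iff)
  then show ?L unfolding exp by (intro Bochner_Integration.integrable_sum)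
  have int2: "(\<integral>s. el_process J p q \<xi> s \<omega> \<bullet> el_process K p' q' \<eta> s \<omega> \<partial>lborel) =
    (\<Sum>i\<in>J. \<Sum>j\<in>K. measure lborel ({p i<..q i} \<inter> {p' j<..q' j}) * (\<xi> i \<omega> \<bullet> \<eta> j \<omega>))" for \<omega>
    unfolding exp using int1 by (simp add: Bochner_Integration.integral_sum Bochner_Integration.integrable_sum)
  have int3: "integrable M (\<lambda>\<omega>. \<xi> i \<omega> \<bullet> \<eta> j \<omega>)" if "i \<in> J" "j \<in> K" for i j
    using J[OF that(1)] K[OF that(2)]
    by (subst euclidean_inner, intro finite_moments_integrable finite_moments_sum finite_moments_mult
          bdd_at_component(1)[of "p i"] bdd_at_component(1)[of "p' j"]) auto
  then show ?I unfolding int2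
    by (intro Bochner_Integration.integrable_sum integrable_mult_right)
  have int4: "integrable M (\<lambda>\<omega>. (\<xi> i \<omega> \<bullet> dW (p i) (q i) \<omega>) * (\<eta> j \<omega> \<bullet> dW (p' j) (q' j) \<omega>))"
    if "i \<in> J" "j \<in> K" for i j
    using J[OF that(1)] K[OF that(2)]
    by (intro finite_moments_integrable finite_moments_mult finite_moments_inner_incr[of "p i" "p i"]
        finite_moments_inner_incr[of "p' j" "p' j"]) auto
  have "expectation (\<lambda>\<omega>. el_ito J p q \<xi> \<omega> * el_ito K p' q' \<eta> \<omega>) =
    (\<Sum>i\<in>J. \<Sum>j\<in>K. expectation (\<lambda>\<omega>. (\<xi> i \<omega> \<bullet> dW (p i) (q i) \<omega>) * (\<eta> j \<omega> \<bullet> dW (p' j) (q' j) \<omega>)))"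
    unfolding el_ito_def sum_product using int4
    by (simp add: Bochner_Integration.integral_sum Bochner_Integration.integrable_sum)
  also have "\<dots> = (\<Sum>i\<in>J. \<Sum>j\<in>K. measure lborel ({p i<..q i} \<inter> {p' j<..q' j}) * expectation (\<lambda>\<omega>. \<xi> i \<omega> \<bullet> \<eta> j \<omega>))"
    using J K by (intro sum.cong refl bilinear_incr) auto
  also have "\<dots> = expectation (\<lambda>\<omega>. \<integral>s. el_process J p q \<xi> s \<omega> \<bullet> el_process K p' q' \<eta> s \<omega> \<partial>lborel)"
    unfolding int2 using int3 by (simp add: Bochner_Integration.integral_sum Bochner_Integration.integrable_sum)
  finally show ?E .
qed

lemma el_ito_isometry:
  assumes "elementary J p q \<xi>"
  shows "(\<integral>\<^sup>+\<omega>. ennreal ((el_ito J p q \<xi> \<omega>)\<^sup>2) \<partial>M)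
    = (\<integral>\<^sup>+\<omega>. (\<integral>\<^sup>+s. ennreal ((norm (el_process J p q \<xi> s \<omega>))\<^sup>2) \<partial>lborel) \<partial>M)"
proof -
  note i = el_ito_inner[OF assms assms]
  have "(\<integral>\<^sup>+\<omega>. ennreal ((el_ito J p q \<xi> \<omega>)\<^sup>2) \<partial>M) = ennreal (expectation (\<lambda>\<omega>. (el_ito J p q \<xi> \<omega>)\<^sup>2))"
    using finite_moments_square_integrable[OF finite_moments_el_ito[OF assms]] by (simp add: nn_integral_eq_integral)
  also have "\<dots> = ennreal (expectation (\<lambda>\<omega>. \<integral>s. el_process J p q \<xi> s \<omega> \<bullet> el_process J p q \<xi> s \<omega> \<partial>lborel))"
    using i(1) by (simp add: power2_eq_square)
  also have "\<dots> = (\<integral>\<^sup>+\<omega>. ennreal (\<integral>s. el_process J p q \<xi> s \<omega> \<bullet> el_process J p q \<xi> s \<omega> \<partial>lborel) \<partial>M)"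
    using i(2) by (intro nn_integral_eq_integral[symmetric]) auto
  also have "\<dots> = (\<integral>\<^sup>+\<omega>. (\<integral>\<^sup>+s. ennreal ((norm (el_process J p q \<xi> s \<omega>))\<^sup>2) \<partial>lborel) \<partial>M)"
    unfolding power2_norm_eq_inner using i(3)
    by (intro nn_integral_cong nn_integral_eq_integral[symmetric]) auto
  finally show ?thesis .
qed

text \<open>The difference is one elementary integral, indexed by the disjoint sum of the index sets
  with the second integrand negated.\<close>

lemma el_ito_isometry_diff:
  assumes "elementary J p q \<xi>" "elementary K p' q' \<eta>"
  shows "(\<integral>\<^sup>+\<omega>. ennreal ((el_ito J p q \<xi> \<omega> - el_ito K p' q' \<eta> \<omega>)\<^sup>2) \<partial>M)
    = (\<integral>\<^sup>+\<omega>. (\<integral>\<^sup>+s. ennreal ((norm (el_process J p q \<xi> s \<omega> - el_process K p' q' \<eta> s \<omega>))\<^sup>2) \<partial>lborel) \<partial>M)"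
proof -
  let ?p = "case_sum p p'" let ?q = "case_sum q q'" let ?\<xi> = "case_sum \<xi> (\<lambda>j \<omega>. - \<eta> j \<omega>)"
  have neg: "bdd_at s (\<lambda>\<omega>. - X \<omega>)" if "bdd_at s X" for s X
    using that unfolding bdd_at_def by (auto simp: bounded_iff)
  have el: "elementary (J <+> K) ?p ?q ?\<xi>"
    using assms neg unfolding elementary_def by auto
  have fin: "finite J" "finite K" using assms unfolding elementary_def by auto
  have "el_ito (J <+> K) ?p ?q ?\<xi> \<omega> = el_ito J p q \<xi> \<omega> - el_ito K p' q' \<eta> \<omega>" for \<omega>
    unfolding el_ito_def using fin by (simp add: sum.Plus sum_negf)
  moreover have "el_process (J <+> K) ?p ?q ?\<xi> s \<omega> = el_process J p q \<xi> s \<omega> - el_process K p' q' \<eta> s \<omega>" for s \<omega>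
    unfolding el_process_def using fin by (simp add: sum.Plus sum_negf del: sum_indicator_scaleR)
  ultimately show ?thesis using el_ito_isometry[OF el] by simp
qed

end

section \<open>Ito integrals: enlarging the filtration, uniqueness, mean and covariance\<close>

lemma has_ito_integral_mono:
  assumes "has_ito_integral M \<FF> W a b Z I" "\<And>s. s \<in> {a..b} \<Longrightarrow> subalgebra (\<GG> s) (\<FF> s)"
  shows "has_ito_integral M \<GG> W a b Z I"
proof -
  have 1: "X \<in> measurable (\<FF> s) N \<Longrightarrow> X \<in> measurable (\<GG> s) N" if "s \<in> {a..b}" for X s and N :: "'n measure"
    using measurable_from_subalg[OF assms(2)[OF that]] .
  have mono: "p i \<le> p j" if "\<forall>j<m. p j \<le> p (Suc j)" "i \<le> j" "j \<le> m" for p :: "nat \<Rightarrow> real" and i j m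
    using that(2,3,1) by (induction j rule: dec_induct) (auto intro: order_trans)
  have 2: "simple_integrand M \<GG> a b m p \<xi>" if "simple_integrand M \<FF> a b m p \<xi>" for m p and \<xi> :: "nat \<Rightarrow> 'a \<Rightarrow> 'b"
    unfolding simple_integrand_def
  proof (intro conjI allI impI)
    fix j assume j: "j < m"
    have p: "p 0 = a" "p m = b" "\<forall>j<m. p j \<le> p (Suc j)" and \<xi>: "\<xi> j \<in> borel_measurable (\<FF> (p j))"
      using that j unfolding simple_integrand_def by blast+
    \<comment> \<open>The inclusion of the filtrations is assumed on \<open>{a..b}\<close> only, so
      the partition points have to be located there.\<close>
    have "p j \<in> {a..b}"
      using mono[OF p(3), of 0 j] mono[OF p(3), of j m] j p(1,2) by simp
    from 1[OF this \<xi>] show "\<xi> j \<in> borel_measurable (\<GG> (p j))" .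
  qed (use that in \<open>unfold simple_integrand_def, blast\<close>)+
  obtain m p \<xi> where "\<forall>k. simple_integrand M \<FF> a b (m k) (p k) (\<xi> k)"
    "(\<lambda>k. \<integral>\<^sup>+\<omega>. (\<integral>\<^sup>+s\<in>{a..<b}.
            ennreal ((norm (Z s \<omega> - simple_process (m k) (p k) (\<xi> k) s \<omega>))\<^sup>2) \<partial>lborel) \<partial>M) \<longlonglongrightarrow> 0"
    "(\<lambda>k. \<integral>\<^sup>+\<omega>. ennreal ((I \<omega> - simple_ito W (m k) (p k) (\<xi> k) \<omega>)\<^sup>2) \<partial>M) \<longlonglongrightarrow> 0"
    using assms(1) unfolding has_ito_integral_def 
    apply (elim conjE exE)
    subgoal for m p \<xi> by (rule that[of m p \<xi>])
    done
  moreover have "\<forall>s\<in>{a..<b}. Z s \<in> borel_measurable (\<GG> s)"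
  proof
    fix s assume s: "s \<in> {a..<b}"
    then have "Z s \<in> borel_measurable (\<FF> s)"
      using assms(1) unfolding has_ito_integral_def by (elim conjE bspec)
    with s show "Z s \<in> borel_measurable (\<GG> s)" by (intro 1[of s]) auto
  qed
  ultimately show ?thesis
    using assms(1) unfolding has_ito_integral_def
    by (intro conjI exI[of _ m] exI[of _ p] exI[of _ \<xi>] allI 2) (elim conjE; (assumption | erule spec))+
qed

context bm_filtration
begin

lemma simple_integrand_elementary:
  assumes "simple_integrand M H a b m p \<xi>" "0 \<le> a" "b \<le> T"
  shows "elementary {..<m} p (\<lambda>j. p (Suc j)) \<xi>"
    and "j < m \<Longrightarrow> a \<le> p j \<and> p (Suc j) \<le> b"
proof -
  have p: "p 0 = a" "p m = b" "\<forall>j<m. p j \<le> p (Suc j)"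
    and \<xi>: "\<forall>j<m. \<xi> j \<in> borel_measurable (H (p j)) \<and> bounded (\<xi> j ` space M)"
    using assms(1) unfolding simple_integrand_def by auto
  have mono: "p i \<le> p j" if "i \<le> j" "j \<le> m" for i j
    using that p(3) by (induction j rule: dec_induct) (auto intro: order_trans)
  show *: "j < m \<Longrightarrow> a \<le> p j \<and> p (Suc j) \<le> b" for j
    using mono[of 0 j] mono[of "Suc j" m] p by auto
  show "elementary {..<m} p (\<lambda>j. p (Suc j)) \<xi>"
    unfolding elementary_def bdd_at_def
  proof (intro conjI ballI)
    fix j assume "j \<in> {..<m}"
    then have "j < m" by simp
    then show "0 \<le> p j" "p j \<le> p (Suc j)" "p (Suc j) \<le> T" "\<xi> j \<in> borel_measurable (H (p j))" "bounded (\<xi> j ` space M)"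
      using *[of j] p(3) \<xi> assms(2,3) by auto
  qed simp
qed

lemma simple_process_el_process:
  "simple_process m p \<xi> s \<omega> = el_process {..<m} p (\<lambda>j. p (Suc j)) \<xi> s \<omega>"
  by (simp only: simple_process_def el_process_def)

lemma simple_ito_el_ito: "simple_ito W m p \<xi> \<omega> = el_ito {..<m} p (\<lambda>j. p (Suc j)) \<xi> \<omega>"
  by (simp only: simple_ito_def el_ito_def)

lemma el_process_outside:
  assumes "\<And>j. j \<in> J \<Longrightarrow> a \<le> p j \<and> q j \<le> b" "s \<notin> {a<..b}"
  shows "el_process J p q \<xi> s \<omega> = 0"
  unfolding el_process_def
proof (intro sum.neutral ballI)
  fix j assume "j \<in> J"
  then have "s \<notin> {p j<..q j}" using assms by force
  then show "indicator {p j<..q j} s *\<^sub>R \<xi> j \<omega> = 0" by simp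
qed

text \<open>The simple integrals that converge to \<open>I\<close> also converge to the elementary
  integral, because the isometry turns the distance of the integrands into that of the integrals.
  This evaluates the stochastic integral of a piecewise constant integrand as a finite sum.\<close>

lemma ito_integral_unique:
  assumes Z: "has_ito_integral M H W a b Z I" and ab: "0 \<le> a" "b \<le> T"
    and el: "elementary J p q \<xi>" and J: "\<And>j. j \<in> J \<Longrightarrow> a \<le> p j \<and> q j \<le> b"
    and eq: "\<And>\<omega>. \<omega> \<in> space M \<Longrightarrow> AE s in lborel. s \<in> {a..<b} \<longrightarrow> Z s \<omega> = el_process J p q \<xi> s \<omega>"
  shows "AE \<omega> in M. I \<omega> = el_ito J p q \<xi> \<omega>"
proof -
  from Z obtain m p' \<eta> where si: "\<And>k. simple_integrand M H a b (m k) (p' k) (\<eta> k)"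
    and lim1: "(\<lambda>k. \<integral>\<^sup>+\<omega>. (\<integral>\<^sup>+s\<in>{a..<b}.
            ennreal ((norm (Z s \<omega> - simple_process (m k) (p' k) (\<eta> k) s \<omega>))\<^sup>2) \<partial>lborel) \<partial>M) \<longlonglongrightarrow> 0"
    and lim2: "(\<lambda>k. \<integral>\<^sup>+\<omega>. ennreal ((I \<omega> - simple_ito W (m k) (p' k) (\<eta> k) \<omega>)\<^sup>2) \<partial>M) \<longlonglongrightarrow> 0"
    and I[measurable]: "I \<in> borel_measurable M"
    unfolding has_ito_integral_def 
    apply (elim conjE exE)
    subgoal for m p \<xi> by (rule that[of m p \<xi>]) (simp_all only: simp_thms)
    done
  note el' = simple_integrand_elementary[OF si ab] and lim1 = lim1[unfolded simple_process_el_process]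
  let ?I = "\<lambda>k. simple_ito W (m k) (p' k) (\<eta> k)" and ?S = "el_ito J p q \<xi>"
    and ?h = "\<lambda>k. el_process {..<m k} (p' k) (\<lambda>j. p' k (Suc j)) (\<eta> k)" and ?g = "el_process J p q \<xi>"
  let ?a = "\<lambda>k. \<integral>\<^sup>+\<omega>. ennreal ((I \<omega> - ?I k \<omega>)\<^sup>2) \<partial>M" and ?b = "\<lambda>k. \<integral>\<^sup>+\<omega>. ennreal ((?I k \<omega> - ?S \<omega>)\<^sup>2) \<partial>M"
    and ?c = "\<integral>\<^sup>+\<omega>. ennreal ((I \<omega> - ?S \<omega>)\<^sup>2) \<partial>M"
  have S[measurable]: "?S \<in> borel_measurable M"
    using finite_moments_measurable[OF finite_moments_el_ito[OF el]] .
  have Sk[measurable]: "?I k \<in> borel_measurable M" for k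
    unfolding simple_ito_el_ito using finite_moments_measurable[OF finite_moments_el_ito[OF el'(1)]] .
  \<comment> \<open>The isometry gives the distance of the two elementary processes over the whole
    time axis. On \<open>{a..<b}\<close> one of them is \<open>Z\<close> almost everywhere;
    elsewhere both vanish except possibly at the null point \<open>b\<close>.\<close>
  have "?b k
    = (\<integral>\<^sup>+\<omega>. (\<integral>\<^sup>+s\<in>{a..<b}. ennreal ((norm (Z s \<omega> - ?h k s \<omega>))\<^sup>2) \<partial>lborel) \<partial>M)"
    for k
    unfolding simple_ito_el_ito el_ito_isometry_diff[OF el'(1) el]
  proof (rule nn_integral_cong)
    fix \<omega> assume "\<omega> \<in> space M"
    show "(\<integral>\<^sup>+s. ennreal ((norm (?h k s \<omega> - ?g s \<omega>))\<^sup>2) \<partial>lborel)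
      = (\<integral>\<^sup>+s\<in>{a..<b}. ennreal ((norm (Z s \<omega> - ?h k s \<omega>))\<^sup>2) \<partial>lborel)"
    proof (rule nn_integral_cong_AE)
      show "AE s in lborel. ennreal ((norm (?h k s \<omega> - ?g s \<omega>))\<^sup>2)
        = ennreal ((norm (Z s \<omega> - ?h k s \<omega>))\<^sup>2) * indicator {a..<b} s"
        using eq[OF \<open>\<omega> \<in> space M\<close>] AE_lborel_singleton[of b]
      proof eventually_elim
        case (elim s)
        show ?case
        proof (cases "s \<in> {a..<b}")
          case True
          then show ?thesis using elim by (simp add: norm_minus_commute)
        next
          case False
          then have "s \<notin> {a<..b}" using elim by auto
          then show ?thesis
            using False el_process_outside[of J a p q b s] J
              el_process_outside[of "{..<m k}" a "p' k" "\<lambda>j. p' k (Suc j)" b s] el'(2)[of _ k] by simp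
        qed
      qed
    qed
  qed
  then have lim3: "(\<lambda>k. \<integral>\<^sup>+\<omega>. ennreal ((?I k \<omega> - ?S \<omega>)\<^sup>2) \<partial>M) \<longlonglongrightarrow> 0"
    using lim1 by simp
  have le: "?c
    \<le> 2 * ?a k
      + 2 * ?b k" for k
    using nn_integral_norm_square_diff_le[OF I Sk S, of k] by simp
  have "(\<lambda>k. 2 * ?a k
      + 2 * ?b k) \<longlonglongrightarrow> 2 * 0 + 2 * 0"
    by (intro tendsto_add tendsto_mult_ennreal tendsto_const lim2 lim3) auto
  then have "?c \<le> 2 * 0 + 2 * 0"
    by (rule LIMSEQ_le_const) (use le in auto)
  then have "?c = 0" by simp
  then show ?thesis
    by (subst (asm) nn_integral_0_iff_AE) auto
qed

text \<open>Zero mean and covariance hold for the approximating elementary integrals and pass to the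
  limit. For the covariance the test variable
  \<open>indicator A \<omega> * (dW a b \<omega> \<bullet> e)\<close> is itself an elementary
  integral over the single interval from \<open>a\<close> to \<open>b\<close>, so the polarized
  isometry \<open>el_ito_inner\<close> applies before the limit is taken.\<close>

lemma
  assumes Z: "has_ito_integral M H W a b Z I" and ab: "0 \<le> a" "a \<le> b" "b \<le> T"
  shows ito_square_integrable: "integrable M (\<lambda>\<omega>. (I \<omega>)\<^sup>2)"
    and ito_expectation: "\<And>A. A \<in> sets (H a) \<Longrightarrow> expectation (\<lambda>\<omega>. indicator A \<omega> * I \<omega>) = 0"
    and ito_integrand_integral_integrable:
      "integrable M (\<lambda>\<omega>. \<integral>s. Z s \<omega> \<partial>restrict_space lborel {a..<b})"
    and ito_covariance: "\<And>A e. A \<in> sets (H a) \<Longrightarrow> e \<in> Basis \<Longrightarrow>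
      expectation (\<lambda>\<omega>. indicator A \<omega> * (I \<omega> * (dW a b \<omega> \<bullet> e)))
      = expectation (\<lambda>\<omega>. indicator A \<omega> * ((\<integral>s. Z s \<omega> \<partial>restrict_space lborel {a..<b}) \<bullet> e))"
proof -
  from Z obtain m p \<xi> where si: "\<And>k. simple_integrand M H a b (m k) (p k) (\<xi> k)"
    and lim1: "(\<lambda>k. \<integral>\<^sup>+\<omega>. (\<integral>\<^sup>+s\<in>{a..<b}.
            ennreal ((norm (Z s \<omega> - simple_process (m k) (p k) (\<xi> k) s \<omega>))\<^sup>2) \<partial>lborel) \<partial>M) \<longlonglongrightarrow> 0"
    and lim2: "(\<lambda>k. \<integral>\<^sup>+\<omega>. ennreal ((I \<omega> - simple_ito W (m k) (p k) (\<xi> k) \<omega>)\<^sup>2) \<partial>M) \<longlonglongrightarrow> 0"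
    and I[measurable]: "I \<in> borel_measurable M"
    and Zm: "(\<lambda>(s, \<omega>). Z s \<omega>) \<in> borel_measurable (restrict_space borel {a..<b} \<Otimes>\<^sub>M M)"
    and Z2: "(\<integral>\<^sup>+\<omega>. (\<integral>\<^sup>+s\<in>{a..<b}. ennreal ((norm (Z s \<omega>))\<^sup>2) \<partial>lborel) \<partial>M) < \<infinity>"
    unfolding has_ito_integral_def 
    apply (elim conjE exE)
    subgoal for m p \<xi> by (rule that[of m p \<xi>]) (simp_all only: simp_thms)
    done
  note el = simple_integrand_elementary[OF si ab(1,3)]
  let ?Ik = "\<lambda>k. el_ito {..<m k} (p k) (\<lambda>j. p k (Suc j)) (\<xi> k)"
  let ?h = "\<lambda>k. el_process {..<m k} (p k) (\<lambda>j. p k (Suc j)) (\<xi> k)"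
  note lim1 = lim1[unfolded simple_process_el_process] and lim2 = lim2[unfolded simple_ito_el_ito]
  have fmI: "finite_moments M (?Ik k)" for k by (rule finite_moments_el_ito[OF el(1)])
  have Ikm[measurable]: "?Ik k \<in> borel_measurable M" for k
    using finite_moments_measurable[OF fmI] .
  have nnL2: "L2_sq M X < \<infinity>" if "integrable M (\<lambda>\<omega>. (X \<omega>)\<^sup>2)" for X :: "'w \<Rightarrow> real"
    using that by (simp add: integrable_iff_bounded)
  have Ik2: "L2_sq M (?Ik k) < \<infinity>" for k
    by (rule nnL2) (rule finite_moments_square_integrable[OF fmI])
  have I2: "L2_sq M I < \<infinity>"
  proof -
    \<comment> \<open>One approximant at finite distance is enough, since every approximant has a
      finite second moment.\<close>
    have "eventually (\<lambda>k. (\<integral>\<^sup>+\<omega>. ennreal ((I \<omega> - ?Ik k \<omega>)\<^sup>2) \<partial>M) < 1) sequentially"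
      by (rule order_tendstoD(2)[OF lim2]) simp
    then obtain k where k: "(\<integral>\<^sup>+\<omega>. ennreal ((I \<omega> - ?Ik k \<omega>)\<^sup>2) \<partial>M) < 1"
      unfolding eventually_sequentially by auto
    have "(L2_sq M I) \<le> 2 * (\<integral>\<^sup>+\<omega>. ennreal ((I \<omega> - ?Ik k \<omega>)\<^sup>2) \<partial>M)
        + 2 * L2_sq M (?Ik k)"
      using nn_integral_norm_square_diff_le[OF I Ikm, of "\<lambda>_. 0" k] by simp
    also have "\<dots> < \<infinity>"
      using k Ik2[of k] order.strict_trans[OF k, of \<top>] by (auto simp: ennreal_mult_less_top)
    finally show ?thesis .
  qed
  then show "integrable M (\<lambda>\<omega>. (I \<omega>)\<^sup>2)" by (simp add: integrable_iff_bounded)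
  have limX: "(\<lambda>k. expectation (\<lambda>\<omega>. ?Ik k \<omega> * X \<omega>)) \<longlonglongrightarrow> expectation (\<lambda>\<omega>. I \<omega> * X \<omega>)"
    if X: "finite_moments M X" for X
    using tendsto_integral_inner_L2[OF I _ Ikm I2 _ Ik2, of X] lim2
      nnL2[OF finite_moments_square_integrable[OF X]] finite_moments_measurable[OF X] by simp
  \<comment> \<open>Mean square convergence of the integrands becomes convergence in the
    \<open>L2_sq\<close> sense on the product of \<open>N\<close> and \<open>M\<close>. This product
    is finite, so square integrability of \<open>Z\<close> implies integrability.\<close>
  define N where "N = restrict_space lborel {a..<b}"
  interpret N: finite_measure N
    by standard (use ab in \<open>simp add: N_def space_restrict_space emeasure_restrict_space\<close>)
  interpret P: pair_sigma_finite N M ..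
  let ?NM = "N \<Otimes>\<^sub>M M" and ?Z = "\<lambda>(s, \<omega>). Z s \<omega>" and ?hp = "\<lambda>k (s, \<omega>). ?h k s \<omega>"
  have setsN: "sets ?NM = sets (restrict_space borel {a..<b} \<Otimes>\<^sub>M M)"
    by (intro sets_pair_measure_cong) (auto simp: N_def sets_restrict_space)
  have Zm[measurable]: "(\<lambda>(s, \<omega>). Z s \<omega>) \<in> borel_measurable ?NM"
    using Zm by (simp cong: measurable_cong_sets add: setsN measurable_cong_sets[OF setsN refl])
  have idN: "(\<lambda>s. s) \<in> borel_measurable N"
    unfolding N_def by (intro measurable_restrict_space1) simp
  have hm[measurable]: "?hp k \<in> borel_measurable ?NM" for k
  proof -
    have "(\<lambda>x. (fst x, snd x)) \<in> N \<Otimes>\<^sub>M M \<rightarrow>\<^sub>M borel \<Otimes>\<^sub>M M"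
      by (intro measurable_Pair measurable_snd) (rule measurable_compose[OF measurable_fst idN])
    from measurable_compose[OF this el_process_measurable[OF el(1)[of k]]] show ?thesis by (simp add: split_beta')
  qed
  have nnN: "(\<integral>\<^sup>+x. F x \<partial>?NM) = (\<integral>\<^sup>+\<omega>. (\<integral>\<^sup>+s\<in>{a..<b}. F (s, \<omega>) \<partial>lborel) \<partial>M)"
    if "F \<in> borel_measurable ?NM" for F :: "real \<times> 'w \<Rightarrow> ennreal"
    by (subst P.nn_integral_snd[OF that, symmetric])
      (simp add: N_def nn_integral_restrict_space)
  have Z2P: "L2_sq ?NM ?Z < \<infinity>"
    using Z2 by (subst nnN) auto
  have h2P: "L2_sq ?NM (?hp k) < \<infinity>" for k
  proof -
    have "L2_sq ?NM (?hp k)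
      \<le> (\<integral>\<^sup>+\<omega>. (\<integral>\<^sup>+s. ennreal ((norm (?h k s \<omega>))\<^sup>2) \<partial>lborel) \<partial>M)"
      by (subst nnN) (auto intro!: nn_integral_mono simp: indicator_def)
    also have "\<dots> < \<infinity>" unfolding el_ito_isometry[OF el(1), symmetric] using Ik2[of k] by simp
    finally show ?thesis .
  qed
  have limP: "(\<lambda>k. L2_sq ?NM (\<lambda>x. ?Z x - ?hp k x)) \<longlonglongrightarrow> 0"
    using lim1 by (subst nnN) auto
  have finP: "finite_measure ?NM"
    by (rule finite_measure_pair_measure) (unfold_locales)
  have g2P: "L2_sq ?NM g < \<infinity>"
    if "\<And>x. x \<in> space ?NM \<Longrightarrow> norm (g x) \<le> 1" for g :: "real \<times> 'w \<Rightarrow> 'a"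
  proof -
    have "(L2_sq ?NM g) \<le> (\<integral>\<^sup>+x. 1 \<partial>?NM)"
      using that by (intro nn_integral_mono) (auto simp: power_le_one)
    also have "\<dots> < \<infinity>"
      using finite_measure.emeasure_finite[OF finP] by (simp add: less_top)
    finally show ?thesis .
  qed
  have intZ: "integrable ?NM (\<lambda>(s, \<omega>). Z s \<omega>)"
  proof (rule Bochner_Integration.integrable_bound[OF _ Zm])
    have "integrable ?NM (\<lambda>x. (norm (?Z x))\<^sup>2)"
      using Z2P by (simp add: integrable_iff_bounded)
    then show "integrable ?NM (\<lambda>x. 1 + (norm (?Z x))\<^sup>2)"
      by (intro Bochner_Integration.integrable_add finite_measure.integrable_const[OF finP])
    have "r \<le> 1 + r\<^sup>2" for r :: real
    proof -
      have "2 * r \<le> r\<^sup>2 + 1" using sum_squares_bound[of r 1] by simp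
      moreover have "0 \<le> r\<^sup>2" by simp
      ultimately show ?thesis by linarith
    qed
    then show "AE x in N \<Otimes>\<^sub>M M. norm (?Z x) \<le> norm (1 + (norm (?Z x))\<^sup>2)"
      by auto
  qed
  show "integrable M (\<lambda>\<omega>. \<integral>s. Z s \<omega> \<partial>restrict_space lborel {a..<b})"
    using P.integrable_snd[OF intZ] unfolding N_def .
  fix A assume A: "A \<in> sets (H a)"
  then have AM[measurable]: "A \<in> events" using subalgebra_H[of a] ab unfolding subalgebra_def by auto
  have fmA: "finite_moments M (indicator A)"
    by (rule finite_moments_bounded[of _ 1]) (auto simp: indicator_def)
  have AH: "indicator A \<in> borel_measurable (H a)"  using A by simp
  show "expectation (\<lambda>\<omega>. indicator A \<omega> * I \<omega>) = 0"
  proof -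
    have "expectation (\<lambda>\<omega>. ?Ik k \<omega> * indicator A \<omega>) = 0" for k
    proof -
      have t: "j < m k \<Longrightarrow> 0 \<le> p k j \<and> a \<le> p k j \<and> p k j \<le> p k (Suc j) \<and> p k (Suc j) \<le> T \<and> bdd_at (p k j) (\<xi> k j)" for j
        using el(1)[of k] el(2)[of j k] ab unfolding elementary_def by fastforce
      have "expectation (\<lambda>\<omega>. ?Ik k \<omega> * indicator A \<omega>)
        = expectation (\<lambda>\<omega>. \<Sum>j<m k. indicator A \<omega> * (\<xi> k j \<omega> \<bullet> (W (p k (Suc j)) \<omega> - W (p k j) \<omega>)))"
        unfolding el_ito_def by (simp only: sum_distrib_left mult.commute)
      also have "\<dots> = (\<Sum>j<m k. expectation (\<lambda>\<omega>. indicator A \<omega> * (\<xi> k j \<omega> \<bullet> (W (p k (Suc j)) \<omega> - W (p k j) \<omega>))))"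
        using t fmA by (intro Bochner_Integration.integral_sum finite_moments_integrable finite_moments_mult
          finite_moments_inner_incr[where p = "p k _"]) auto
      also have "\<dots> = 0"
      \<comment> \<open>The event \<open>A\<close> is known at \<open>a\<close>, hence at the left
        end \<open>p k j\<close> of every interval of the partition.\<close>
      proof (intro sum.neutral ballI expectation_inner_incr fmA)
        fix j assume "j \<in> {..<m k}"
        then have "p k j \<le> T" "a \<le> p k j" using t[of j] by auto
        then show "indicator A \<in> borel_measurable (H (p k j))"
          using measurable_H_mono[OF ab(1) _ _ AH] by blast
      qed (use t in auto)
      finally show ?thesis .
    qed
    with limX[OF fmA] show ?thesis
      by (simp add: LIMSEQ_const_iff mult.commute)
  qed
  fix e :: 'a assume e: "e \<in> Basis"
  let ?g = "\<lambda>(s :: real, \<omega>). indicator A \<omega> *\<^sub>R e"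
  \<comment> \<open>The integrand with constant value
    \<open>indicator A \<omega> *\<^sub>R e\<close> on one interval, whose integral \<open>S\<close>
    is the test variable of the covariance.\<close>
  define \<eta> where "\<eta> = (\<lambda>(j::unit) \<omega>. indicator A \<omega> *\<^sub>R e)"
  have \<eta>: "elementary {()} (\<lambda>_. a) (\<lambda>_. b) \<eta>"
    unfolding elementary_def bdd_at_def \<eta>_def using ab A e
    by (auto simp: bounded_iff indicator_def intro!: exI[of _ 1])
  define S where "S = el_ito {()} (\<lambda>_. a) (\<lambda>_. b) \<eta>"
  have S_eq: "S \<omega> = indicator A \<omega> * (dW a b \<omega> \<bullet> e)" for \<omega>
    by (simp add: S_def el_ito_def \<eta>_def inner_commute)
  have "(\<lambda>k. expectation (\<lambda>\<omega>. ?Ik k \<omega> * S \<omega>)) \<longlonglongrightarrow> expectation (\<lambda>\<omega>. I \<omega> * S \<omega>)"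
    unfolding S_def by (rule limX[OF finite_moments_el_ito[OF \<eta>]])
  moreover have "expectation (\<lambda>\<omega>. ?Ik k \<omega> * S \<omega>) = (\<integral>x. ?hp k x \<bullet> ?g x \<partial>?NM)" for k
  proof -
    \<comment> \<open>Elementary processes live on \<open>{a<..b}\<close> and the integrand
      \<open>Z\<close> on \<open>{a..<b}\<close>; the two end points are null.\<close>
    have ae: "AE s in lborel. ?h k s \<omega> \<bullet> el_process {()} (\<lambda>_. a) (\<lambda>_. b) \<eta> s \<omega>
      = indicator {a..<b} s *\<^sub>R (?h k s \<omega> \<bullet> (indicator A \<omega> *\<^sub>R e))" for \<omega>
      using AE_lborel_singleton[of a] AE_lborel_singleton[of b]
      by eventually_elim (auto simp: el_process_def \<eta>_def indicator_def)
    have meas: "(\<lambda>s. ?h k s \<omega>) \<in> borel_measurable lborel" for \<omega>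
      unfolding el_process_def by measurable
    have int: "integrable ?NM (\<lambda>x. ?hp k x \<bullet> ?g x)"
      by (intro integrable_inner_L2[OF hm _ h2P g2P]) (auto simp: indicator_def e)
    have "expectation (\<lambda>\<omega>. ?Ik k \<omega> * S \<omega>) = expectation (\<lambda>\<omega>. \<integral>s. ?h k s \<omega> \<bullet> el_process {()} (\<lambda>_. a) (\<lambda>_. b) \<eta> s \<omega> \<partial>lborel)"
      unfolding S_def by (rule el_ito_inner(1)[OF el(1) \<eta>])
    also have "\<dots> = expectation (\<lambda>\<omega>. \<integral>s. indicator {a..<b} s *\<^sub>R (?h k s \<omega> \<bullet> (indicator A \<omega> *\<^sub>R e)) \<partial>lborel)"
    proof (rule Bochner_Integration.integral_cong[OF refl], rule integral_cong_AE[OF _ _ ae])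
      show "(\<lambda>s. ?h k s \<omega> \<bullet> el_process {()} (\<lambda>_. a) (\<lambda>_. b) \<eta> s \<omega>) \<in> borel_measurable lborel" for \<omega>
        using meas unfolding el_process_def[of "{()}"] by measurable
      show "(\<lambda>s. indicator {a..<b} s *\<^sub>R (?h k s \<omega> \<bullet> (indicator A \<omega> *\<^sub>R e))) \<in> borel_measurable lborel" for \<omega>
        using meas by measurable
    qed
    also have "\<dots> = expectation (\<lambda>\<omega>. \<integral>s. ?h k s \<omega> \<bullet> (indicator A \<omega> *\<^sub>R e) \<partial>N)"
      unfolding N_def by (subst integral_restrict_space) auto
    also have "\<dots> = (\<integral>x. ?hp k x \<bullet> ?g x \<partial>?NM)"
      using P.integral_snd[of "\<lambda>s \<omega>. ?h k s \<omega> \<bullet> (indicator A \<omega> *\<^sub>R e)"] int by (simp add: split_beta')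
    finally show ?thesis .
  qed
  moreover have gm: "?g \<in> borel_measurable ?NM"
    by measurable
  have g2: "L2_sq ?NM ?g < \<infinity>"
    by (rule g2P) (auto simp: indicator_def e)
  have "(\<lambda>k. \<integral>x. ?hp k x \<bullet> ?g x \<partial>?NM)
    \<longlonglongrightarrow> (\<integral>x. ?Z x \<bullet> ?g x \<partial>?NM)"
    by (rule tendsto_integral_inner_L2[OF Zm gm hm Z2P g2 h2P limP])
  ultimately have "expectation (\<lambda>\<omega>. I \<omega> * S \<omega>) =
    (\<integral>x. ?Z x \<bullet> ?g x \<partial>?NM)"
    by (simp add: LIMSEQ_unique)
  also have "\<dots> = expectation (\<lambda>\<omega>. \<integral>s. Z s \<omega> \<bullet> (indicator A \<omega> *\<^sub>R e) \<partial>N)"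
    using P.integral_snd[of "\<lambda>s \<omega>. Z s \<omega> \<bullet> (indicator A \<omega> *\<^sub>R e)"] integrable_inner_L2[OF Zm gm Z2P g2]
    by (simp add: split_beta')
  also have "\<dots> = expectation (\<lambda>\<omega>. indicator A \<omega> * ((\<integral>s. Z s \<omega> \<partial>N) \<bullet> e))"
  proof (rule integral_cong_AE)
    show "(\<lambda>\<omega>. \<integral>s. Z s \<omega> \<bullet> (indicator A \<omega> *\<^sub>R e) \<partial>N) \<in> borel_measurable M"
      by measurable
    show "(\<lambda>\<omega>. indicator A \<omega> * ((\<integral>s. Z s \<omega> \<partial>N) \<bullet> e)) \<in> borel_measurable M"
      by measurable
    \<comment> \<open>Taking the fixed vector out of the time integral uses integrability of the
      section, which Fubini provides for almost every \<open>\<omega>\<close>.\<close>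
    show "AE \<omega> in M. (\<integral>s. Z s \<omega> \<bullet> (indicator A \<omega> *\<^sub>R e) \<partial>N) = indicator A \<omega> * ((\<integral>s. Z s \<omega> \<partial>N) \<bullet> e)"
      using P.AE_integrable_snd[OF intZ] by eventually_elim (simp add: indicator_def e)
  qed
  finally show "expectation (\<lambda>\<omega>. indicator A \<omega> * (I \<omega> * (dW a b \<omega> \<bullet> e)))
      = expectation (\<lambda>\<omega>. indicator A \<omega> * ((\<integral>s. Z s \<omega> \<partial>restrict_space lborel {a..<b}) \<bullet> e))"
    unfolding S_eq N_def by (simp only: mult.left_commute[of "I _" "indicator _ _"])
qed

end

section \<open>The filtration generated by the past of W, all of B and the null sets\<close>

text \<open>Increments of \<open>W\<close> after time \<open>s\<close> are independent even of this \<open>\<sigma>\<close>-algebra, which contains all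
  those of the scheme at time \<open>s\<close>; hence one filtration serves for every stochastic integral.\<close>

definition full_filtration ::
  "'w measure \<Rightarrow> real \<Rightarrow> (real \<Rightarrow> 'w \<Rightarrow> 'a::real_normed_vector) \<Rightarrow> (real \<Rightarrow> 'w \<Rightarrow> real)
    \<Rightarrow> real \<Rightarrow> 'w measure"
  where "full_filtration M T W B s =
    sigma (space M) (incr_events M W 0 {0..s} \<union> incr_events M B 0 {0..T} \<union> null_sets M)"

lemma incr_events_subset:
  fixes P :: "real \<Rightarrow> 'w \<Rightarrow> 'b::euclidean_space"
  assumes "space N = space M" "\<And>r. r \<in> I \<Longrightarrow> P r \<in> borel_measurable N" "P s \<in> borel_measurable N"
  shows "incr_events M P s I \<subseteq> sets N"
  unfolding incr_events_def using assms by (intro preimage_events_subset_sets) auto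

lemma incr_events_measurable:
  assumes "incr_events M P s I \<subseteq> sets N" "space N = space M" "r \<in> I"
  shows "(\<lambda>\<omega>. P r \<omega> - P s \<omega>) \<in> borel_measurable N"
  using assms unfolding incr_events_def by (intro preimage_events_measurable[of M _ N]) auto

text \<open>The increment from \<open>r\<close> to \<open>u\<close> is the difference of two
  increments from the base time \<open>s\<close>.\<close>

lemma incr_measurable_change_base:
  fixes P :: "real \<Rightarrow> 'w \<Rightarrow> 'b::euclidean_space"
  assumes "incr_events M P s I \<subseteq> sets N" "space N = space M" "r \<in> I" "u \<in> I"
  shows "(\<lambda>\<omega>. P u \<omega> - P r \<omega>) \<in> borel_measurable N"
  using borel_measurable_diff[OF incr_events_measurable[OF assms(1,2,4)] incr_events_measurable[OF assms(1,2,3)]]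
  by simp

lemma incr_events_change_base:
  fixes P :: "real \<Rightarrow> 'w \<Rightarrow> 'b::euclidean_space"
  assumes "space N = space M" "incr_events M P s I \<subseteq> sets N" "J \<subseteq> I" "r \<in> I"
  shows "incr_events M P r J \<subseteq> sets N"
  unfolding incr_events_def[of M P r J] using assms
  by (intro preimage_events_subset_sets) (auto intro: incr_measurable_change_base)

lemma incr_events_mono: "I \<subseteq> J \<Longrightarrow> incr_events M P s I \<subseteq> incr_events M P s J"
  unfolding incr_events_def preimage_events_def by blast

lemma space_full_filtration [simp]: "space (full_filtration M T W B s) = space M"
  by (simp add: full_filtration_def space_measure_of_conv)

lemma incr_events_Pow: "incr_events M P s I \<subseteq> Pow (space M)"
  unfolding incr_events_def by (rule preimage_events_subset_Pow)

lemma sets_full_filtration: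
  "incr_events M W 0 {0..s} \<union> incr_events M B 0 {0..T} \<union> null_sets M \<subseteq> sets (full_filtration M T W B s)"
proof -
  have "incr_events M W 0 {0..s} \<union> incr_events M B 0 {0..T} \<union> null_sets M \<subseteq> Pow (space M)"
    using incr_events_Pow[of M W] incr_events_Pow[of M B] sets.sets_into_space by blast
  from sets_measure_of[OF this] show ?thesis
    unfolding full_filtration_def by (auto intro: sigma_sets.Basic)
qed

context
  fixes M :: "'w measure" and T :: real
    and W :: "real \<Rightarrow> 'w \<Rightarrow> 'a::euclidean_space" and B :: "real \<Rightarrow> 'w \<Rightarrow> real"
  assumes M: "prob_space M" and W: "brownian_motion M T W" and B: "brownian_motion M T B"
    and WB: "indep_processes M T W B"
begin

lemma full_filtration_subalgebra:
  assumes "0 \<le> s" "s \<le> T"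
  shows "subalgebra M (full_filtration M T W B s)"
proof -
  have "incr_events M W 0 {0..s} \<subseteq> sets M"
    using W assms unfolding brownian_motion_def by (intro incr_events_subset) auto
  moreover have "incr_events M B 0 {0..T} \<subseteq> sets M"
    using B assms unfolding brownian_motion_def by (intro incr_events_subset) auto
  ultimately show ?thesis
    unfolding full_filtration_def by (intro subalgebra_sigma) auto
qed

lemma full_filtration_mono:
  assumes "s \<le> r"
  shows "subalgebra (full_filtration M T W B r) (full_filtration M T W B s)"
  unfolding full_filtration_def[of M T W B s]
  using assms sets_full_filtration[of M W r B T] incr_events_mono[of "{0..s}" "{0..r}" M W 0]
  by (intro subalgebra_sigma) auto

text \<open>A generator argument: the events agreeing almost surely with an intersection of an event
  of the past of \<open>W\<close> and an event of \<open>B\<close> form an \<open>Int_stable\<close>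
  family that contains all generators. On this family independence of the increment follows from
  independence of \<open>W\<close> and \<open>B\<close> combined with that of the increments of
  \<open>W\<close>.\<close>

lemma full_filtration_indep:
  assumes s: "0 \<le> s" "s < r" "r \<le> T"
  shows "indep_sigalg M (full_filtration M T W B s) (sigma (space M) (preimage_events M {\<lambda>\<omega>. W r \<omega> - W s \<omega>}))"
    (is "indep_sigalg M ?H ?D")
proof -
  interpret prob_space M by (rule M)
  let ?A = "sigma (space M) (preimage_events M (W ` {0..s}))"
  let ?WT = "sigma (space M) (preimage_events M (W ` {0..T}))"
  let ?B = "sigma (space M) (preimage_events M (B ` {0..T}))"
  have AD: "indep_set (sets ?A) (sets ?D)"
    using W s unfolding brownian_motion_def indep_sigalg_def by blast
  have WTB: "indep_set (sets ?WT) (sets ?B)"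
    using WB unfolding indep_processes_def indep_sigalg_def by blast
  have Wm: "W u \<in> borel_measurable ?WT" if "u \<in> {0..T}" for u
    using that by (intro measurable_sigma_preimage_events) auto
  have WmA: "W u \<in> borel_measurable ?A" if "u \<in> {0..s}" for u
    using that by (intro measurable_sigma_preimage_events) auto
  have Bm: "B u \<in> borel_measurable ?B" if "u \<in> {0..T}" for u
    using that by (intro measurable_sigma_preimage_events) auto
  have sA: "sets ?A \<subseteq> sets ?WT"
    by (intro sets_sigma_subset preimage_events_subset_sets) (use Wm s in \<open>auto simp: space_measure_of_conv\<close>)
  have sD: "sets ?D \<subseteq> sets ?WT"
    by (intro sets_sigma_subset preimage_events_subset_sets) (use Wm s in \<open>auto simp: space_measure_of_conv\<close>)
  have ev: "sets ?A \<subseteq> events" "sets ?D \<subseteq> events" "sets ?B \<subseteq> events"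
    using AD WTB by (auto simp: indep_sets2_eq)
  \<comment> \<open>Requiring equality only almost surely lets \<open>G\<close> contain the null
    sets while every member keeps a product form.\<close>
  define G where "G = {E \<in> events. \<exists>a\<in>sets ?A. \<exists>c\<in>sets ?B. AE \<omega> in M. \<omega> \<in> E \<longleftrightarrow> \<omega> \<in> a \<inter> c}"
  have "Int_stable G"
  proof (rule Int_stableI)
    fix E E' assume "E \<in> G" "E' \<in> G"
    then obtain a c a' c' where E: "E \<in> events" "a \<in> sets ?A" "c \<in> sets ?B" "AE \<omega> in M. \<omega> \<in> E \<longleftrightarrow> \<omega> \<in> a \<inter> c"
      and E': "E' \<in> events" "a' \<in> sets ?A" "c' \<in> sets ?B" "AE \<omega> in M. \<omega> \<in> E' \<longleftrightarrow> \<omega> \<in> a' \<inter> c'"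
      unfolding G_def by auto
    have "AE \<omega> in M. \<omega> \<in> E \<inter> E' \<longleftrightarrow> \<omega> \<in> (a \<inter> a') \<inter> (c \<inter> c')"
      using E(4) E'(4) by eventually_elim auto
    then show "E \<inter> E' \<in> G"
      unfolding G_def using sets.Int[OF E(1) E'(1)] sets.Int[OF E(2) E'(2)] sets.Int[OF E(3) E'(3)] by blast
  qed
  have indep: "indep_set G (sets ?D)"
  proof (rule indep_setI)
    show "G \<subseteq> events" by (auto simp: G_def)
    fix E d assume "E \<in> G" and d: "d \<in> sets ?D"
    then obtain a c where E: "E \<in> events" "a \<in> sets ?A" "c \<in> sets ?B" "AE \<omega> in M. \<omega> \<in> E \<longleftrightarrow> \<omega> \<in> a \<inter> c"
      unfolding G_def by auto
    have evs: "a \<in> events" "c \<in> events" "d \<in> events" using E d ev by auto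
    have aW: "a \<in> sets ?WT" and dW: "d \<in> sets ?WT" using E d sA sD by auto
    have "prob (E \<inter> d) = prob ((a \<inter> c) \<inter> d)"
      using E(4) by (intro finite_measure_eq_AE) (use E evs in \<open>auto elim!: eventually_mono\<close>)
    \<comment> \<open>Both \<open>a\<close> and \<open>d\<close> are events of \<open>W\<close>, so
      \<open>c\<close> is split off first; then \<open>a\<close> and \<open>d\<close> separate by
      the independent increments of \<open>W\<close>, and finally \<open>a\<close> and
      \<open>c\<close> are joined again.\<close>
    also have "\<dots> = prob ((a \<inter> d) \<inter> c)" by (simp add: ac_simps)
    also have "\<dots> = prob (a \<inter> d) * prob c" using indep_setD[OF WTB sets.Int[OF aW dW] E(3)] .
    also have "\<dots> = prob a * prob c * prob d" using indep_setD[OF AD E(2) d] by simp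
    also have "prob a * prob c = prob (a \<inter> c)" using indep_setD[OF WTB aW E(3)] by simp
    also have "\<dots> = prob E"
      using E(4) by (intro finite_measure_eq_AE) (use E evs in \<open>auto elim!: eventually_mono\<close>)
    finally show "prob (E \<inter> d) = prob E * prob d" .
  qed (use ev in auto)
  have topA: "space M \<in> sets ?A" and topB: "space M \<in> sets ?B"
    using sets.top[of ?A] sets.top[of ?B] by (simp_all add: space_measure_of_conv)
  have "incr_events M W 0 {0..s} \<subseteq> sets ?A"
    using WmA s by (intro incr_events_subset) (auto simp: space_measure_of_conv)
  moreover have "E \<in> G" if "E \<in> sets ?A" for E
    unfolding G_def using that ev topB by (intro CollectI conjI bexI[of _ E] bexI[of _ "space M"] AE_I2) auto
  ultimately have 1: "incr_events M W 0 {0..s} \<subseteq> G" by blast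
  have "incr_events M B 0 {0..T} \<subseteq> sets ?B"
    using Bm s by (intro incr_events_subset) (auto simp: space_measure_of_conv)
  moreover have "E \<in> G" if "E \<in> sets ?B" for E
    unfolding G_def
    by (rule CollectI, rule conjI, use that ev in blast, rule bexI[of _ "space M"], rule bexI[of _ E])
      (use that topA in \<open>auto intro: AE_I2\<close>)
  ultimately have 2: "incr_events M B 0 {0..T} \<subseteq> G" by blast
  have 3: "null_sets M \<subseteq> G"
  proof
    fix E assume E: "E \<in> null_sets M"
    \<comment> \<open>A null event agrees almost surely with the empty event, represented by
      \<open>a = {}\<close> and \<open>c = space M\<close>.\<close>
    have "AE \<omega> in M. \<omega> \<in> E \<longleftrightarrow> \<omega> \<in> {} \<inter> space M" using AE_not_in[OF E] by auto
    with E topB show "E \<in> G" unfolding G_def by (blast intro: sets.empty_sets null_setsD2)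
  qed
  have gen: "incr_events M W 0 {0..s} \<union> incr_events M B 0 {0..T} \<union> null_sets M \<subseteq> Pow (space M)"
    using incr_events_Pow[of M W] incr_events_Pow[of M B] sets.sets_into_space by blast
  have "sets ?H = sigma_sets (space M) (incr_events M W 0 {0..s} \<union> incr_events M B 0 {0..T} \<union> null_sets M)"
    unfolding full_filtration_def using gen by simp
  also have "\<dots> \<subseteq> sigma_sets (space M) G"
    using 1 2 3 by (intro sigma_sets_mono') auto
  finally have H: "sets ?H \<subseteq> sigma_sets (space M) G" .
  have D: "sigma_sets (space M) (sets ?D) = sets ?D"
    using sets.sigma_sets_eq[of ?D] by (simp add: space_measure_of_conv)
  have "indep_set (sigma_sets (space M) G) (sigma_sets (space M) (sets ?D))"
    by (rule indep_set_sigma_sets[OF indep \<open>Int_stable G\<close> sets.Int_stable])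
  then show ?thesis
    unfolding indep_sigalg_def using H unfolding D indep_sets2_eq by blast
qed

lemma bm_filtration_full: "bm_filtration M T W (full_filtration M T W B)"
proof -
  interpret prob_space M by (rule M)
  show ?thesis
  proof unfold_locales
    fix s r :: real assume "0 \<le> s" "s \<le> r" "r \<le> T"
    have sub: "incr_events M W 0 {0..r} \<subseteq> sets (full_filtration M T W B r)"
      using sets_full_filtration[of M W r B T] by auto
    show "(\<lambda>\<omega>. W r \<omega> - W s \<omega>) \<in> borel_measurable (full_filtration M T W B r)"
      by (rule incr_measurable_change_base[OF sub]) (use \<open>0 \<le> s\<close> \<open>s \<le> r\<close> in auto)
  qed (use full_filtration_subalgebra full_filtration_mono full_filtration_indep W in
        \<open>auto simp: brownian_motion_def\<close>)
qed

lemma incr_B_full: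
  assumes "0 \<le> c" "c \<le> T"
  shows "incr_events M B c {c..T} \<subseteq> sets (full_filtration M T W B s)"
  by (rule incr_events_change_base[of _ _ B 0 "{0..T}"])
    (use assms sets_full_filtration[of M W s B T] in auto)

lemma sigalg_F_full:
  assumes "0 \<le> s" "s \<le> T"
  shows "subalgebra (full_filtration M T W B s) (sigalg_F M T W B s)"
  unfolding sigalg_F_def using incr_B_full[OF assms] sets_full_filtration[of M W s B T]
  by (intro subalgebra_sigma) auto

lemma sigalg_G_full:
  assumes "0 \<le> c" "c \<le> T"
  shows "subalgebra (full_filtration M T W B s) (sigalg_G M T W B c s)"
  unfolding sigalg_G_def using incr_B_full[OF assms] sets_full_filtration[of M W s B T]
  by (intro subalgebra_sigma) auto

lemma sigalg_FW_full: "subalgebra (full_filtration M T W B s) (sigalg_FW M W s)"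
  unfolding sigalg_FW_def using sets_full_filtration[of M W s B T] by (intro subalgebra_sigma) auto

lemma space_sigalg_F [simp]: "space (sigalg_F M T W B s) = space M"
  by (simp add: sigalg_F_def space_measure_of_conv)

lemma sets_sigalg_F:
  "incr_events M W 0 {0..s} \<union> incr_events M B s {s..T} \<union> null_sets M \<subseteq> sets (sigalg_F M T W B s)"
proof -
  have "incr_events M W 0 {0..s} \<union> incr_events M B s {s..T} \<union> null_sets M \<subseteq> Pow (space M)"
    using incr_events_Pow[of M W] incr_events_Pow[of M B] sets.sets_into_space by blast
  from sets_measure_of[OF this] show ?thesis
    unfolding sigalg_F_def by (auto intro: sigma_sets.Basic)
qed

lemma sigalg_F_subalgebra:
  assumes "0 \<le> s" "s \<le> T"
  shows "subalgebra M (sigalg_F M T W B s)"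
  using full_filtration_subalgebra[OF assms] sigalg_F_full[OF assms] by (auto simp: subalgebra_def)

text \<open>At the left end of its interval the filtration of the scheme is contained in
  \<open>sigalg_F\<close>. Hence \<open>Y\<close> at a grid time is already known there and equals
  its own conditional expectation.\<close>

lemma sigalg_G_F: "subalgebra (sigalg_F M T W B s) (sigalg_G M T W B s s)"
  unfolding sigalg_G_def using sets_sigalg_F[of s] by (intro subalgebra_sigma) auto

lemma sigalg_FW_F:
  assumes "r \<le> s"
  shows "subalgebra (sigalg_F M T W B s) (sigalg_FW M W r)"
  unfolding sigalg_FW_def
  using assms sets_sigalg_F[of s] incr_events_mono[of "{0..r}" "{0..s}" M W 0]
  by (intro subalgebra_sigma) auto

lemma incr_B_sigalg_F:
  assumes "s \<le> u" "u \<le> r" "r \<le> T"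
  shows "(\<lambda>\<omega>. B r \<omega> - B u \<omega>) \<in> borel_measurable (sigalg_F M T W B s)"
  by (rule incr_measurable_change_base[of M B s "{s..T}"]) (use assms sets_sigalg_F[of s] in auto)

end

section \<open>The Euler scheme on the grid\<close>

lemma subdivision_less:
  assumes "subdivision T n t" "i < j" "j \<le> n" shows "t i < t j"
  using assms(2,3)
proof (induction j)
  case (Suc j)
  then have "t j < t (Suc j)" using assms(1) unfolding subdivision_def by auto
  then show ?case using Suc by (cases "i = j") auto
qed simp

lemma subdivision_le:
  assumes "subdivision T n t" "i \<le> j" "j \<le> n" shows "t i \<le> t j"
  using subdivision_less[OF assms(1), of i j] assms(2,3) by (cases "i = j") auto

lemma subdivision_bounds:
  assumes "subdivision T n t" "i \<le> n" shows "0 \<le> t i" "t i \<le> T"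
  using subdivision_le[OF assms(1), of 0 i] subdivision_le[OF assms(1), of i n] assms
  unfolding subdivision_def by auto

lemma grid_floor_eq:
  assumes "subdivision T n t" "l < n" "t l < s" "s < t (Suc l)"
  shows "grid_floor n t s = t l"
  unfolding grid_floor_def
proof (rule Max_eqI)
  have "{t i |i. i \<le> n \<and> t i \<le> s} \<subseteq> t ` {..n}" by auto
  then show "finite {t i |i. i \<le> n \<and> t i \<le> s}" by (rule finite_subset) simp
  show "t l \<in> {t i |i. i \<le> n \<and> t i \<le> s}" using assms by force
  fix y assume "y \<in> {t i |i. i \<le> n \<and> t i \<le> s}"
  then obtain i where i: "y = t i" "i \<le> n" "t i \<le> s" by auto
  have "i \<le> l"
  proof (rule ccontr)
    assume "\<not> i \<le> l"
    then have "t (Suc l) \<le> t i" using subdivision_le[OF assms(1), of "Suc l" i] i by simp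
    then show False using assms i by simp
  qed
  then show "y \<le> t l" using subdivision_le[OF assms(1), of i l] assms i by simp
qed

text \<open>Grid points are excluded because the conventions differ there: at \<open>t l\<close> the
  indicators select the cell that ends at \<open>t l\<close>, whereas \<open>grid_floor\<close>
  returns \<open>t l\<close> itself.\<close>

lemma sum_indicator_grid:
  fixes F :: "real \<Rightarrow> 'b::real_vector"
  assumes sd: "subdivision T n t" and "i \<le> n" and s: "s \<notin> t ` {..i}"
  shows "(\<Sum>l<i. indicator {t l<..t (Suc l)} s *\<^sub>R F (t l)) = (if s \<in> {0..t i} then F (grid_floor n t s) else 0)"
  using assms(2,3)
proof (induction i)
  case 0
  then show ?case using sd by (auto simp: subdivision_def)
next
  case (Suc i)
  have IH: "(\<Sum>l<i. indicator {t l<..t (Suc l)} s *\<^sub>R F (t l)) = (if s \<in> {0..t i} then F (grid_floor n t s) else 0)"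
  proof (rule Suc.IH)
    show "i \<le> n" "s \<notin> t ` {..i}" using Suc.prems by (auto simp: atMost_Suc)
  qed
  have lt: "t i < t (Suc i)" "0 \<le> t i" using subdivision_less[OF sd, of i "Suc i"] subdivision_bounds[OF sd, of i] Suc by auto
  have ne: "s \<noteq> t i" "s \<noteq> t (Suc i)" using Suc.prems by auto
  show ?case
  proof (cases "t i < s \<and> s < t (Suc i)")
    case True
    then have "grid_floor n t s = t i" using grid_floor_eq[OF sd, of i s] Suc.prems by auto
    then show ?thesis using IH True lt by (simp add: sum.lessThan_Suc del: sum_indicator_scaleR)
  next
    case False
    then have "indicator {t i<..t (Suc i)} s = (0::real)" using ne by (auto simp: indicator_def)
    moreover have "s \<in> {0..t (Suc i)} \<longleftrightarrow> s \<in> {0..t i}" using False ne lt by auto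
    ultimately show ?thesis using IH by (simp add: sum.lessThan_Suc del: sum_indicator_scaleR)
  qed
qed

lemma grid_integral:
  fixes F :: "real \<Rightarrow> real^'d"
  assumes sd: "subdivision T n t" and "i \<le> n"
  shows "(LINT s:{0..t i}|lborel. F (grid_floor n t s)) = (\<Sum>l<i. (t (Suc l) - t l) *\<^sub>R F (t l))"
proof -
  let ?g = "\<lambda>s. \<Sum>l<i. indicator {t l<..t (Suc l)} s *\<^sub>R F (t l)"
  have int: "integrable lborel (\<lambda>s. indicator {t l<..t (Suc l)} s *\<^sub>R F (t l))" for l
    by (cases "t l \<le> t (Suc l)") (auto intro!: integrable_scaleR_left simp: integrable_indicator_iff)
  have "(LINT s:{0..t i}|lborel. F (grid_floor n t s)) = (\<integral>s. ?g s \<partial>lborel)"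
    unfolding set_lebesgue_integral_def
    by (rule integral_discrete_difference[of "t ` {..i}"])
      (auto simp: sum_indicator_grid[OF sd \<open>i \<le> n\<close>] countable_finite simp del: sum_indicator_scaleR)
  also have "\<dots> = (\<Sum>l<i. \<integral>s. indicator {t l<..t (Suc l)} s *\<^sub>R F (t l) \<partial>lborel)"
    using int by (intro Bochner_Integration.integral_sum)
  also have "\<dots> = (\<Sum>l<i. (t (Suc l) - t l) *\<^sub>R F (t l))"
    using subdivision_le[OF sd] \<open>i \<le> n\<close> by (intro sum.cong refl) simp
  finally show ?thesis .
qed

text \<open>Cauchy-Schwarz in each row. The dimension factor comes from summing the coordinates;
  only the finiteness of the constant matters.\<close>

lemma norm_matrix_vector_le:
  fixes A :: "real^'d^'d"
  shows "norm (A *v x) \<le> real CARD('d) * norm A * norm x"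
proof -
  have "norm (A *v x) \<le> (\<Sum>k\<in>UNIV. \<bar>(A *v x) $ k\<bar>)" by (rule norm_le_l1_cart)
  also have "\<dots> \<le> (\<Sum>k\<in>(UNIV::'d set). norm A * norm x)"
  proof (rule sum_mono)
    fix k
    have "\<bar>(A *v x) $ k\<bar> \<le> norm (A $ k) * norm x"
      unfolding matrix_vector_mul_component by (rule Cauchy_Schwarz_ineq2)
    also have "\<dots> \<le> norm A * norm x"
      using Finite_Cartesian_Product.norm_nth_le[of A k] by (intro mult_right_mono) auto
    finally show "\<bar>(A *v x) $ k\<bar> \<le> norm A * norm x" .
  qed
  finally show ?thesis by simp
qed

locale euler_scheme = bm_filtration M T W H
  for M :: "'w measure" and T :: real and W :: "real \<Rightarrow> 'w \<Rightarrow> real^'d" and H :: "real \<Rightarrow> 'w measure" +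
  fixes n :: nat and t :: "nat \<Rightarrow> real" and b :: "real^'d \<Rightarrow> real^'d" and \<sigma> :: "real^'d \<Rightarrow> real^'d^'d"
    and x0 :: "real^'d" and X :: "real \<Rightarrow> 'w \<Rightarrow> real^'d"
  assumes FW: "\<And>s. subalgebra (H s) (sigalg_FW M W s)"
    and sd: "subdivision T n t" and X: "euler_X M T n t W b \<sigma> x0 X"
    and \<sigma>: "\<sigma> \<in> borel_measurable borel" "bounded (range \<sigma>)" and b: "bounded (range b)"
begin

text \<open>Along the grid, row \<open>k\<close> of the integrand is piecewise constant with values
  known at the left ends, so \<open>ito_integral_unique\<close> evaluates its integral as a finite
  sum; the drift is a step function as well.\<close>

lemma euler_X_grid:
  assumes i: "i \<le> n"
  shows "AE \<omega> in M. X (t i) \<omega> =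
    x0 + (\<Sum>l<i. (t (Suc l) - t l) *\<^sub>R b (X (t l) \<omega>) + \<sigma> (X (t l) \<omega>) *v (W (t (Suc l)) \<omega> - W (t l) \<omega>))"
proof -
  have ti: "t i \<in> {0..T}" using subdivision_bounds[OF sd i] by simp
  obtain I :: "'w \<Rightarrow> real^'d" where
    I: "\<And>k. has_ito_integral M (sigalg_FW M W) W 0 (t i) (\<lambda>s \<omega>. \<sigma> (X (grid_floor n t s) \<omega>) $ k) (\<lambda>\<omega>. I \<omega> $ k)"
    and eq: "AE \<omega> in M. X (t i) \<omega> = x0 + (LINT s:{0..t i}|lborel. b (X (grid_floor n t s) \<omega>)) + I \<omega>"
    using X ti unfolding euler_X_def by blast
  \<comment> \<open>Boundedness of \<open>\<sigma>\<close> makes its frozen rows admissible values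
    of an elementary process.\<close>
  have bdd: "bdd_at (t l) (\<lambda>\<omega>. \<sigma> (X (t l) \<omega>) $ k)" if "l \<le> n" for l k
  proof -
    have "X (t l) \<in> borel_measurable (sigalg_FW M W (t l))"
      using X subdivision_bounds[OF sd that] unfolding euler_X_def by auto
    then have Xm: "X (t l) \<in> borel_measurable (H (t l))" by (rule measurable_from_subalg[OF FW])
    have "(\<lambda>\<omega>. \<sigma> (X (t l) \<omega>) $ k) \<in> borel_measurable (H (t l))"
      by (rule measurable_compose[OF measurable_compose[OF Xm \<sigma>(1)]])
        (intro borel_measurable_continuous_onI continuous_intros)
    moreover obtain C where "\<And>x. norm (\<sigma> x) \<le> C" using \<sigma>(2) unfolding bounded_iff by auto
    then have "norm (\<sigma> x $ k) \<le> C" for x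
      using order_trans[OF Finite_Cartesian_Product.norm_nth_le] by blast
    then have "bounded ((\<lambda>\<omega>. \<sigma> (X (t l) \<omega>) $ k) ` space M)" unfolding bounded_iff by auto
    ultimately show ?thesis unfolding bdd_at_def by simp
  qed
  have Ik: "AE \<omega> in M. I \<omega> $ k = (\<Sum>l<i. \<sigma> (X (t l) \<omega>) $ k \<bullet> (W (t (Suc l)) \<omega> - W (t l) \<omega>))" for k
  proof -
    have "AE \<omega> in M. I \<omega> $ k = el_ito {..<i} t (\<lambda>l. t (Suc l)) (\<lambda>l \<omega>. \<sigma> (X (t l) \<omega>) $ k) \<omega>"
    proof (rule ito_integral_unique[OF has_ito_integral_mono[OF I FW]])
      show "elementary {..<i} t (\<lambda>l. t (Suc l)) (\<lambda>l \<omega>. \<sigma> (X (t l) \<omega>) $ k)"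
        unfolding elementary_def using subdivision_bounds[OF sd] subdivision_le[OF sd] bdd i by auto
      fix l assume "l \<in> {..<i}"
      then show "0 \<le> t l \<and> t (Suc l) \<le> t i"
        using subdivision_bounds[OF sd, of l] subdivision_le[OF sd, of "Suc l" i] i by auto
    next
      fix \<omega> assume "\<omega> \<in> space M"
      show "AE s in lborel. s \<in> {0..<t i} \<longrightarrow> \<sigma> (X (grid_floor n t s) \<omega>) $ k =
         el_process {..<i} t (\<lambda>l. t (Suc l)) (\<lambda>l \<omega>. \<sigma> (X (t l) \<omega>) $ k) s \<omega>"
        unfolding el_process_def using AE_not_in[OF finite_imp_null_set_lborel, of "t ` {..i}"]
        by (auto elim!: eventually_mono simp del: sum_indicator_scaleR
          simp: sum_indicator_grid[OF sd i, of _ "\<lambda>r. \<sigma> (X r \<omega>) $ k"])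
    qed (use ti in auto)
    then show ?thesis unfolding el_ito_def .
  qed
  have "AE \<omega> in M. \<forall>k. I \<omega> $ k = (\<Sum>l<i. \<sigma> (X (t l) \<omega>) $ k \<bullet> (W (t (Suc l)) \<omega> - W (t l) \<omega>))"
    using Ik by (simp add: AE_all_countable)
  with eq show ?thesis
  proof eventually_elim
    case (elim \<omega>)
    have "I \<omega> = (\<Sum>l<i. \<sigma> (X (t l) \<omega>) *v (W (t (Suc l)) \<omega> - W (t l) \<omega>))"
      unfolding vec_eq_iff sum_component matrix_vector_mul_component using elim(2) by simp
    then show ?case
      using elim(1) grid_integral[OF sd i, of "\<lambda>r. b (X r \<omega>)"] by (simp add: sum.distrib)
  qed
qed

lemma euler_X_step:
  assumes "i < n"
  shows "AE \<omega> in M. X (t (Suc i)) \<omega> = euler_step W b \<sigma> (t i) (t (Suc i)) (X (t i) \<omega>) \<omega>"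
  using euler_X_grid[of i] euler_X_grid[of "Suc i"] assms
  unfolding euler_step_def by (auto elim!: eventually_elim2 simp: sum.lessThan_Suc)

text \<open>With bounded \<open>b\<close> and \<open>\<sigma>\<close> the grid values are dominated
  by a constant plus a finite combination of norms of Gaussian increments.\<close>

lemma euler_X_moments:
  assumes i: "i \<le> n"
  shows "finite_moments M (\<lambda>\<omega>. norm (X (t i) \<omega>))"
proof -
  obtain Cb where Cb: "\<And>x. norm (b x) \<le> Cb" using b unfolding bounded_iff by auto
  obtain Cs where Cs: "\<And>x. norm (\<sigma> x) \<le> Cs" using \<sigma>(2) unfolding bounded_iff by auto
  have ti: "0 \<le> t i" "t i \<le> T" using subdivision_bounds[OF sd i] by auto
  have "X (t i) \<in> borel_measurable (sigalg_FW M W (t i))"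
    using X ti unfolding euler_X_def by auto
  then have Xm: "X (t i) \<in> borel_measurable M"
    using measurable_H[OF ti measurable_from_subalg[OF FW]] by blast
  let ?S = "\<lambda>\<omega>. norm x0 + (\<Sum>l<i. (t (Suc l) - t l) * Cb + real CARD('d) * Cs * norm (W (t (Suc l)) \<omega> - W (t l) \<omega>))"
  show ?thesis
  proof (rule finite_moments_bound)
    show "finite_moments M ?S"
      using i subdivision_bounds[OF sd] subdivision_le[OF sd]
      by (intro finite_moments_add finite_moments_sum finite_moments_mult finite_moments_incr)
        (auto intro!: finite_moments_bounded[OF _ order_refl])
    show "(\<lambda>\<omega>. norm (X (t i) \<omega>)) \<in> borel_measurable M" using Xm by simp
    show "AE \<omega> in M. \<bar>norm (X (t i) \<omega>)\<bar> \<le> \<bar>?S \<omega>\<bar>"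
      using euler_X_grid[OF i]
    proof eventually_elim
      case (elim \<omega>)
      have "norm (X (t i) \<omega>) \<le> norm x0 + norm (\<Sum>l<i. (t (Suc l) - t l) *\<^sub>R b (X (t l) \<omega>) + \<sigma> (X (t l) \<omega>) *v (W (t (Suc l)) \<omega> - W (t l) \<omega>))"
        unfolding elim by (rule norm_triangle_ineq)
      also have "\<dots> \<le> ?S \<omega>"
      proof (intro add_left_mono sum_norm_le order_trans[OF norm_triangle_ineq] add_mono)
        fix l assume "l \<in> {..<i}"
        then have "0 \<le> t (Suc l) - t l" using subdivision_le[OF sd, of l "Suc l"] i by auto
        then show "norm ((t (Suc l) - t l) *\<^sub>R b (X (t l) \<omega>)) \<le> (t (Suc l) - t l) * Cb"
          using Cb by (simp add: mult_left_mono)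
        show "norm (\<sigma> (X (t l) \<omega>) *v (W (t (Suc l)) \<omega> - W (t l) \<omega>)) \<le> real CARD('d) * Cs * norm (W (t (Suc l)) \<omega> - W (t l) \<omega>)"
          by (rule order_trans[OF norm_matrix_vector_le]) (intro mult_right_mono mult_left_mono Cs; simp)
      qed
      finally show ?case by simp
    qed
  qed
qed

end

section \<open>Conditional expectations by freezing the known variables\<close>

lemma measurable_pair_subalgebra:
  assumes "subalgebra M C" "F \<in> measurable (N \<Otimes>\<^sub>M C) L"
  shows "F \<in> measurable (N \<Otimes>\<^sub>M M) L"
proof -
  have "(\<lambda>p. (fst p, snd p)) \<in> measurable (N \<Otimes>\<^sub>M M) (N \<Otimes>\<^sub>M C)"
    using measurable_from_subalg[OF assms(1) measurable_ident_sets[OF refl]]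
    by (intro measurable_Pair measurable_fst) (rule measurable_compose[OF measurable_snd], simp add: id_def)
  from measurable_compose[OF this assms(2)] show ?thesis by simp
qed

lemma (in prob_space) freezing_measurable:
  fixes \<Psi> :: "'x \<Rightarrow> 'a \<Rightarrow> 'b::{banach, second_countable_topology}"
  assumes "subalgebra M C" "(\<lambda>(x, \<omega>). \<Psi> x \<omega>) \<in> borel_measurable (N \<Otimes>\<^sub>M C)"
  shows "(\<lambda>x. \<integral>\<omega>. \<Psi> x \<omega> \<partial>M) \<in> borel_measurable N"
  using borel_measurable_lebesgue_integral[OF measurable_pair_subalgebra[OF assms]] .

text \<open>Independence means that the joint law of \<open>\<xi>\<close> and of the identity into
  \<open>C\<close> is the product of the two laws; Fubini for this product gives both
  claims.\<close>

lemma (in prob_space) freezing_integral: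
  fixes \<Psi> :: "'x \<Rightarrow> 'a \<Rightarrow> real"
  assumes ind: "indep_sigalg M C F" and sp: "space C = space M" "space F = space M"
    and \<xi>: "\<xi> \<in> measurable F N" and \<Psi>: "(\<lambda>(x, \<omega>). \<Psi> x \<omega>) \<in> borel_measurable (N \<Otimes>\<^sub>M C)"
    and int: "integrable M (\<lambda>\<omega>. \<Psi> (\<xi> \<omega>) \<omega>)"
  shows "integrable M (\<lambda>\<omega>. \<integral>\<omega>'. \<Psi> (\<xi> \<omega>) \<omega>' \<partial>M)"
    and "(\<integral>\<omega>. (\<integral>\<omega>'. \<Psi> (\<xi> \<omega>) \<omega>' \<partial>M) \<partial>M) = (\<integral>\<omega>. \<Psi> (\<xi> \<omega>) \<omega> \<partial>M)"
proof -
  have C: "subalgebra M C" and F: "subalgebra M F"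
    using ind sp unfolding indep_sigalg_def indep_sets2_eq subalgebra_def by auto
  have \<xi>M: "\<xi> \<in> measurable M N" by (rule measurable_from_subalg[OF F \<xi>])
  have idC: "(\<lambda>\<omega>. \<omega>) \<in> measurable M C" by (rule measurable_from_subalg[OF C]) simp
  \<comment> \<open>\<open>?D2\<close> is \<open>M\<close> restricted to the events of
    \<open>C\<close>. The restriction is essential, as \<open>\<xi>\<close> is independent of
    \<open>C\<close> but in general not of all of \<open>M\<close>.\<close>
  let ?D1 = "distr M N \<xi>" and ?D2 = "distr M C (\<lambda>\<omega>. \<omega>)"
  interpret D1: prob_space ?D1 by (rule prob_space_distr[OF \<xi>M])
  interpret D2: prob_space ?D2 by (rule prob_space_distr[OF idC])
  interpret P: pair_prob_space ?D1 ?D2 ..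
  have pm: "(\<lambda>\<omega>. (\<xi> \<omega>, \<omega>)) \<in> measurable M (N \<Otimes>\<^sub>M C)" using \<xi>M idC by simp
  have eq: "?D1 \<Otimes>\<^sub>M ?D2 = distr M (N \<Otimes>\<^sub>M C) (\<lambda>\<omega>. (\<xi> \<omega>, \<omega>))"
  proof (rule pair_measure_eqI)
    fix A B assume "A \<in> sets ?D1" "B \<in> sets ?D2"
    then have AB: "A \<in> sets N" "B \<in> sets C" by auto
    have \<xi>A: "\<xi> -` A \<inter> space M \<in> sets F" using measurable_sets[OF \<xi> AB(1)] sp by simp
    have BM: "B \<inter> space M = B" using sets.sets_into_space[OF AB(2)] sp by auto
    have "(\<lambda>\<omega>. (\<xi> \<omega>, \<omega>)) -` (A \<times> B) \<inter> space M = B \<inter> (\<xi> -` A \<inter> space M)" using BM by auto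
    then show "emeasure ?D1 A * emeasure ?D2 B = emeasure (distr M (N \<Otimes>\<^sub>M C) (\<lambda>\<omega>. (\<xi> \<omega>, \<omega>))) (A \<times> B)"
      using indep_setD[OF ind[unfolded indep_sigalg_def] AB(2) \<xi>A] AB BM
      by (simp add: emeasure_distr \<xi>M idC pm emeasure_eq_measure ennreal_mult[symmetric] mult.commute)
  qed (unfold_locales, simp)
  have int': "integrable (?D1 \<Otimes>\<^sub>M ?D2) (\<lambda>(x, \<omega>). \<Psi> x \<omega>)"
    unfolding eq using int by (subst integrable_distr_eq[OF pm \<Psi>]) simp
  have inner: "(\<integral>\<omega>'. \<Psi> x \<omega>' \<partial>?D2) = (\<integral>\<omega>'. \<Psi> x \<omega>' \<partial>M)" if "x \<in> space N" for x
    using integral_distr[OF idC measurable_compose[OF measurable_Pair1'[OF that] \<Psi>]] by simp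
  have inner_m: "(\<lambda>x. \<integral>\<omega>'. \<Psi> x \<omega>' \<partial>M) \<in> borel_measurable N"
    by (rule freezing_measurable[OF C \<Psi>])
  have *: "integrable ?D1 (\<lambda>x. \<integral>\<omega>'. \<Psi> x \<omega>' \<partial>M)"
  proof -
    have "integrable ?D1 (\<lambda>x. \<integral>\<omega>'. \<Psi> x \<omega>' \<partial>?D2) = integrable ?D1 (\<lambda>x. \<integral>\<omega>'. \<Psi> x \<omega>' \<partial>M)"
      by (rule Bochner_Integration.integrable_cong[OF refl], rule inner) simp
    then show ?thesis using P.integrable_fst[OF int'] by simp
  qed
  then show "integrable M (\<lambda>\<omega>. \<integral>\<omega>'. \<Psi> (\<xi> \<omega>) \<omega>' \<partial>M)"
    by (subst (asm) integrable_distr_eq[OF \<xi>M inner_m]) simp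
  have "(\<integral>\<omega>. (\<integral>\<omega>'. \<Psi> (\<xi> \<omega>) \<omega>' \<partial>M) \<partial>M) = (\<integral>x. (\<integral>\<omega>'. \<Psi> x \<omega>' \<partial>M) \<partial>?D1)"
    by (rule integral_distr[OF \<xi>M inner_m, symmetric])
  also have "\<dots> = (\<integral>x. (\<integral>\<omega>'. \<Psi> x \<omega>' \<partial>?D2) \<partial>?D1)"
    by (rule Bochner_Integration.integral_cong[OF refl], rule inner[symmetric]) simp
  also have "\<dots> = (\<integral>p. (case p of (x, \<omega>) \<Rightarrow> \<Psi> x \<omega>) \<partial>(?D1 \<Otimes>\<^sub>M ?D2))"
    by (rule P.integral_fst[OF int'])
  also have "\<dots> = (\<integral>\<omega>. \<Psi> (\<xi> \<omega>) \<omega> \<partial>M)"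
    unfolding eq by (subst integral_distr[OF pm \<Psi>]) simp
  finally show "(\<integral>\<omega>. (\<integral>\<omega>'. \<Psi> (\<xi> \<omega>) \<omega>' \<partial>M) \<partial>M) = (\<integral>\<omega>. \<Psi> (\<xi> \<omega>) \<omega> \<partial>M)" .
qed

text \<open>The indicator of \<open>A\<close> is measurable over \<open>F\<close> and is frozen
  together with \<open>\<xi>\<close>, as an additional real argument.\<close>

lemma (in prob_space) freezing_set_integral:
  fixes \<Psi> :: "'x \<Rightarrow> 'a \<Rightarrow> real"
  assumes ind: "indep_sigalg M C F" and sp: "space C = space M" "space F = space M"
    and \<xi>: "\<xi> \<in> measurable F N" and \<Psi>: "(\<lambda>(x, \<omega>). \<Psi> x \<omega>) \<in> borel_measurable (N \<Otimes>\<^sub>M C)"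
    and int: "integrable M (\<lambda>\<omega>. \<Psi> (\<xi> \<omega>) \<omega>)" and A: "A \<in> sets F"
  shows "(\<integral>\<omega>. indicator A \<omega> * (\<integral>\<omega>'. \<Psi> (\<xi> \<omega>) \<omega>' \<partial>M) \<partial>M) = (\<integral>\<omega>. indicator A \<omega> * \<Psi> (\<xi> \<omega>) \<omega> \<partial>M)"
proof -
  have F: "subalgebra M F"
    using ind sp unfolding indep_sigalg_def indep_sets2_eq subalgebra_def by auto
  have AM: "A \<in> events" using A F by (auto simp: subalgebra_def)
  let ?\<Psi> = "\<lambda>(a, x) \<omega>. a * \<Psi> x \<omega>"
  have "(\<lambda>p. fst (fst p) * (case (snd (fst p), snd p) of (x, \<omega>) \<Rightarrow> \<Psi> x \<omega>)) \<in> borel_measurable ((borel \<Otimes>\<^sub>M N) \<Otimes>\<^sub>M C)"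
    by (intro borel_measurable_times measurable_compose[OF _ \<Psi>]) measurable
  then have m: "(\<lambda>(x, \<omega>). ?\<Psi> x \<omega>) \<in> borel_measurable ((borel \<Otimes>\<^sub>M N) \<Otimes>\<^sub>M C)"
    by (simp add: split_beta')
  have int': "integrable M (\<lambda>\<omega>. ?\<Psi> (indicator A \<omega>, \<xi> \<omega>) \<omega>)"
    using integrable_mult_indicator[OF AM int] by simp
  have "(\<lambda>\<omega>. (indicator A \<omega> :: real, \<xi> \<omega>)) \<in> measurable F (borel \<Otimes>\<^sub>M N)"
    using \<xi> A by simp
  from freezing_integral(2)[OF ind sp this m int'] show ?thesis by simp
qed

text \<open>The point \<open>x\<close> is approximated by simple functions \<open>S i\<close>. For
  an argument with finitely many values the composite is a finite sum of products, and continuity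
  passes to the limit. This is wanted because \<open>coeff_sigalg\<close> is generated by the
  coefficients at fixed arguments and gives no joint measurability directly.\<close>

lemma caratheodory_measurable:
  fixes f :: "'w \<Rightarrow> 'e::euclidean_space \<Rightarrow> real"
  assumes m: "\<And>x. (\<lambda>\<omega>. f \<omega> x) \<in> borel_measurable C"
    and c: "\<And>\<omega>. \<omega> \<in> space C \<Longrightarrow> continuous_on UNIV (f \<omega>)"
  shows "(\<lambda>(\<omega>, x). f \<omega> x) \<in> borel_measurable (C \<Otimes>\<^sub>M borel)"
proof -
  obtain S :: "nat \<Rightarrow> 'e \<Rightarrow> 'e" where S: "\<And>i. simple_function borel (S i)" "\<And>x. (\<lambda>i. S i x) \<longlonglongrightarrow> x"
    using borel_measurable_implies_sequence_metric[of "\<lambda>x. x" borel 0] by auto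
  show ?thesis
  proof (rule borel_measurable_LIMSEQ_real)
    fix p assume "p \<in> space (C \<Otimes>\<^sub>M (borel :: 'e measure))"
    then have "isCont (f (fst p)) (snd p)"
      using c[of "fst p"] by (auto simp: space_pair_measure continuous_on_eq_continuous_at)
    then show "(\<lambda>i. f (fst p) (S i (snd p))) \<longlonglongrightarrow> (case p of (\<omega>, x) \<Rightarrow> f \<omega> x)"
      using isCont_tendsto_compose[OF _ S(2)] by (auto simp: split_beta')
  next
    fix i
    have fin: "finite (range (S i))" using simple_functionD(1)[OF S(1)[of i]] by simp
    have Sm: "S i \<in> borel_measurable borel" by (rule borel_measurable_simple_function[OF S(1)])
    have "(\<lambda>p. \<Sum>c\<in>range (S i). indicator (S i -` {c}) (snd p) * f (fst p) c) \<in> borel_measurable (C \<Otimes>\<^sub>M borel)"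
    proof (intro borel_measurable_sum borel_measurable_times)
      fix c
      have "S i -` {c} \<in> sets borel" using measurable_sets[OF Sm, of "{c}"] by simp
      then show "(\<lambda>p. indicator (S i -` {c}) (snd p) :: real) \<in> borel_measurable (C \<Otimes>\<^sub>M borel)"
        by (intro measurable_compose[OF measurable_snd]) simp
      show "(\<lambda>p. f (fst p) c) \<in> borel_measurable (C \<Otimes>\<^sub>M borel)"
        by (rule measurable_compose[OF measurable_fst m])
    qed
    moreover have "(\<Sum>c\<in>range (S i). indicator (S i -` {c}) x * f \<omega> c) = f \<omega> (S i x)" for \<omega> x
    proof -
      have "(\<Sum>c\<in>range (S i). indicator (S i -` {c}) x * f \<omega> c) = (\<Sum>c\<in>range (S i). if c = S i x then f \<omega> c else 0)"
        by (intro sum.cong) (auto simp: indicator_def)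
      then show ?thesis using fin by (simp add: sum.delta)
    qed
    ultimately show "(\<lambda>p. f (fst p) (S i (snd p))) \<in> borel_measurable (C \<Otimes>\<^sub>M borel)" by simp
  qed
qed

lemma borel_measurable_matrix_vector [measurable (raw)]:
  fixes A :: "'x \<Rightarrow> real^'d^'d" and x :: "'x \<Rightarrow> real^'d"
  assumes "A \<in> borel_measurable N" "x \<in> borel_measurable N"
  shows "(\<lambda>p. A p *v x p) \<in> borel_measurable N"
proof (subst borel_measurable_euclidean_space, intro ballI)
  fix e :: "real^'d" assume "e \<in> Basis"
  then obtain k where e: "e = axis k 1" by (auto simp: Basis_vec_def)
  have "(\<lambda>p. A p $ k) \<in> borel_measurable N"
    by (rule measurable_compose[OF assms(1)]) (intro borel_measurable_continuous_onI continuous_intros)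
  then show "(\<lambda>p. (A p *v x p) \<bullet> e) \<in> borel_measurable N"
    unfolding e inner_axis using assms(2) by (simp add: matrix_vector_mul_component)
qed

section \<open>The functions u and v\<close>

text \<open>The consequences of the hypotheses on which the analysis of \<open>u\<close> and
  \<open>v\<close> rests: one Lipschitz constant for both coefficients and second moments at the
  origin. \<open>B\<close> does not occur here, because its increments enter \<open>u\<close> and
  \<open>v\<close> as the deterministic arguments \<open>ys\<close>.\<close>

locale uv_setting = prob_space M for M :: "'w measure" +
  fixes T :: real and n :: nat and t :: "nat \<Rightarrow> real" and W :: "real \<Rightarrow> 'w \<Rightarrow> real^'d"
    and b :: "real^'d \<Rightarrow> real^'d" and \<sigma> :: "real^'d \<Rightarrow> real^'d^'d" and \<phi> :: "real^'d \<Rightarrow> real"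
    and f g :: "'w \<Rightarrow> real \<Rightarrow> real^'d \<Rightarrow> real \<Rightarrow> real^'d \<Rightarrow> real" and L :: real
  assumes sd: "subdivision T n t"
    and b_meas[measurable]: "b \<in> borel_measurable borel" and b_bdd: "bounded (range b)"
    and \<sigma>_meas[measurable]: "\<sigma> \<in> borel_measurable borel" and \<sigma>_bdd: "bounded (range \<sigma>)"
    and \<phi>_meas[measurable]: "\<phi> \<in> borel_measurable borel" and \<phi>_bdd: "bounded (range \<phi>)"
    and C_sub: "\<And>i. i \<in> {1..n} \<Longrightarrow> subalgebra M (coeff_sigalg M t W f g i)"
    and L: "0 \<le> L"
    and f_lip: "\<And>\<omega> i x x' y y' z z'. \<omega> \<in> space M \<Longrightarrow> i \<in> {1..n} \<Longrightarrow>
      \<bar>f \<omega> (t i) x y z - f \<omega> (t i) x' y' z'\<bar> \<le> L * (norm (x - x') + \<bar>y - y'\<bar> + norm (z - z'))"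
    and g_lip: "\<And>\<omega> i x x' y y' z z'. \<omega> \<in> space M \<Longrightarrow> i \<in> {1..n} \<Longrightarrow>
      \<bar>g \<omega> (t i) x y z - g \<omega> (t i) x' y' z'\<bar> \<le> L * (norm (x - x') + \<bar>y - y'\<bar> + norm (z - z'))"
    and f0: "\<And>i. i \<in> {1..n} \<Longrightarrow> integrable M (\<lambda>\<omega>. (f \<omega> (t i) 0 0 0)\<^sup>2)"
    and g0: "\<And>i. i \<in> {1..n} \<Longrightarrow> integrable M (\<lambda>\<omega>. (g \<omega> (t i) 0 0 0)\<^sup>2)"
    and dW: "\<And>i. i \<in> {1..n} \<Longrightarrow> finite_moments M (\<lambda>\<omega>. norm (dP t W i \<omega>))"
begin

abbreviation "CC \<equiv> coeff_sigalg M t W f g"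
abbreviation "u \<equiv> u_pi M n t W b \<sigma> \<phi> f g"
abbreviation "v \<equiv> v_pi M n t W b \<sigma> \<phi> f g"
abbreviation "UUi i \<equiv> UU t W b \<sigma> f i (u (Suc i)) (v (Suc i))"
abbreviation "VVi i \<equiv> VV t W b \<sigma> g i (u (Suc i)) (v (Suc i))"
abbreviation "NN \<equiv> (Pi\<^sub>M UNIV (\<lambda>_::nat. borel :: (real^'d) measure)) \<Otimes>\<^sub>M (Pi\<^sub>M UNIV (\<lambda>_::nat. borel :: real measure))"

lemma space_CC: "space (CC i) = space M"
  unfolding coeff_sigalg_def by (simp add: space_measure_of_conv)

lemma u_n: "u n xs ys = \<phi> (xs n)" and v_n: "v n xs ys = 0"
  by (simp_all add: u_pi_def v_pi_def)

lemma u_step: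
  assumes "i < n"
  shows "u i xs ys = (\<integral>\<omega>. UUi i xs \<omega> ys \<partial>M) + ys (Suc i) * (\<integral>\<omega>. VVi i xs \<omega> ys \<partial>M)"
proof -
  have *: "n - i = Suc (n - Suc i)" "n - Suc (n - Suc i) = i" using assms by auto
  show ?thesis unfolding u_pi_def v_pi_def *(1) by (simp add: Let_def *(2))
qed

lemma v_step:
  assumes "i < n"
  shows "v i xs ys = (1 / dt t (Suc i)) *\<^sub>R (\<integral>\<omega>. UUi i xs \<omega> ys *\<^sub>R dP t W (Suc i) \<omega> \<partial>M)
    + (ys (Suc i) / dt t (Suc i)) *\<^sub>R (\<integral>\<omega>. VVi i xs \<omega> ys *\<^sub>R dP t W (Suc i) \<omega> \<partial>M)"
proof -
  have *: "n - i = Suc (n - Suc i)" "n - Suc (n - Suc i) = i" using assms by auto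
  show ?thesis unfolding u_pi_def v_pi_def *(1) by (simp add: Let_def *(2))
qed

lemma euler_step_dP: "euler_step W b \<sigma> (t i) (t (Suc i)) x \<omega> = x + dt t (Suc i) *\<^sub>R b x + \<sigma> x *v dP t W (Suc i) \<omega>"
  by (simp add: euler_step_def dt_def dP_def)

lemma dt_pos: "i < n \<Longrightarrow> 0 < dt t (Suc i)"
  using subdivision_less[OF sd, of i "Suc i"] by (simp add: dt_def)

lemma
  shows f_meas: "(\<lambda>\<omega>. f \<omega> (t i) x y z) \<in> borel_measurable (CC i)"
    and g_meas: "(\<lambda>\<omega>. g \<omega> (t i) x y z) \<in> borel_measurable (CC i)"
    and dP_meas: "dP t W i \<in> borel_measurable (CC i)"
proof -
  let ?\<A> = "preimage_events M {(\<lambda>\<omega>. f \<omega> (t i) x y z) |x y z. True} \<union>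
     preimage_events M {(\<lambda>\<omega>. g \<omega> (t i) x y z) |x y z. True} \<union> preimage_events M {dP t W i}"
  have "?\<A> \<subseteq> Pow (space M)" by (simp add: preimage_events_subset_Pow)
  from sets_measure_of[OF this] have A: "?\<A> \<subseteq> sets (CC i)"
    unfolding coeff_sigalg_def by (simp only:) (rule subsetI, erule sigma_sets.Basic)
  note * = preimage_events_measurable[OF _ space_CC[of i]]
  show "(\<lambda>\<omega>. f \<omega> (t i) x y z) \<in> borel_measurable (CC i)"
    by (rule *[of "{(\<lambda>\<omega>. f \<omega> (t i) x y z) |x y z. True}"]) (use A in blast)+
  show "(\<lambda>\<omega>. g \<omega> (t i) x y z) \<in> borel_measurable (CC i)"
    by (rule *[of "{(\<lambda>\<omega>. g \<omega> (t i) x y z) |x y z. True}"]) (use A in blast)+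
  show "dP t W i \<in> borel_measurable (CC i)"
    by (rule *[of "{dP t W i}"]) (use A in blast)+
qed

lemma lipschitz_imp_continuous:
  fixes h :: "real^'d \<Rightarrow> real \<Rightarrow> real^'d \<Rightarrow> real"
  assumes "\<And>x x' y y' z z'. \<bar>h x y z - h x' y' z'\<bar> \<le> L * (norm (x - x') + \<bar>y - y'\<bar> + norm (z - z'))"
  shows "continuous_on UNIV (\<lambda>(x, y, z). h x y z)"
proof -
  have "dist (case p of (x, y, z) \<Rightarrow> h x y z) (case p' of (x, y, z) \<Rightarrow> h x y z) \<le> (3 * L) * dist p p'" for p p' :: "(real^'d) \<times> real \<times> (real^'d)"
  proof -
    obtain x y z x' y' z' where p: "p = (x, y, z)" "p' = (x', y', z')" by (metis prod_cases3)
    have "norm (x - x') \<le> dist p p'" "\<bar>y - y'\<bar> \<le> dist p p'" "norm (z - z') \<le> dist p p'"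
      using dist_fst_le[of p p'] dist_snd_le[of p p'] dist_fst_le[of "snd p" "snd p'"] dist_snd_le[of "snd p" "snd p'"]
      unfolding p by (auto simp: dist_norm intro: order_trans)
    then have "L * (norm (x - x') + \<bar>y - y'\<bar> + norm (z - z')) \<le> L * (3 * dist p p')"
      by (intro mult_left_mono L) auto
    with assms[of x y z x' y' z'] show ?thesis by (simp add: p dist_real_def)
  qed
  then have "(3 * L)-lipschitz_on UNIV (\<lambda>(x, y, z). h x y z)"
    using L by (intro lipschitz_onI) auto
  then show ?thesis by (rule lipschitz_on_continuous_on)
qed

text \<open>The Lipschitz bound makes the coefficient continuous in its space arguments, so
  \<open>caratheodory_measurable\<close> applies and measurable arguments may be inserted.\<close>

lemma coeff_compose_measurable:
  fixes h :: "'w \<Rightarrow> real^'d \<Rightarrow> real \<Rightarrow> real^'d \<Rightarrow> real"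
  assumes m: "\<And>x y z. (\<lambda>\<omega>. h \<omega> x y z) \<in> borel_measurable (CC i)"
    and l: "\<And>\<omega> x x' y y' z z'. \<omega> \<in> space M \<Longrightarrow> \<bar>h \<omega> x y z - h \<omega> x' y' z'\<bar> \<le> L * (norm (x - x') + \<bar>y - y'\<bar> + norm (z - z'))"
    and [measurable]: "X \<in> borel_measurable (N \<Otimes>\<^sub>M CC i)" "Y \<in> borel_measurable (N \<Otimes>\<^sub>M CC i)" "Z \<in> borel_measurable (N \<Otimes>\<^sub>M CC i)"
  shows "(\<lambda>p. h (snd p) (X p) (Y p) (Z p)) \<in> borel_measurable (N \<Otimes>\<^sub>M CC i)"
proof -
  have 1: "(\<lambda>(\<omega>, q). case q of (x, y, z) \<Rightarrow> h \<omega> x y z) \<in> borel_measurable (CC i \<Otimes>\<^sub>M borel)"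
  proof (rule caratheodory_measurable)
    show "(\<lambda>\<omega>. case q of (x, y, z) \<Rightarrow> h \<omega> x y z) \<in> borel_measurable (CC i)" for q
      using m by (cases q) simp
    show "continuous_on UNIV (\<lambda>q. case q of (x, y, z) \<Rightarrow> h \<omega> x y z)" if "\<omega> \<in> space (CC i)" for \<omega>
      using l that by (intro lipschitz_imp_continuous) (auto simp: space_CC)
  qed
  have 2: "(\<lambda>p. (snd p, (X p, Y p, Z p))) \<in> measurable (N \<Otimes>\<^sub>M CC i) (CC i \<Otimes>\<^sub>M borel)"
    by (intro measurable_Pair measurable_snd) (simp add: borel_prod[symmetric])
  from measurable_compose[OF 2 1] show ?thesis by simp
qed

text \<open>Measurability is kept relative to \<open>CC (Suc i)\<close>, as freezing requires: the
  only random inputs of the step are the increment of \<open>W\<close> and the coefficients at the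
  next grid time.\<close>

lemma UV_measurable:
  assumes i: "i < n"
    and u: "(\<lambda>(xs, ys). u (Suc i) xs ys) \<in> borel_measurable NN"
    and v: "(\<lambda>(xs, ys). v (Suc i) xs ys) \<in> borel_measurable NN"
  shows "(\<lambda>((xs, ys), \<omega>). UUi i xs \<omega> ys) \<in> borel_measurable (NN \<Otimes>\<^sub>M CC (Suc i))" (is ?A)
    and "(\<lambda>((xs, ys), \<omega>). VVi i xs \<omega> ys) \<in> borel_measurable (NN \<Otimes>\<^sub>M CC (Suc i))" (is ?B)
proof -
  let ?x = "\<lambda>p. euler_step W b \<sigma> (t i) (t (Suc i)) (fst (fst p) i) (snd p)"
  have c[measurable]: "(\<lambda>p. fst (fst p) i) \<in> borel_measurable (NN \<Otimes>\<^sub>M CC (Suc i))"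
    by measurable
  have d[measurable]: "(\<lambda>p. dP t W (Suc i) (snd p)) \<in> borel_measurable (NN \<Otimes>\<^sub>M CC (Suc i))"
    by (rule measurable_compose[OF measurable_snd dP_meas])
  have x[measurable]: "?x \<in> borel_measurable (NN \<Otimes>\<^sub>M CC (Suc i))"
    unfolding euler_step_dP by measurable
  have "(\<lambda>p. (fst (fst p))(Suc i := ?x p)) \<in> measurable (NN \<Otimes>\<^sub>M CC (Suc i)) (Pi\<^sub>M UNIV (\<lambda>_. borel))"
  proof (rule measurable_PiM_single')
    fix l :: nat
    show "(\<lambda>p. ((fst (fst p))(Suc i := ?x p)) l) \<in> borel_measurable (NN \<Otimes>\<^sub>M CC (Suc i))"
      by (cases "l = Suc i") (simp_all, measurable)
  qed auto
  then have pr: "(\<lambda>p. ((fst (fst p))(Suc i := ?x p), snd (fst p))) \<in> measurable (NN \<Otimes>\<^sub>M CC (Suc i)) NN"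
    by measurable
  have um: "(\<lambda>p. u (Suc i) ((fst (fst p))(Suc i := ?x p)) (snd (fst p))) \<in> borel_measurable (NN \<Otimes>\<^sub>M CC (Suc i))"
    using measurable_compose[OF pr u] by simp
  have vm: "(\<lambda>p. v (Suc i) ((fst (fst p))(Suc i := ?x p)) (snd (fst p))) \<in> borel_measurable (NN \<Otimes>\<^sub>M CC (Suc i))"
    using measurable_compose[OF pr v] by simp
  have "(\<lambda>p. f (snd p) (t (Suc i)) (?x p) (u (Suc i) ((fst (fst p))(Suc i := ?x p)) (snd (fst p)))
      (v (Suc i) ((fst (fst p))(Suc i := ?x p)) (snd (fst p)))) \<in> borel_measurable (NN \<Otimes>\<^sub>M CC (Suc i))"
    by (rule coeff_compose_measurable[OF f_meas f_lip x um vm]) (use i in auto)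
  then show ?A
    unfolding UU_def Let_def split_beta' using um by simp
  have "(\<lambda>p. g (snd p) (t (Suc i)) (?x p) (u (Suc i) ((fst (fst p))(Suc i := ?x p)) (snd (fst p)))
      (v (Suc i) ((fst (fst p))(Suc i := ?x p)) (snd (fst p)))) \<in> borel_measurable (NN \<Otimes>\<^sub>M CC (Suc i))"
    by (rule coeff_compose_measurable[OF g_meas g_lip x um vm]) (use i in auto)
  then show ?B
    unfolding VV_def Let_def split_beta' by simp
qed

lemma uv_measurable:
  assumes "i \<le> n"
  shows "(\<lambda>(xs, ys). u i xs ys) \<in> borel_measurable NN \<and> (\<lambda>(xs, ys). v i xs ys) \<in> borel_measurable NN"
  using assms
proof (induction i rule: inc_induct)
  case base
  have "(\<lambda>p. \<phi> (fst p n)) \<in> borel_measurable NN" by measurable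
  then show ?case by (simp add: u_n v_n split_beta')
next
  case (step i)
  then have i: "i < n" by simp
  note UV = UV_measurable[OF i conjunct1[OF step.IH] conjunct2[OF step.IH]]
  have Cs: "subalgebra M (CC (Suc i))" using i by (intro C_sub) auto
  have d: "(\<lambda>p. dP t W (Suc i) (snd p)) \<in> borel_measurable (NN \<Otimes>\<^sub>M CC (Suc i))"
    by (rule measurable_compose[OF measurable_snd dP_meas])
  have [measurable]: "(\<lambda>p. \<integral>\<omega>. UUi i (fst p) \<omega> (snd p) \<partial>M) \<in> borel_measurable NN"
    "(\<lambda>p. \<integral>\<omega>. VVi i (fst p) \<omega> (snd p) \<partial>M) \<in> borel_measurable NN"
    "(\<lambda>p. \<integral>\<omega>. UUi i (fst p) \<omega> (snd p) *\<^sub>R dP t W (Suc i) \<omega> \<partial>M) \<in> borel_measurable NN"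
    "(\<lambda>p. \<integral>\<omega>. VVi i (fst p) \<omega> (snd p) *\<^sub>R dP t W (Suc i) \<omega> \<partial>M) \<in> borel_measurable NN"
    using UV d by (auto intro!: freezing_measurable[OF Cs] borel_measurable_scaleR simp: split_beta')
  have [measurable]: "(\<lambda>p. snd p (Suc i)) \<in> borel_measurable NN" by measurable
  show ?case
    unfolding u_step[OF i] v_step[OF i] split_beta' by (intro conjI; measurable)
qed

text \<open>The recursion overwrites entry \<open>Suc i\<close> of \<open>xs\<close> and reads entry
  \<open>Suc i\<close> of \<open>ys\<close>. This later allows the paths to be replaced by truncated
  tuples that are known at \<open>t i\<close>.\<close>

lemma uv_cong:
  assumes "i \<le> n" "\<And>l. l \<le> i \<Longrightarrow> xs l = xs' l" "\<And>l. i < l \<Longrightarrow> l \<le> n \<Longrightarrow> ys l = ys' l"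
  shows "u i xs ys = u i xs' ys' \<and> v i xs ys = v i xs' ys'"
  using assms
proof (induction i arbitrary: xs xs' ys ys' rule: inc_induct)
  case base
  then show ?case by (simp add: u_n v_n)
next
  case (step i)
  then have i: "i < n" by simp
  have x: "xs i = xs' i" "ys (Suc i) = ys' (Suc i)" using step.prems i by auto
  have "u (Suc i) (xs(Suc i := c)) ys = u (Suc i) (xs'(Suc i := c)) ys' \<and>
      v (Suc i) (xs(Suc i := c)) ys = v (Suc i) (xs'(Suc i := c)) ys'" for c
    by (rule step.IH) (use step.prems in \<open>auto simp: le_Suc_eq\<close>)
  then show ?case
    unfolding u_step[OF i] v_step[OF i] UU_def VV_def Let_def by (simp add: x)
qed

section \<open>Growth bounds for the functions u and v\<close>

definition noise :: "nat \<Rightarrow> 'w \<Rightarrow> real" where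
  "noise i \<omega> = 1 + norm (dP t W i \<omega>) + \<bar>f \<omega> (t i) 0 0 0\<bar> + \<bar>g \<omega> (t i) 0 0 0\<bar>"

text \<open>Measurability over \<open>CC i\<close>, and not merely over \<open>M\<close>, is what
  makes \<open>noise\<close> independent of the information at the previous grid time.\<close>

lemma noise_meas: "noise i \<in> borel_measurable (CC i)"
  unfolding noise_def using f_meas[of i 0 0 0] g_meas[of i 0 0 0] dP_meas[of i] by measurable

lemma noise_square_integrable:
  assumes "i \<in> {1..n}"
  shows "integrable M (\<lambda>\<omega>. (noise i \<omega>)\<^sup>2)"
proof (rule Bochner_Integration.integrable_bound)
  show "integrable M (\<lambda>\<omega>. 4 * (1 + (norm (dP t W i \<omega>))\<^sup>2 + (f \<omega> (t i) 0 0 0)\<^sup>2 + (g \<omega> (t i) 0 0 0)\<^sup>2))"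
    using f0[OF assms] g0[OF assms] finite_moments_square_integrable[OF dW[OF assms]] by simp
  show "(\<lambda>\<omega>. (noise i \<omega>)\<^sup>2) \<in> borel_measurable M"
    using measurable_from_subalg[OF C_sub[OF assms] noise_meas] by simp
  have "(1 + p + q + r)\<^sup>2 \<le> 4 * (1 + p\<^sup>2 + q\<^sup>2 + r\<^sup>2)" for p q r :: real
    using sum_squares_bound[of 1 p] sum_squares_bound[of 1 q] sum_squares_bound[of 1 r]
      sum_squares_bound[of p q] sum_squares_bound[of p r] sum_squares_bound[of q r]
    by (simp add: power2_eq_square algebra_simps)
  from this[of "norm (dP t W i _)" "\<bar>f _ (t i) 0 0 0\<bar>" "\<bar>g _ (t i) 0 0 0\<bar>"]
  show "AE \<omega> in M. norm ((noise i \<omega>)\<^sup>2)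
      \<le> norm (4 * (1 + (norm (dP t W i \<omega>))\<^sup>2 + (f \<omega> (t i) 0 0 0)\<^sup>2 + (g \<omega> (t i) 0 0 0)\<^sup>2))"
    unfolding noise_def by (simp only: real_norm_def power2_abs abs_power2) (auto intro: order_trans[OF _ abs_ge_self])
qed

text \<open>The factor with index \<open>l\<close> arises in the step from \<open>l\<close> to
  \<open>l - 1\<close>, where the \<open>V\<close> part is multiplied by
  \<open>ys l\<close>.\<close>

definition weight :: "nat \<Rightarrow> (nat \<Rightarrow> real) \<Rightarrow> real" where
  "weight i ys = (\<Prod>l\<in>{i<..n}. 1 + \<bar>ys l\<bar>)"

lemma weight_ge_1: "1 \<le> weight i ys"
  unfolding weight_def by (rule prod_ge_1) auto

lemma weight_Suc: "i < n \<Longrightarrow> weight i ys = (1 + \<bar>ys (Suc i)\<bar>) * weight (Suc i) ys"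
proof -
  assume "i < n"
  then have "{i<..n} = insert (Suc i) {Suc i<..n}" by auto
  then show ?thesis unfolding weight_def by simp
qed

definition uv_bound :: "real \<Rightarrow> nat \<Rightarrow> bool" where
  "uv_bound K i \<longleftrightarrow> 0 \<le> K \<and> (\<forall>xs ys. \<bar>u i xs ys\<bar> \<le> K * ((1 + norm (xs i)) * weight i ys) \<and>
     norm (v i xs ys) \<le> K * ((1 + norm (xs i)) * weight i ys))"

definition UV_bound :: "real \<Rightarrow> nat \<Rightarrow> bool" where
  "UV_bound K i \<longleftrightarrow> 0 \<le> K \<and> (\<forall>xs ys. \<forall>\<omega>\<in>space M.
      \<bar>UUi i xs \<omega> ys\<bar> \<le> K * ((1 + norm (xs i)) * weight (Suc i) ys) * noise (Suc i) \<omega> \<and>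
      \<bar>VVi i xs \<omega> ys\<bar> \<le> K * ((1 + norm (xs i)) * weight (Suc i) ys) * noise (Suc i) \<omega>)"

lemma UV_boundD:
  assumes "UV_bound K i" "\<omega> \<in> space M"
  shows "\<bar>UUi i xs \<omega> ys\<bar> \<le> K * ((1 + norm (xs i)) * weight (Suc i) ys) * noise (Suc i) \<omega>"
    and "\<bar>VVi i xs \<omega> ys\<bar> \<le> K * ((1 + norm (xs i)) * weight (Suc i) ys) * noise (Suc i) \<omega>"
  using assms unfolding UV_bound_def by blast+

text \<open>The Euler step is linear in the old point up to a factor \<open>noise\<close>, and
  Lipschitz coefficients grow linearly. The bound therefore stays of first order in both
  \<open>xs i\<close> and \<open>noise\<close>, which keeps second moments of \<open>noise\<close>
  sufficient.\<close>

lemma step_bound: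
  assumes i: "i < n" and uvK: "uv_bound K (Suc i)"
  shows "\<exists>K'. UV_bound K' i"
proof -
  have K: "0 \<le> K"
    and uK: "\<And>xs ys. \<bar>u (Suc i) xs ys\<bar> \<le> K * ((1 + norm (xs (Suc i))) * weight (Suc i) ys)"
    and vK: "\<And>xs ys. norm (v (Suc i) xs ys) \<le> K * ((1 + norm (xs (Suc i))) * weight (Suc i) ys)"
    using uvK unfolding uv_bound_def by blast+
  obtain Cb where Cb: "\<And>x. norm (b x) \<le> Cb" using b_bdd unfolding bounded_iff by auto
  obtain Cs where Cs: "\<And>x. norm (\<sigma> x) \<le> Cs" using \<sigma>_bdd unfolding bounded_iff by auto
  have nn: "0 \<le> Cb" "0 \<le> Cs" using Cb[of 0] Cs[of 0] norm_ge_zero order_trans by blast+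
  let ?h = "dt t (Suc i)"
  have h: "0 \<le> ?h" using dt_pos[OF i] by simp
  \<comment> \<open>Chosen for \<open>1 + norm x \<le> c1 * (q * a)\<close> below; the three
    summands account for the old point, the drift and the diffusion.\<close>
  define c1 where "c1 = 1 + ?h * Cb + real CARD('d) * Cs"
  \<comment> \<open>The sum of the constants for \<open>U\<close> and for \<open>V\<close>, so that
    it serves both. The factor \<open>1 + 2 * K\<close> bounds the three arguments of the
    coefficient, \<open>1 + ?h\<close> counts the coefficient once for \<open>V\<close> and with
    weight \<open>?h\<close> for \<open>U\<close>, and \<open>?h + 1\<close> comes from the
    coefficient at the origin.\<close>
  define K' where "K' = (K + (1 + ?h) * L * (1 + 2 * K)) * c1 + ?h + 1"
  have c1: "0 \<le> c1" unfolding c1_def using nn h by simp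
  have K'0: "0 \<le> K'" unfolding K'_def using c1 K h L by simp
  show ?thesis
    unfolding UV_bound_def
  proof (intro exI[of _ K'] conjI K'0 allI ballI)
    fix xs :: "nat \<Rightarrow> real^'d" and ys \<omega> assume \<omega>: "\<omega> \<in> space M"
    define x where "x = euler_step W b \<sigma> (t i) (t (Suc i)) (xs i) \<omega>"
    define P where "P = weight (Suc i) ys"
    define a where "a = noise (Suc i) \<omega>"
    define q where "q = 1 + norm (xs i)"
    define u' where "u' = u (Suc i) (xs(Suc i := x)) ys"
    define v' where "v' = v (Suc i) (xs(Suc i := x)) ys"
    define D where "D = norm (dP t W (Suc i) \<omega>)"
    have P: "1 \<le> P" unfolding P_def by (rule weight_ge_1)
    have q: "1 \<le> q" unfolding q_def by simp
    have D: "0 \<le> D" unfolding D_def by simp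
    have aD: "1 + D \<le> a" and af: "\<bar>f \<omega> (t (Suc i)) 0 0 0\<bar> \<le> a" and ag: "\<bar>g \<omega> (t (Suc i)) 0 0 0\<bar> \<le> a"
      unfolding a_def D_def noise_def by auto
    have a: "1 \<le> a" using aD D by simp
    have x1: "1 + norm x \<le> c1 * (q * a)"
    proof -
      have "norm x \<le> norm (xs i) + norm (?h *\<^sub>R b (xs i)) + norm (\<sigma> (xs i) *v dP t W (Suc i) \<omega>)"
        unfolding x_def euler_step_dP by (intro order_trans[OF norm_triangle_ineq] add_mono norm_triangle_ineq order_refl)
      also have "norm (?h *\<^sub>R b (xs i)) \<le> ?h * Cb" using Cb h by (simp add: mult_left_mono)
      also have "norm (\<sigma> (xs i) *v dP t W (Suc i) \<omega>) \<le> real CARD('d) * Cs * D"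
        unfolding D_def by (rule order_trans[OF norm_matrix_vector_le]) (intro mult_right_mono mult_left_mono Cs; simp)
      finally have "1 + norm x \<le> q + ?h * Cb + real CARD('d) * Cs * D" unfolding q_def by simp
      also have "\<dots> \<le> q * a + ?h * Cb * (q * a) + real CARD('d) * Cs * (q * a)"
      proof (intro add_mono)
        have qa: "1 \<le> q * a" using q a mult_mono[of 1 q 1 a] by simp
        show "q \<le> q * a" using q a by simp
        show "?h * Cb \<le> ?h * Cb * (q * a)" using mult_left_mono[OF qa, of "?h * Cb"] h nn by simp
        have "D \<le> 1 * a" using aD by simp
        also have "\<dots> \<le> q * a" using q a by (intro mult_right_mono) auto
        finally show "real CARD('d) * Cs * D \<le> real CARD('d) * Cs * (q * a)"
          using nn by (intro mult_left_mono) auto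
      qed
      also have "\<dots> = c1 * (q * a)" unfolding c1_def by (simp add: algebra_simps)
      finally show ?thesis .
    qed
    define R where "R = q * P * a"
    have qaP: "c1 * (q * a) * P = c1 * R" unfolding R_def by simp
    have x1P: "(1 + norm x) * P \<le> c1 * R"
      using mult_right_mono[OF x1, of P] P unfolding qaP by simp
    have u': "\<bar>u'\<bar> \<le> K * (c1 * R)"
      using uK[of "xs(Suc i := x)" ys] mult_left_mono[OF x1P K] unfolding u'_def P_def by simp
    have v': "norm v' \<le> K * (c1 * R)"
      using vK[of "xs(Suc i := x)" ys] mult_left_mono[OF x1P K] unfolding v'_def P_def by simp
    have "norm x * 1 \<le> (1 + norm x) * P" using P by (intro mult_mono) auto
    then have x': "norm x \<le> c1 * R" using x1P by simp
    have aR: "a \<le> R"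
    proof -
      have "1 * 1 * a \<le> q * P * a" using q P a by (intro mult_right_mono mult_mono) auto
      then show ?thesis unfolding R_def by simp
    qed
    have lip: "L * (norm x + \<bar>u'\<bar> + norm v') \<le> L * ((1 + 2 * K) * (c1 * R))"
      using x' u' v' by (intro mult_left_mono L) (simp add: algebra_simps)
    have S: "Suc i \<in> {1..n}" using i by auto
    have F: "\<bar>f \<omega> (t (Suc i)) x u' v'\<bar> \<le> R + L * ((1 + 2 * K) * (c1 * R))"
      using f_lip[OF \<omega> S, of x u' v' 0 0 0] af aR lip by simp
    have G: "\<bar>g \<omega> (t (Suc i)) x u' v'\<bar> \<le> R + L * ((1 + 2 * K) * (c1 * R))"
      using g_lip[OF \<omega> S, of x u' v' 0 0 0] ag aR lip by simp
    have R0: "0 \<le> R" using aR a by simp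
    have eqK: "K' * R = K * (c1 * R) + (1 + ?h) * (R + L * ((1 + 2 * K) * (c1 * R)))"
      unfolding K'_def by (simp add: algebra_simps)
    have z: "0 \<le> K * (c1 * R)" "0 \<le> R + L * ((1 + 2 * K) * (c1 * R))"
      using K c1 R0 L by simp_all
    have "\<bar>UUi i xs \<omega> ys\<bar> \<le> \<bar>u'\<bar> + \<bar>f \<omega> (t (Suc i)) x u' v'\<bar> * ?h"
      unfolding UU_def Let_def u'_def v'_def x_def Suc_eq_plus1[symmetric]
      using h by (intro order_trans[OF abs_triangle_ineq]) (simp add: abs_mult)
    also have "\<dots> \<le> K * (c1 * R) + ?h * (R + L * ((1 + 2 * K) * (c1 * R)))"
      using u' mult_left_mono[OF F h] by (simp add: mult.commute)
    also have "\<dots> \<le> K' * R" unfolding eqK using z by (simp add: algebra_simps)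
    finally show "\<bar>UUi i xs \<omega> ys\<bar> \<le> K' * ((1 + norm (xs i)) * weight (Suc i) ys) * noise (Suc i) \<omega>"
      unfolding R_def q_def P_def a_def by (simp only: mult.assoc)
    have "\<bar>VVi i xs \<omega> ys\<bar> = \<bar>g \<omega> (t (Suc i)) x u' v'\<bar>"
      unfolding VV_def Let_def u'_def v'_def x_def Suc_eq_plus1[symmetric] ..
    also have "\<dots> \<le> K' * R"
      unfolding eqK using G z mult_nonneg_nonneg[OF h z(2)] by (simp add: algebra_simps)
    finally show "\<bar>VVi i xs \<omega> ys\<bar> \<le> K' * ((1 + norm (xs i)) * weight (Suc i) ys) * noise (Suc i) \<omega>"
      unfolding R_def q_def P_def a_def by (simp only: mult.assoc)
  qed
qed

lemma UV_section_measurable: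
  assumes i: "i < n"
  shows "(\<lambda>\<omega>. UUi i xs \<omega> ys) \<in> borel_measurable M" "(\<lambda>\<omega>. VVi i xs \<omega> ys) \<in> borel_measurable M"
proof -
  note uv = uv_measurable[of "Suc i"]
  have p: "(xs, ys) \<in> space NN" by (simp add: space_pair_measure space_PiM)
  have Cs: "subalgebra M (CC (Suc i))" using i by (intro C_sub) auto
  show "(\<lambda>\<omega>. UUi i xs \<omega> ys) \<in> borel_measurable M"
    using measurable_from_subalg[OF Cs measurable_compose[OF measurable_Pair1'[OF p] UV_measurable(1)[OF i]]] uv i by simp
  show "(\<lambda>\<omega>. VVi i xs \<omega> ys) \<in> borel_measurable M"
    using measurable_from_subalg[OF Cs measurable_compose[OF measurable_Pair1'[OF p] UV_measurable(2)[OF i]]] uv i by simp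
qed

text \<open>As \<open>noise\<close> contains the norm of the increment as a summand, the second
  product is at most the square of \<open>noise\<close>.\<close>

lemma noise_mult_integrable:
  assumes "i \<in> {1..n}"
  shows "integrable M (noise i)" "integrable M (\<lambda>\<omega>. noise i \<omega> * norm (dP t W i \<omega>))"
proof -
  have m[measurable]: "noise i \<in> borel_measurable M"
    using measurable_from_subalg[OF C_sub[OF assms] noise_meas] .
  show "integrable M (noise i)"
    by (rule square_integrable_imp_integrable[OF m noise_square_integrable[OF assms]])
  have [measurable]: "dP t W i \<in> borel_measurable M"
    using measurable_from_subalg[OF C_sub[OF assms] dP_meas] .
  show "integrable M (\<lambda>\<omega>. noise i \<omega> * norm (dP t W i \<omega>))"
  proof (rule Bochner_Integration.integrable_bound[OF noise_square_integrable[OF assms]])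
    have "noise i \<omega> * norm (dP t W i \<omega>) \<le> (noise i \<omega>)\<^sup>2" "0 \<le> noise i \<omega>" for \<omega>
      unfolding noise_def power2_eq_square by (intro mult_left_mono; simp) simp
    then show "AE \<omega> in M. norm (noise i \<omega> * norm (dP t W i \<omega>)) \<le> norm ((noise i \<omega>)\<^sup>2)"
      by (auto simp: abs_mult)
  qed simp
qed

lemma noise_bound_integrable:
  assumes i: "i \<in> {1..n}" and Fm[measurable]: "F \<in> borel_measurable M"
    and F: "\<And>\<omega>. \<omega> \<in> space M \<Longrightarrow> \<bar>F \<omega>\<bar> \<le> c * noise i \<omega>"
  shows "integrable M F" "integrable M (\<lambda>\<omega>. F \<omega> *\<^sub>R dP t W i \<omega>)"
    and "\<bar>expectation F\<bar> \<le> c * expectation (noise i)"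
    and "norm (\<integral>\<omega>. F \<omega> *\<^sub>R dP t W i \<omega> \<partial>M) \<le> c * expectation (\<lambda>\<omega>. noise i \<omega> * norm (dP t W i \<omega>))"
proof -
  have [measurable]: "dP t W i \<in> borel_measurable M"
    using measurable_from_subalg[OF C_sub[OF i] dP_meas] .
  have i1: "integrable M (\<lambda>\<omega>. c * noise i \<omega>)" "integrable M (\<lambda>\<omega>. c * (noise i \<omega> * norm (dP t W i \<omega>)))"
    using noise_mult_integrable[OF i] by auto
  have b1: "norm (F \<omega>) \<le> c * noise i \<omega>" if "\<omega> \<in> space M" for \<omega> using F[OF that] by simp
  have b2: "norm (F \<omega> *\<^sub>R dP t W i \<omega>) \<le> c * (noise i \<omega> * norm (dP t W i \<omega>))"
    if "\<omega> \<in> space M" for \<omega>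
    using mult_right_mono[OF F[OF that], of "norm (dP t W i \<omega>)"] by simp
  show j1: "integrable M F"
    by (rule Bochner_Integration.integrable_bound[OF i1(1) Fm])
      (use b1 in \<open>auto intro!: AE_I2 intro: order_trans[OF _ abs_ge_self]\<close>)
  show j2: "integrable M (\<lambda>\<omega>. F \<omega> *\<^sub>R dP t W i \<omega>)"
    by (rule Bochner_Integration.integrable_bound[OF i1(2)])
      (measurable, use b2 in \<open>auto intro!: AE_I2 intro: order_trans[OF _ abs_ge_self]\<close>)
  have "norm (\<integral>\<omega>. F \<omega> \<partial>M) \<le> (\<integral>\<omega>. c * noise i \<omega> \<partial>M)"
    by (rule order_trans[OF integral_norm_bound integral_mono[OF integrable_norm]]) (use j1 i1(1) b1 in blast)+
  then show "\<bar>expectation F\<bar> \<le> c * expectation (noise i)" by simp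
  have "norm (\<integral>\<omega>. F \<omega> *\<^sub>R dP t W i \<omega> \<partial>M) \<le> (\<integral>\<omega>. c * (noise i \<omega> * norm (dP t W i \<omega>)) \<partial>M)"
    by (rule order_trans[OF integral_norm_bound integral_mono[OF integrable_norm]]) (use j2 i1(2) b2 in blast)+
  then show "norm (\<integral>\<omega>. F \<omega> *\<^sub>R dP t W i \<omega> \<partial>M) \<le> c * expectation (\<lambda>\<omega>. noise i \<omega> * norm (dP t W i \<omega>))"
    by simp
qed

lemma uv_growth:
  assumes "i \<le> n"
  shows "\<exists>K. uv_bound K i"
  using assms
proof (induction i rule: inc_induct)
  case base
  obtain K where K: "\<And>x. norm (\<phi> x) \<le> K" using \<phi>_bdd unfolding bounded_iff by auto
  then have K0: "0 \<le> K" using norm_ge_zero order_trans by blast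
  have "\<bar>\<phi> (xs n)\<bar> \<le> K * ((1 + norm (xs n)) * weight n ys)" for xs ys
  proof -
    have "K * 1 \<le> K * ((1 + norm (xs n)) * weight n ys)"
      using mult_mono[of 1 "1 + norm (xs n)" 1 "weight n ys"] weight_ge_1[of n ys] K0 by (intro mult_left_mono) auto
    then show ?thesis using K[of "xs n"] by simp
  qed
  moreover have "0 \<le> K * ((1 + norm (xs n)) * weight n ys)" for xs :: "nat \<Rightarrow> real^'d" and ys
    using weight_ge_1[of n ys] K0 by simp
  ultimately show ?case using K0 by (auto simp: u_n v_n uv_bound_def)
next
  case (step i)
  then have i: "i < n" and S: "Suc i \<in> {1..n}" by auto
  obtain K' where UV: "UV_bound K' i" using step_bound[OF i] step.IH by blast
  then have K': "0 \<le> K'" unfolding UV_bound_def by blast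
  note U = UV_boundD(1)[OF UV] and V = UV_boundD(2)[OF UV]
  define E1 where "E1 = expectation (noise (Suc i))"
  define E2 where "E2 = expectation (\<lambda>\<omega>. noise (Suc i) \<omega> * norm (dP t W (Suc i) \<omega>))"
  have E: "0 \<le> E1" "0 \<le> E2" unfolding E1_def E2_def noise_def by (auto intro!: Bochner_Integration.integral_nonneg)
  let ?h = "dt t (Suc i)"
  have h: "0 < ?h" by (rule dt_pos[OF i])
  note gen = noise_bound_integrable(3,4)[OF S, folded E1_def E2_def]
  note gU = gen(1)[OF UV_section_measurable(1)[OF i] U] gen(2)[OF UV_section_measurable(1)[OF i] U]
    and gV = gen(1)[OF UV_section_measurable(2)[OF i] V] gen(2)[OF UV_section_measurable(2)[OF i] V]
  \<comment> \<open>The first summand is the constant for \<open>u\<close>, the second the constant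
    for \<open>v\<close> after division by the step length.\<close>
  define K2 where "K2 = K' * E1 + K' * E2 / ?h"
  have K20: "0 \<le> K2" unfolding K2_def using K' E h by simp
  show ?case
    unfolding uv_bound_def
  proof (intro exI[of _ K2] conjI allI K20)
    fix xs :: "nat \<Rightarrow> real^'d" and ys
    let ?Q = "(1 + norm (xs i)) * weight (Suc i) ys"
    have Q: "0 \<le> ?Q" using weight_ge_1[of "Suc i" ys] by simp
    have w: "(1 + norm (xs i)) * weight i ys = (1 + \<bar>ys (Suc i)\<bar>) * ?Q"
      unfolding weight_Suc[OF i] by simp
    have "\<bar>u i xs ys\<bar> \<le> \<bar>\<integral>\<omega>. UUi i xs \<omega> ys \<partial>M\<bar> + \<bar>ys (Suc i)\<bar> * \<bar>\<integral>\<omega>. VVi i xs \<omega> ys \<partial>M\<bar>"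
      unfolding u_step[OF i] by (rule order_trans[OF abs_triangle_ineq]) (simp add: abs_mult)
    also have "\<dots> \<le> K' * ?Q * E1 + \<bar>ys (Suc i)\<bar> * (K' * ?Q * E1)"
      using gU[of xs ys] gV[of xs ys] by (intro add_mono mult_left_mono) auto
    also have "\<dots> = (K' * E1) * ((1 + \<bar>ys (Suc i)\<bar>) * ?Q)" by (simp add: algebra_simps)
    also have "\<dots> \<le> K2 * ((1 + \<bar>ys (Suc i)\<bar>) * ?Q)"
      using Q K' E h unfolding K2_def by (intro mult_right_mono) auto
    finally show "\<bar>u i xs ys\<bar> \<le> K2 * ((1 + norm (xs i)) * weight i ys)" unfolding w .
    have "norm (v i xs ys) \<le> norm ((1 / ?h) *\<^sub>R (\<integral>\<omega>. UUi i xs \<omega> ys *\<^sub>R dP t W (Suc i) \<omega> \<partial>M))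
       + norm ((ys (Suc i) / ?h) *\<^sub>R (\<integral>\<omega>. VVi i xs \<omega> ys *\<^sub>R dP t W (Suc i) \<omega> \<partial>M))"
      unfolding v_step[OF i] by (rule norm_triangle_ineq)
    also have "\<dots> = (1 / ?h) * norm (\<integral>\<omega>. UUi i xs \<omega> ys *\<^sub>R dP t W (Suc i) \<omega> \<partial>M)
       + (\<bar>ys (Suc i)\<bar> / ?h) * norm (\<integral>\<omega>. VVi i xs \<omega> ys *\<^sub>R dP t W (Suc i) \<omega> \<partial>M)"
      using h by simp
    also have "\<dots> \<le> (1 / ?h) * (K' * ?Q * E2) + (\<bar>ys (Suc i)\<bar> / ?h) * (K' * ?Q * E2)"
      using gU[of xs ys] gV[of xs ys] h by (intro add_mono mult_left_mono) auto
    also have "\<dots> = (K' * E2 / ?h) * ((1 + \<bar>ys (Suc i)\<bar>) * ?Q)" using h by (simp add: field_simps)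
    also have "\<dots> \<le> K2 * ((1 + \<bar>ys (Suc i)\<bar>) * ?Q)"
      using Q K' E h unfolding K2_def by (intro mult_right_mono) auto
    finally show "norm (v i xs ys) \<le> K2 * ((1 + norm (xs i)) * weight i ys)" unfolding w .
  qed
qed

lemma UV_growth: "i < n \<Longrightarrow> \<exists>K. UV_bound K i"
  using step_bound uv_growth[of "Suc i"] by auto

end

section \<open>Square integrability and conditional expectations\<close>

lemma integrable_mult_L2:
  fixes X Y :: "'a \<Rightarrow> real"
  assumes [measurable]: "X \<in> borel_measurable M" "Y \<in> borel_measurable M"
    and "integrable M (\<lambda>\<omega>. (X \<omega>)\<^sup>2)" "integrable M (\<lambda>\<omega>. (Y \<omega>)\<^sup>2)"
  shows "integrable M (\<lambda>\<omega>. X \<omega> * Y \<omega>)"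
proof (rule Bochner_Integration.integrable_bound)
  show "integrable M (\<lambda>\<omega>. (X \<omega>)\<^sup>2 + (Y \<omega>)\<^sup>2)" using assms by simp
  have "\<bar>a * b\<bar> \<le> a\<^sup>2 + b\<^sup>2" for a b :: real
  proof -
    have "2 * (\<bar>a\<bar> * \<bar>b\<bar>) \<le> a\<^sup>2 + b\<^sup>2" using sum_squares_bound[of "\<bar>a\<bar>" "\<bar>b\<bar>"] by simp
    moreover have "0 \<le> \<bar>a\<bar> * \<bar>b\<bar>" by simp
    ultimately show ?thesis unfolding abs_mult by linarith
  qed
  then show "AE \<omega> in M. norm (X \<omega> * Y \<omega>) \<le> norm ((X \<omega>)\<^sup>2 + (Y \<omega>)\<^sup>2)" by simp
qed simp

lemma brownian_increment_moments:
  assumes "prob_space M" "brownian_motion M T P" "0 \<le> s" "s < r" "r \<le> T"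
  shows "finite_moments M (\<lambda>\<omega>. norm (P r \<omega> - P s \<omega>))"
  using assms unfolding brownian_motion_def
  by (intro prob_space.gaussian_norm_moments[of M _ "sqrt (r - s)"]) auto

lemma (in prob_space) AE_cond_exp_eq:
  fixes X Y :: "'a \<Rightarrow> real"
  assumes F: "subalgebra M F" and "Y \<in> borel_measurable F"
    and "integrable M X" "integrable M Y"
    and eq: "\<And>A. A \<in> sets F \<Longrightarrow> (\<integral>\<omega>. indicator A \<omega> * X \<omega> \<partial>M) = (\<integral>\<omega>. indicator A \<omega> * Y \<omega> \<partial>M)"
  shows "AE \<omega> in M. real_cond_exp M F X \<omega> = Y \<omega>"
proof -
  interpret finite_measure_subalgebra M F by unfold_locales (rule F)
  interpret sigma_finite_subalgebra M F
    by (rule finite_measure_subalgebra_is_sigma_finite) unfold_locales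
  show ?thesis
    by (rule real_cond_exp_charact) (use assms in \<open>auto simp: set_lebesgue_integral_def\<close>)
qed

text \<open>Both variables are versions of the conditional expectation of \<open>X\<close> given
  \<open>F\<close>.\<close>

lemma (in prob_space) AE_eq_subalgebra:
  fixes X Y :: "'a \<Rightarrow> real"
  assumes F: "subalgebra M F" and "X \<in> borel_measurable F" "Y \<in> borel_measurable F"
    and "integrable M X" "integrable M Y"
    and eq: "\<And>A. A \<in> sets F \<Longrightarrow> (\<integral>\<omega>. indicator A \<omega> * X \<omega> \<partial>M) = (\<integral>\<omega>. indicator A \<omega> * Y \<omega> \<partial>M)"
  shows "AE \<omega> in M. X \<omega> = Y \<omega>"
proof -
  have "AE \<omega> in M. real_cond_exp M F X \<omega> = Y \<omega>" by (rule AE_cond_exp_eq[OF F assms(3-5)]) (rule eq)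
  moreover have "AE \<omega> in M. real_cond_exp M F X \<omega> = X \<omega>" by (rule AE_cond_exp_eq[OF F assms(2,4,4) refl])
  ultimately show ?thesis by eventually_elim simp
qed

text \<open>The scheme averages \<open>Z\<close> over closed cells, while its Ito integral is taken
  on half-open ones.\<close>

lemma integral_closed_eq_half_open:
  fixes Z :: "real \<Rightarrow> 'a::euclidean_space"
  shows "(LINT s:{a..b}|lborel. Z s) = (\<integral>s. Z s \<partial>restrict_space lborel {a..<b})"
proof -
  have "(LINT s:{a..b}|lborel. Z s) = (\<integral>s. indicator {a..<b} s *\<^sub>R Z s \<partial>lborel)"
    unfolding set_lebesgue_integral_def
    by (rule integral_discrete_difference[of "{b}"]) (auto simp: indicator_def)
  then show ?thesis by (subst integral_restrict_space) auto
qed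

section \<open>One backward step\<close>

text \<open>Both identities are tested on events of \<open>sigalg_F\<close> at \<open>t i\<close>.
  With \<open>D\<close> a component of the increment of \<open>W\<close>, the second one rests on
  \<open>I * D = R * D - Y * D\<close>: the product with \<open>Y\<close> has mean zero on such
  events, the covariance formula evaluates the left-hand side, and freezing evaluates the product
  with \<open>R\<close>.\<close>

lemma backward_step:
  fixes M :: "'w measure" and T :: real
    and W :: "real \<Rightarrow> 'w \<Rightarrow> real^'d" and B :: "real \<Rightarrow> 'w \<Rightarrow> real"
    and X :: "real \<Rightarrow> 'w \<Rightarrow> real^'d" and Y :: "real \<Rightarrow> 'w \<Rightarrow> real"
    and Z :: "real \<Rightarrow> 'w \<Rightarrow> real^'d" and Z1 :: "nat \<Rightarrow> 'w \<Rightarrow> real^'d"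
  assumes uv: "uv_setting M T n t W b \<sigma> \<phi> f g L"
    and W: "brownian_motion M T W" and B: "brownian_motion M T B" and WB: "indep_processes M T W B"
    and cind: "coeffs_indep_of_F M T n t W B f g"
    and X: "euler_X M T n t W b \<sigma> x0 X"
    and bs: "backward_scheme M T n t W B \<phi> f g X Y Z Z1"
    and i: "i < n"
    and IHY: "AE \<omega> in M. Y (t (Suc i)) \<omega> =
       u_pi M n t W b \<sigma> \<phi> f g (Suc i) (\<lambda>j. X (t j) \<omega>) (\<lambda>j. dP t B j \<omega>)"
    and IHZ: "AE \<omega> in M. Z1 (Suc i) \<omega> =
       v_pi M n t W b \<sigma> \<phi> f g (Suc i) (\<lambda>j. X (t j) \<omega>) (\<lambda>j. dP t B j \<omega>)"
  shows "(AE \<omega> in M. Y (t i) \<omega> =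
       u_pi M n t W b \<sigma> \<phi> f g i (\<lambda>j. X (t j) \<omega>) (\<lambda>j. dP t B j \<omega>)) \<and>
    (AE \<omega> in M. Z1 i \<omega> =
       v_pi M n t W b \<sigma> \<phi> f g i (\<lambda>j. X (t j) \<omega>) (\<lambda>j. dP t B j \<omega>))"
proof -
  interpret uv_setting M T n t W b \<sigma> \<phi> f g L by (rule uv)
  have ps: "prob_space M" by unfold_locales
  let ?H = "full_filtration M T W B"
  interpret H: bm_filtration M T W ?H by (rule bm_filtration_full[OF ps W B WB])
  let ?s = "t i" and ?r = "t (Suc i)" and ?dW = "dP t W (Suc i)"
  let ?u = "\<lambda>i \<omega>. u i (\<lambda>j. X (t j) \<omega>) (\<lambda>j. dP t B j \<omega>)" and ?v = "\<lambda>i \<omega>. v i (\<lambda>j. X (t j) \<omega>) (\<lambda>j. dP t B j \<omega>)"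
    and ?f = "\<lambda>\<omega>. f \<omega> ?r (X ?r \<omega>) (Y ?r \<omega>) (Z1 (Suc i) \<omega>)" and ?g = "\<lambda>\<omega>. g \<omega> ?r (X ?r \<omega>) (Y ?r \<omega>) (Z1 (Suc i) \<omega>)"
    and ?E = "\<lambda>A F. \<integral>\<omega>. indicator A \<omega> * F \<omega> \<partial>M"
  have sr: "0 \<le> ?s" "?s < ?r" "?r \<le> T" "?s \<le> T"
    using subdivision_bounds[OF sd, of i] subdivision_bounds[OF sd, of "Suc i"] subdivision_less[OF sd, of i "Suc i"] i by auto
  have S: "Suc i \<in> {1..n}" using i by auto
  let ?F = "sigalg_F M T W B ?s" and ?C = "coeff_sigalg M t W f g (Suc i)"
  have FM: "subalgebra M ?F" by (rule sigalg_F_subalgebra[OF ps W B WB sr(1,4)])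
  have FH: "subalgebra (?H ?s) ?F" by (rule sigalg_F_full[OF ps W B WB sr(1,4)])
  have CM: "subalgebra M ?C" by (rule C_sub[OF S])
  have CF: "indep_sigalg M ?C ?F" using cind S unfolding coeffs_indep_of_F_def by force
  have spF: "space ?F = space M" using FM by (simp add: subalgebra_def)
  note FMm = measurable_from_subalg[OF FM] and CMm = measurable_from_subalg[OF CM]
  have es: "euler_scheme M T W ?H n t b \<sigma> x0 X"
    using sigalg_FW_full[OF ps W B WB] sd X \<sigma>_meas \<sigma>_bdd b_bdd by unfold_locales auto
  have Xm: "X (t l) \<in> borel_measurable ?F" if "l \<le> i" for l
  proof -
    have "X (t l) \<in> borel_measurable (sigalg_FW M W (t l))"
      using X subdivision_bounds[OF sd, of l] that i unfolding euler_X_def by auto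
    then show ?thesis
      using measurable_from_subalg[OF sigalg_FW_F[OF ps W B WB, of "t l" ?s]] subdivision_le[OF sd that] i by auto
  qed
  have Bm: "dP t B l \<in> borel_measurable ?F" if "i < l" "l \<le> n" for l
  proof -
    have "?s \<le> t (l - 1)" "t (l - 1) \<le> t l" "t l \<le> T"
      using subdivision_le[OF sd, of i "l - 1"] subdivision_le[OF sd, of "l - 1" l] subdivision_bounds[OF sd, of l] that by auto
    from incr_B_sigalg_F[OF ps W B WB this] show ?thesis by (simp add: dP_def[abs_def])
  qed
  have Bmom: "finite_moments M (\<lambda>\<omega>. \<bar>dP t B l \<omega>\<bar>)" if "i < l" "l \<le> n" for l
    using brownian_increment_moments[OF ps B, of "t (l - 1)" "t l"] that
      subdivision_less[OF sd, of "l - 1" l] subdivision_bounds[OF sd, of l] subdivision_bounds[OF sd, of "l - 1"]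
    by (auto simp: dP_def)
  \<comment> \<open>Entries unknown at \<open>t i\<close> are replaced by 0, which makes the pair
    \<open>\<xi>\<close> measurable over \<open>?F\<close>. By \<open>uv_cong\<close> the replaced
    values do not affect the functions to which the pair is passed.\<close>
  define xs where "xs \<omega> l = (if l \<le> i then X (t l) \<omega> else 0)" for \<omega> l
  define ys where "ys \<omega> l = (if i < l \<and> l \<le> n then dP t B l \<omega> else 0)" for \<omega> l
  define \<xi> where "\<xi> \<omega> = (xs \<omega>, ys \<omega>)" for \<omega>
  have \<xi>m: "\<xi> \<in> measurable ?F NN"
    unfolding \<xi>_def
  proof (intro measurable_Pair measurable_PiM_single')
    show "(\<lambda>\<omega>. xs \<omega> l) \<in> borel_measurable ?F" for l
      unfolding xs_def using Xm by (cases "l \<le> i") auto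
    show "(\<lambda>\<omega>. ys \<omega> l) \<in> borel_measurable ?F" for l
      unfolding ys_def using Bm by (cases "i < l \<and> l \<le> n") auto
  qed auto
  \<comment> \<open>The right-hand side of the scheme without its stochastic integral, with
    everything known at \<open>t i\<close> turned into the parameter \<open>p\<close>.\<close>
  define \<Psi> where "\<Psi> p \<omega> = UUi i (fst p) \<omega> (snd p) + snd p (Suc i) * VVi i (fst p) \<omega> (snd p)" for p \<omega>
  have uvS: "(\<lambda>(xs, ys). u (Suc i) xs ys) \<in> borel_measurable NN" "(\<lambda>(xs, ys). v (Suc i) xs ys) \<in> borel_measurable NN"
    using uv_measurable[of "Suc i"] i by auto
  have \<Psi>m: "(\<lambda>(p, \<omega>). \<Psi> p \<omega>) \<in> borel_measurable (NN \<Otimes>\<^sub>M ?C)"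
  proof -
    have [measurable]: "(\<lambda>p. UUi i (fst (fst p)) (snd p) (snd (fst p))) \<in> borel_measurable (NN \<Otimes>\<^sub>M ?C)"
      "(\<lambda>p. VVi i (fst (fst p)) (snd p) (snd (fst p))) \<in> borel_measurable (NN \<Otimes>\<^sub>M ?C)"
      using UV_measurable[OF i uvS] by (simp_all add: split_beta')
    show ?thesis unfolding \<Psi>_def split_beta' by measurable
  qed
  obtain K where UV: "UV_bound K i" using UV_growth[OF i] by blast
  note U = UV_boundD(1)[OF UV] and V = UV_boundD(2)[OF UV]
  have \<Psi>b: "\<bar>\<Psi> p \<omega>\<bar> \<le> K * ((1 + norm (fst p i)) * weight i (snd p)) * noise (Suc i) \<omega>" if "\<omega> \<in> space M" for p \<omega>
  proof -
    let ?q = "K * ((1 + norm (fst p i)) * weight (Suc i) (snd p)) * noise (Suc i) \<omega>"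
    have "\<bar>\<Psi> p \<omega>\<bar> \<le> \<bar>UUi i (fst p) \<omega> (snd p)\<bar> + \<bar>snd p (Suc i)\<bar> * \<bar>VVi i (fst p) \<omega> (snd p)\<bar>"
      unfolding \<Psi>_def by (rule order_trans[OF abs_triangle_ineq]) (simp add: abs_mult)
    also have "\<dots> \<le> ?q + \<bar>snd p (Suc i)\<bar> * ?q"
      using U[OF that] V[OF that] by (intro add_mono mult_left_mono) auto
    also have "\<dots> = K * ((1 + norm (fst p i)) * weight i (snd p)) * noise (Suc i) \<omega>"
      unfolding weight_Suc[OF i] by (simp add: algebra_simps)
    finally show ?thesis .
  qed
  have Um: "(\<lambda>\<omega>. UUi i x \<omega> y) \<in> borel_measurable M" and Vm: "(\<lambda>\<omega>. VVi i x \<omega> y) \<in> borel_measurable M" for x y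
    using UV_section_measurable[OF i] by auto
  note Ui = noise_bound_integrable(1,2)[OF S Um U] and Vi = noise_bound_integrable(1,2)[OF S Vm V]
  define R where "R \<omega> = \<Psi> (\<xi> \<omega>) \<omega>" for \<omega>
  have Rm: "R \<in> borel_measurable M"
  proof -
    have "(\<lambda>\<omega>. (\<xi> \<omega>, \<omega>)) \<in> measurable M (NN \<Otimes>\<^sub>M ?C)"
      using FMm[OF \<xi>m] CMm[of "\<lambda>\<omega>. \<omega>" ?C] by (intro measurable_Pair) auto
    from measurable_compose[OF this \<Psi>m] show ?thesis by (simp add: R_def[abs_def])
  qed
  define Q where "Q \<omega> = (1 + norm (X ?s \<omega>)) * weight i (ys \<omega>)" for \<omega>
  have Qm: "Q \<in> borel_measurable ?F"
  proof -
    have "(\<lambda>\<omega>. ys \<omega> l) \<in> borel_measurable ?F" for l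
      unfolding ys_def using Bm by (cases "i < l \<and> l \<le> n") auto
    then have "(\<lambda>\<omega>. weight i (ys \<omega>)) \<in> borel_measurable ?F" unfolding weight_def by simp
    then show ?thesis unfolding Q_def using Xm[of i] by simp
  qed
  have Qmom: "finite_moments M Q"
  proof -
    have "finite_moments M (\<lambda>\<omega>. weight i (ys \<omega>))"
      unfolding weight_def
    proof (intro finite_moments_prod finite_moments_add)
      fix l assume l: "l \<in> {i<..n}"
      then have "(\<lambda>\<omega>. \<bar>ys \<omega> l\<bar>) = (\<lambda>\<omega>. \<bar>dP t B l \<omega>\<bar>)" by (auto simp: ys_def)
      then show "finite_moments M (\<lambda>\<omega>. \<bar>ys \<omega> l\<bar>)" using Bmom[of l] l by auto
    qed (auto intro: finite_moments_bounded[of _ 1])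
    moreover have "finite_moments M (\<lambda>\<omega>. 1 + norm (X ?s \<omega>))"
      using euler_scheme.euler_X_moments[OF es] i
      by (intro finite_moments_add) (auto intro: finite_moments_bounded[of _ 1])
    ultimately show ?thesis unfolding Q_def[abs_def] by (rule finite_moments_mult[rotated])
  qed
  have R2: "integrable M (\<lambda>\<omega>. (R \<omega>)\<^sup>2)"
  proof (rule Bochner_Integration.integrable_bound)
    \<comment> \<open>A product of two square integrable variables need not be square integrable;
      here it is, because \<open>noise\<close> is independent of the known factor
      \<open>Q\<close>.\<close>
    have iv: "indep_var borel (\<lambda>\<omega>. (noise (Suc i) \<omega>)\<^sup>2) borel (\<lambda>\<omega>. (Q \<omega>)\<^sup>2)"
      by (rule indep_var_of_indep_sigalg[OF CF]) (use noise_meas Qm spF space_CC in auto)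
    show "integrable M (\<lambda>\<omega>. K\<^sup>2 * ((noise (Suc i) \<omega>)\<^sup>2 * (Q \<omega>)\<^sup>2))"
      using indep_var_integrable[OF iv noise_square_integrable[OF S] finite_moments_square_integrable[OF Qmom]] by simp
    show "(\<lambda>\<omega>. (R \<omega>)\<^sup>2) \<in> borel_measurable M" using Rm by simp
    show "AE \<omega> in M. norm ((R \<omega>)\<^sup>2) \<le> norm (K\<^sup>2 * ((noise (Suc i) \<omega>)\<^sup>2 * (Q \<omega>)\<^sup>2))"
    proof (rule AE_I2)
      fix \<omega> assume "\<omega> \<in> space M"
      from \<Psi>b[OF this, of "\<xi> \<omega>"] have "\<bar>R \<omega>\<bar> \<le> K * Q \<omega> * noise (Suc i) \<omega>"
        by (simp add: R_def \<xi>_def xs_def Q_def)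
      then have "\<bar>R \<omega>\<bar>\<^sup>2 \<le> (K * Q \<omega> * noise (Suc i) \<omega>)\<^sup>2" by (intro power_mono) auto
      then show "norm ((R \<omega>)\<^sup>2) \<le> norm (K\<^sup>2 * ((noise (Suc i) \<omega>)\<^sup>2 * (Q \<omega>)\<^sup>2))"
        by (simp add: power_mult_distrib mult_ac)
    qed
  qed
  have Rint: "integrable M R" by (rule square_integrable_imp_integrable[OF Rm R2])
  have Xstep: "AE \<omega> in M. X ?r \<omega> = euler_step W b \<sigma> ?s ?r (X ?s \<omega>) \<omega>"
    by (rule euler_scheme.euler_X_step[OF es i])
  have bsi: "\<forall>s\<in>{t (Suc i - 1)..<?r}. Y s \<in> borel_measurable (sigalg_G M T W B (t (Suc i - 1)) s) \<and>
      (\<exists>I. has_ito_integral M (sigalg_G M T W B (t (Suc i - 1))) W s ?r Z I \<and>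
        (AE \<omega> in M. Y s \<omega> = Y ?r \<omega> + ?f \<omega> * dt t (Suc i)
          + ?g \<omega> * dP t B (Suc i) \<omega> - I \<omega>))"
    using bs S unfolding backward_scheme_def by blast
  then have YG: "Y ?s \<in> borel_measurable (sigalg_G M T W B ?s ?s)" using sr by auto
  obtain I where IG: "has_ito_integral M (sigalg_G M T W B ?s) W ?s ?r Z I"
    and Yeq: "AE \<omega> in M. Y ?s \<omega> = Y ?r \<omega> + ?f \<omega> * dt t (Suc i)
          + ?g \<omega> * dP t B (Suc i) \<omega> - I \<omega>"
  proof -
    have "?s \<in> {t (Suc i - 1)..<?r}" using sr by simp
    from bspec[OF bsi this] show ?thesis using that by (elim conjE exE) simp
  qed
  have IH: "has_ito_integral M ?H W ?s ?r Z I"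
    by (rule has_ito_integral_mono[OF IG sigalg_G_full[OF ps W B WB sr(1,4)]])
  note ito = H.ito_square_integrable[OF IH] H.ito_expectation[OF IH]
    H.ito_integrand_integral_integrable[OF IH] H.ito_covariance[OF IH]
  have Im: "I \<in> borel_measurable M" using IG unfolding has_ito_integral_def by blast
  have I2: "integrable M (\<lambda>\<omega>. (I \<omega>)\<^sup>2)" using ito(1) sr by simp
  have Iint: "integrable M I" by (rule square_integrable_imp_integrable[OF Im I2])
  have YF: "Y ?s \<in> borel_measurable ?F"
    by (rule measurable_from_subalg[OF sigalg_G_F[OF ps W B WB] YG])
  have YM: "Y ?s \<in> borel_measurable M" by (rule FMm[OF YF])
  \<comment> \<open>The Euler step supplies entry \<open>Suc i\<close>, which is 0 in
    \<open>xs\<close>. The induction hypotheses then identify the values of \<open>u\<close> and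
    \<open>v\<close> inside \<open>\<Psi>\<close> with \<open>Y\<close> and \<open>Z1\<close> at the
    next grid time.\<close>
  have YR: "AE \<omega> in M. Y ?s \<omega> = R \<omega> - I \<omega>"
    using Yeq Xstep IHY IHZ
  proof eventually_elim
    case (elim \<omega>)
    let ?x = "euler_step W b \<sigma> ?s ?r (X ?s \<omega>) \<omega>"
    have "u (Suc i) ((xs \<omega>)(Suc i := ?x)) (ys \<omega>) = ?u (Suc i) \<omega> \<and>
        v (Suc i) ((xs \<omega>)(Suc i := ?x)) (ys \<omega>) = ?v (Suc i) \<omega>"
      by (rule uv_cong) (use i elim(2) in \<open>auto simp: xs_def ys_def\<close>)
    then have e: "u (Suc i) ((xs \<omega>)(Suc i := ?x)) (ys \<omega>) = Y ?r \<omega>" "v (Suc i) ((xs \<omega>)(Suc i := ?x)) (ys \<omega>) = Z1 (Suc i) \<omega>"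
      using elim(3,4) by auto
    have y: "ys \<omega> (Suc i) = dP t B (Suc i) \<omega>" and x: "xs \<omega> i = X ?s \<omega>" using i by (auto simp: ys_def xs_def)
    have "R \<omega> = Y ?r \<omega> + ?f \<omega> * dt t (Suc i)
          + dP t B (Suc i) \<omega> * ?g \<omega>"
      unfolding R_def \<Psi>_def \<xi>_def UU_def VV_def Let_def fst_conv snd_conv Suc_eq_plus1[symmetric] x y elim(2)[symmetric]
      by (simp only: e[folded elim(2)])
    then show ?case using elim(1) by simp
  qed
  have Yint: "integrable M (Y ?s)"
    using Bochner_Integration.integrable_diff[OF Rint Iint] YR YM
    by (subst integrable_cong_AE[of _ _ "\<lambda>\<omega>. R \<omega> - I \<omega>"]) (use Rm Im in auto)
  have AM: "A \<in> events" "A \<in> sets (?H ?s)" if "A \<in> sets ?F" for A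
    using that FM FH unfolding subalgebra_def by auto
  have indi: "integrable M (\<lambda>\<omega>. indicator A \<omega> * G \<omega>)" if "A \<in> sets ?F" "integrable M G" for A and G :: "'w \<Rightarrow> real"
    using integrable_mult_indicator[OF AM(1)[OF that(1)] that(2)] by simp
  define \<psi> where "\<psi> p = (\<integral>\<omega>. \<Psi> p \<omega> \<partial>M)" for p
  have \<psi>m: "(\<lambda>\<omega>. \<psi> (\<xi> \<omega>)) \<in> borel_measurable ?F"
    using measurable_compose[OF \<xi>m freezing_measurable[OF CM \<Psi>m]] by (simp add: \<psi>_def)
  have Rint': "integrable M (\<lambda>\<omega>. \<Psi> (\<xi> \<omega>) \<omega>)" using Rint by (simp add: R_def[abs_def])
  have \<psi>int: "integrable M (\<lambda>\<omega>. \<psi> (\<xi> \<omega>))"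
    using freezing_integral(1)[OF CF space_CC spF \<xi>m \<Psi>m Rint'] by (simp add: \<psi>_def)
  \<comment> \<open>\<open>Y\<close> at \<open>t i\<close> is already measurable over
    \<open>?F\<close>, so comparing integrals over events of \<open>?F\<close> identifies it
    directly.\<close>
  have Y\<psi>: "AE \<omega> in M. Y ?s \<omega> = \<psi> (\<xi> \<omega>)"
  proof (rule AE_eq_subalgebra[OF FM YF \<psi>m Yint \<psi>int])
    fix A assume A: "A \<in> sets ?F"
    have "(?E A (Y ?s)) = (\<integral>\<omega>. indicator A \<omega> * R \<omega> - indicator A \<omega> * I \<omega> \<partial>M)"
      using YR YM Rm Im AM(1)[OF A] by (intro integral_cong_AE) (auto elim!: eventually_mono simp: right_diff_distrib)
    also have "\<dots> = (?E A R) - (?E A I)"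
      using indi[OF A Rint] indi[OF A Iint] by simp
    also have "(?E A I) = 0"
      using ito(2)[of A] AM(2)[OF A] sr by simp
    also have "(?E A R) = (?E A (\<lambda>\<omega>. \<psi> (\<xi> \<omega>)))"
      using freezing_set_integral[OF CF space_CC spF \<xi>m \<Psi>m Rint' A] by (simp add: R_def \<psi>_def)
    finally show "(?E A (Y ?s)) = (?E A (\<lambda>\<omega>. \<psi> (\<xi> \<omega>)))" by simp
  qed
  have \<xi>cong: "u i (xs \<omega>) (ys \<omega>) = ?u i \<omega> \<and>
      v i (xs \<omega>) (ys \<omega>) = ?v i \<omega>" for \<omega>
    by (rule uv_cong) (use i in \<open>auto simp: xs_def ys_def\<close>)
  have \<psi>u: "\<psi> (\<xi> \<omega>) = ?u i \<omega>" for \<omega>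
    using \<xi>cong[of \<omega>] Ui(1) Vi(1) unfolding \<psi>_def \<Psi>_def u_step[OF i] \<xi>_def by simp
  have dWk: "(\<lambda>\<omega>. ?dW \<omega> $ k) \<in> borel_measurable ?C" for k
    by (rule measurable_compose[OF dP_meas]) (intro borel_measurable_continuous_onI continuous_intros)
  define \<Psi>2 where "\<Psi>2 k p \<omega> = \<Psi> p \<omega> * ?dW \<omega> $ k" for k p \<omega>
  define \<psi>2 where "\<psi>2 k p = (\<integral>\<omega>. \<Psi>2 k p \<omega> \<partial>M)" for k p
  have \<Psi>2m: "(\<lambda>(p, \<omega>). \<Psi>2 k p \<omega>) \<in> borel_measurable (NN \<Otimes>\<^sub>M ?C)" for k
    using \<Psi>m measurable_compose[OF measurable_snd dWk[of k], of NN] unfolding \<Psi>2_def split_beta' by simp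
  have dW2: "integrable M (\<lambda>\<omega>. (?dW \<omega> $ k)\<^sup>2)" for k
    using finite_moments_square_integrable[OF H.finite_moments_incr_component[of ?s ?r "axis k 1"]] sr
    by (simp add: dP_def inner_axis)
  have Rdint: "integrable M (\<lambda>\<omega>. \<Psi>2 k (\<xi> \<omega>) \<omega>)" for k
    using integrable_mult_L2[OF Rm _ R2 dW2[of k]] CMm[OF dWk] by (simp add: R_def \<Psi>2_def)
  have \<psi>2m: "(\<lambda>\<omega>. \<psi>2 k (\<xi> \<omega>)) \<in> borel_measurable ?F" for k
    using measurable_compose[OF \<xi>m freezing_measurable[OF CM \<Psi>2m]] by (simp add: \<psi>2_def)
  have \<psi>2int: "integrable M (\<lambda>\<omega>. \<psi>2 k (\<xi> \<omega>))" for k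
    using freezing_integral(1)[OF CF space_CC spF \<xi>m \<Psi>2m Rdint] by (simp add: \<psi>2_def)
  define G where "G \<omega> = (\<integral>s. Z s \<omega> \<partial>restrict_space lborel {?s..<?r})" for \<omega>
  have Gint: "integrable M G" using ito(3) sr by (simp add: G_def[abs_def])
  have Gkint: "integrable M (\<lambda>\<omega>. G \<omega> $ k)" for k
    using integrable_inner_left[of "axis k 1" M G] Gint by (simp add: inner_axis)
  have G\<psi>: "AE \<omega> in M. real_cond_exp M ?F (\<lambda>\<omega>. G \<omega> $ k) \<omega> = \<psi>2 k (\<xi> \<omega>)" for k
  proof (rule AE_cond_exp_eq[OF FM \<psi>2m Gkint \<psi>2int])
    fix A assume A: "A \<in> sets ?F"
    let ?D = "\<lambda>\<omega>. ?dW \<omega> $ k"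
    have D: "?D \<omega> = (W ?r \<omega> - W ?s \<omega>) \<bullet> axis k 1" for \<omega> by (simp add: dP_def inner_axis)
    have Dm: "?D \<in> borel_measurable M" by (rule CMm[OF dWk])
    have IDint: "integrable M (\<lambda>\<omega>. I \<omega> * ?D \<omega>)" by (rule integrable_mult_L2[OF Im Dm I2 dW2])
    have AY: "(\<lambda>\<omega>. indicator A \<omega> * Y ?s \<omega>) \<in> borel_measurable (?H ?s)"
      using measurable_from_subalg[OF FH YF] AM(2)[OF A] by simp
    \<comment> \<open>Both \<open>A\<close> and \<open>Y\<close> are known at the left end, and the
      increment after it is centred and independent of them.\<close>
    have Yz: "(\<integral>\<omega>. (indicator A \<omega> * Y ?s \<omega>) * ?D \<omega> \<partial>M) = 0" and Yzi: "integrable M (\<lambda>\<omega>. (indicator A \<omega> * Y ?s \<omega>) * ?D \<omega>)"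
      unfolding D using sr H.expectation_mult_incr[of ?s ?r "axis k 1", OF _ _ _ _ AY indi[OF A Yint]]
        H.integrable_mult_incr[of ?s ?r "axis k 1", OF _ _ _ _ AY indi[OF A Yint]] by auto
    have "(?E A (\<lambda>\<omega>. G \<omega> $ k)) = (\<integral>\<omega>. indicator A \<omega> * (I \<omega> * ?D \<omega>) \<partial>M)"
      using ito(4)[of A "axis k 1"] AM(2)[OF A] sr unfolding G_def D by (simp add: inner_axis)
    also have "\<dots> = (\<integral>\<omega>. indicator A \<omega> * \<Psi>2 k (\<xi> \<omega>) \<omega> - (indicator A \<omega> * Y ?s \<omega>) * ?D \<omega> \<partial>M)"
    proof (rule integral_cong_AE)
      show "AE \<omega> in M. indicator A \<omega> * (I \<omega> * ?D \<omega>) = indicator A \<omega> * \<Psi>2 k (\<xi> \<omega>) \<omega> - (indicator A \<omega> * Y ?s \<omega>) * ?D \<omega>"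
        using YR
      proof eventually_elim
        case (elim \<omega>)
        then have "I \<omega> = \<Psi> (\<xi> \<omega>) \<omega> - Y ?s \<omega>" by (simp add: R_def)
        then show ?case by (simp only: \<Psi>2_def left_diff_distrib right_diff_distrib mult.assoc)
      qed
    qed (use indi[OF A IDint] indi[OF A Rdint] Yzi in auto)
    also have "\<dots> = (?E A (\<lambda>\<omega>. \<Psi>2 k (\<xi> \<omega>) \<omega>))"
      using indi[OF A Rdint] Yzi Yz by simp
    also have "\<dots> = (?E A (\<lambda>\<omega>. \<psi>2 k (\<xi> \<omega>)))"
      using freezing_set_integral[OF CF space_CC spF \<xi>m \<Psi>2m Rdint A] by (simp add: \<psi>2_def)
    finally show "(?E A (\<lambda>\<omega>. G \<omega> $ k)) = (?E A (\<lambda>\<omega>. \<psi>2 k (\<xi> \<omega>)))" .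
  qed
  have LG: "(LINT r:{?s..?r}|lborel. Z r \<omega>) = G \<omega>" for \<omega>
    unfolding G_def by (rule integral_closed_eq_half_open)
  have cex: "AE \<omega> in M. cond_exp_vec M ?F (\<lambda>\<omega>. LINT r:{?s..?r}|lborel. Z r \<omega>) \<omega> $ k = \<psi>2 k (\<xi> \<omega>)" for k
    using G\<psi>[of k] unfolding cond_exp_vec_def LG by simp
  have \<psi>2v: "(1 / dt t (Suc i)) * \<psi>2 k (\<xi> \<omega>) = ?v i \<omega> $ k" for k \<omega>
  proof -
    have comp: "(\<integral>\<omega>'. E \<omega>' *\<^sub>R ?dW \<omega>' \<partial>M) $ k = (\<integral>\<omega>'. E \<omega>' * ?dW \<omega>' $ k \<partial>M)"
        "integrable M (\<lambda>\<omega>'. E \<omega>' * ?dW \<omega>' $ k)"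
      if "integrable M (\<lambda>\<omega>'. E \<omega>' *\<^sub>R ?dW \<omega>')" for E
      using integral_inner_left[of "axis k 1" M "\<lambda>\<omega>'. E \<omega>' *\<^sub>R ?dW \<omega>'"] that
        integrable_inner_left[of "axis k 1" M "\<lambda>\<omega>'. E \<omega>' *\<^sub>R ?dW \<omega>'"]
      by (simp_all add: inner_axis)
    let ?E1 = "\<lambda>\<omega>'. UUi i (xs \<omega>) \<omega>' (ys \<omega>)" and ?E2 = "\<lambda>\<omega>'. VVi i (xs \<omega>) \<omega>' (ys \<omega>)"
    have "\<psi>2 k (\<xi> \<omega>) = (\<integral>\<omega>'. ?E1 \<omega>' * ?dW \<omega>' $ k + ys \<omega> (Suc i) * (?E2 \<omega>' * ?dW \<omega>' $ k) \<partial>M)"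
      unfolding \<psi>2_def \<Psi>2_def \<Psi>_def \<xi>_def fst_conv snd_conv by (simp only: distrib_right mult.assoc)
    also have "\<dots> = (\<integral>\<omega>'. ?E1 \<omega>' * ?dW \<omega>' $ k \<partial>M) + ys \<omega> (Suc i) * (\<integral>\<omega>'. ?E2 \<omega>' * ?dW \<omega>' $ k \<partial>M)"
      using comp(2)[OF Ui(2)] comp(2)[OF Vi(2)] by simp
    finally have "(1 / dt t (Suc i)) * \<psi>2 k (\<xi> \<omega>) = v i (xs \<omega>) (ys \<omega>) $ k"
      unfolding v_step[OF i] using comp(1)[OF Ui(2)] comp(1)[OF Vi(2)] by (simp add: distrib_left)
    then show ?thesis using \<xi>cong[of \<omega>] by simp
  qed
  have "AE \<omega> in M. \<forall>k. cond_exp_vec M ?F (\<lambda>\<omega>. LINT r:{?s..?r}|lborel. Z r \<omega>) \<omega> $ k = \<psi>2 k (\<xi> \<omega>)"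
    using cex by (simp add: AE_all_countable)
  moreover have "AE \<omega> in M. Z1 i \<omega> = (1 / dt t (Suc i)) *\<^sub>R
         cond_exp_vec M ?F (\<lambda>\<omega>. LINT r:{?s..?r}|lborel. Z r \<omega>) \<omega>"
    using bs i unfolding backward_scheme_def by simp
  ultimately have "AE \<omega> in M. Z1 i \<omega> = ?v i \<omega>"
    by eventually_elim (simp add: vec_eq_iff \<psi>2v[symmetric])
  with Y\<psi> show ?thesis by (simp add: \<psi>u)
qed

section \<open>Consequences of the hypotheses on the coefficients, and the induction\<close>

lemma class_Cb_continuous_bounded:
  assumes "class_Cb k F"
  shows "continuous_on UNIV F" "bounded (range F)"
proof -
  \<comment> \<open>The empty list of directions is the derivative of order 0, that is the function
    itself.\<close>
  have e: "iter_partial [] F = F" by (simp add: iter_partial_def)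
  have "continuous_on UNIV (iter_partial [] F)"
    using assms unfolding class_Cb_def class_C_def by (elim conjE) (auto dest!: spec[of _ "[]"])
  then show "continuous_on UNIV F" unfolding e .
  have "bounded (range (iter_partial [] F))"
    using assms unfolding class_Cb_def by (elim conjE) (auto dest!: spec[of _ "[]"])
  then show "bounded (range F)" unfolding e .
qed

text \<open>Membership in \<open>space_M2\<close> controls the time integral but no individual time.
  The modulus of continuity compares \<open>p s\<close> with \<open>p r\<close> for every
  \<open>r\<close>, and averaging over \<open>r\<close> transfers the integrability to the fixed
  time \<open>s\<close>.\<close>

lemma space_M2_square_integrable:
  fixes p :: "real \<Rightarrow> 'w \<Rightarrow> real"
  assumes M: "prob_space M" and T: "0 < T" and p: "p \<in> space_M2 M T F" and s: "s \<in> {0..T}"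
    and ps[measurable]: "p s \<in> borel_measurable M" and L: "0 \<le> L"
    and lip: "\<And>\<omega> r. \<omega> \<in> space M \<Longrightarrow> r \<in> {0..T} \<Longrightarrow> \<bar>p s \<omega> - p r \<omega>\<bar>\<^sup>2 \<le> L * \<bar>s - r\<bar>"
  shows "integrable M (\<lambda>\<omega>. (p s \<omega>)\<^sup>2)"
proof -
  interpret prob_space M by (rule M)
  define N where "N = restrict_space lborel {0..T}"
  have spN: "space N = {0..T}" by (simp add: N_def space_restrict_space)
  have eN: "emeasure N (space N) = ennreal T"
    using T by (simp add: N_def space_restrict_space emeasure_restrict_space)
  interpret N: finite_measure N by standard (simp add: eN)
  interpret P: pair_sigma_finite N M ..
  have setsN: "sets (N \<Otimes>\<^sub>M M) = sets (restrict_space borel {0..T} \<Otimes>\<^sub>M M)"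
    by (intro sets_pair_measure_cong) (auto simp: N_def sets_restrict_space)
  have pm[measurable]: "(\<lambda>(r, \<omega>). p r \<omega>) \<in> borel_measurable (N \<Otimes>\<^sub>M M)"
    using p unfolding space_M2_def by (simp add: measurable_cong_sets[OF setsN refl])
  have "(\<integral>\<^sup>+x. ennreal ((case x of (r, \<omega>) \<Rightarrow> p r \<omega>)\<^sup>2) \<partial>(N \<Otimes>\<^sub>M M))
      = (\<integral>\<^sup>+\<omega>. (\<integral>\<^sup>+r\<in>{0..T}. ennreal ((p r \<omega>)\<^sup>2) \<partial>lborel) \<partial>M)"
  proof -
    have "(\<lambda>x. ennreal ((case x of (r, \<omega>) \<Rightarrow> p r \<omega>)\<^sup>2)) \<in> borel_measurable (N \<Otimes>\<^sub>M M)" by measurable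
    from P.nn_integral_snd[OF this] show ?thesis by (simp add: N_def nn_integral_restrict_space)
  qed
  also have "\<dots> < \<infinity>" using p unfolding space_M2_def by simp
  finally have fin: "(\<integral>\<^sup>+x. ennreal ((case x of (r, \<omega>) \<Rightarrow> p r \<omega>)\<^sup>2) \<partial>(N \<Otimes>\<^sub>M M)) < \<infinity>" .
  have bd: "(p s \<omega>)\<^sup>2 \<le> 2 * (p r \<omega>)\<^sup>2 + 2 * (L * T)" if "\<omega> \<in> space M" "r \<in> {0..T}" for \<omega> r
  proof -
    have "L * \<bar>s - r\<bar> \<le> L * T" using s that L by (intro mult_left_mono) auto
    then have "(p s \<omega> - p r \<omega>)\<^sup>2 \<le> L * T" using lip[OF that] by simp
    moreover have "(p s \<omega>)\<^sup>2 \<le> 2 * (p r \<omega>)\<^sup>2 + 2 * (p s \<omega> - p r \<omega>)\<^sup>2"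
      using zero_le_power2[of "p s \<omega> - 2 * p r \<omega>"] by (simp add: power2_eq_square algebra_simps)
    ultimately show ?thesis by linarith
  qed
  \<comment> \<open>Integrating a quantity that does not depend on \<open>r\<close> over the time
    interval multiplies it by \<open>T\<close>; since \<open>T\<close> is positive, finiteness of
    the product gives that of the second moment.\<close>
  have "(\<integral>\<^sup>+\<omega>. ennreal ((p s \<omega>)\<^sup>2) \<partial>M) * ennreal T = (\<integral>\<^sup>+x. ennreal ((p s (snd x))\<^sup>2) \<partial>(N \<Otimes>\<^sub>M M))"
    by (subst P.nn_integral_snd[symmetric]) (simp_all add: eN nn_integral_multc)
  also have "\<dots> \<le> (\<integral>\<^sup>+x. 2 * ennreal ((case x of (r, \<omega>) \<Rightarrow> p r \<omega>)\<^sup>2) + ennreal (2 * (L * T)) \<partial>(N \<Otimes>\<^sub>M M))"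
  proof (rule nn_integral_mono)
    fix x assume "x \<in> space (N \<Otimes>\<^sub>M M)"
    then have "(p s (snd x))\<^sup>2 \<le> 2 * (p (fst x) (snd x))\<^sup>2 + 2 * (L * T)"
      by (intro bd) (auto simp: space_pair_measure spN)
    from ennreal_leI[OF this]
    show "ennreal ((p s (snd x))\<^sup>2) \<le> 2 * ennreal ((case x of (r, \<omega>) \<Rightarrow> p r \<omega>)\<^sup>2) + ennreal (2 * (L * T))"
      using L T by (simp add: ennreal_mult' split_beta')
  qed
  also have "\<dots> = 2 * (\<integral>\<^sup>+x. ennreal ((case x of (r, \<omega>) \<Rightarrow> p r \<omega>)\<^sup>2) \<partial>(N \<Otimes>\<^sub>M M)) + ennreal (2 * (L * T)) * emeasure (N \<Otimes>\<^sub>M M) (space (N \<Otimes>\<^sub>M M))"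
    by (simp add: nn_integral_add nn_integral_cmult)
  also have "\<dots> < \<infinity>"
  proof -
    have "finite_measure (N \<Otimes>\<^sub>M M)" by (rule finite_measure_pair_measure) unfold_locales
    then have "emeasure (N \<Otimes>\<^sub>M M) (space (N \<Otimes>\<^sub>M M)) < \<infinity>"
      using finite_measure.emeasure_finite by (auto simp: less_top)
    then show ?thesis using fin by (auto simp: ennreal_mult_less_top)
  qed
  finally have "(\<integral>\<^sup>+\<omega>. ennreal ((p s \<omega>)\<^sup>2) \<partial>M) < \<infinity>"
    using T by (auto simp: ennreal_mult_less_top)
  then show ?thesis by (simp add: integrable_iff_bounded)
qed

text \<open>For nonnegative terms the sum of squares is at most the square of the sum. Passing from
  \<open>L\<close> to a larger \<open>K\<close> lets both coefficients share one constant.\<close>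

lemma lipschitz_of_square_bound:
  fixes a b c h :: real
  assumes "\<bar>h\<bar>\<^sup>2 \<le> L * (a\<^sup>2 + b\<^sup>2 + c\<^sup>2)" "0 \<le> L" "L \<le> K" "0 \<le> a" "0 \<le> b" "0 \<le> c"
  shows "\<bar>h\<bar> \<le> sqrt K * (a + b + c)"
proof (rule power2_le_imp_le)
  have "a\<^sup>2 + b\<^sup>2 + c\<^sup>2 \<le> (a + b + c)\<^sup>2"
    using assms(4-6) by (simp add: power2_sum power2_eq_square algebra_simps)
  then have "L * (a\<^sup>2 + b\<^sup>2 + c\<^sup>2) \<le> K * (a + b + c)\<^sup>2"
    using assms by (intro mult_mono) auto
  then show "\<bar>h\<bar>\<^sup>2 \<le> (sqrt K * (a + b + c))\<^sup>2"
    using assms by (simp add: power_mult_distrib)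
qed (use assms in auto)

theorem theorem4p1:
  fixes M :: "'w measure" and T :: real
    and W :: "real \<Rightarrow> 'w \<Rightarrow> real^'d" and B :: "real \<Rightarrow> 'w \<Rightarrow> real"
    and x0 :: "real^'d" and b :: "real^'d \<Rightarrow> real^'d" and \<sigma> :: "real^'d \<Rightarrow> real^'d^'d"
    and \<phi> :: "real^'d \<Rightarrow> real"
    and f g :: "'w \<Rightarrow> real \<Rightarrow> real^'d \<Rightarrow> real \<Rightarrow> real^'d \<Rightarrow> real"
    and Lf Lg \<alpha> :: real
    and n :: nat and t :: "nat \<Rightarrow> real"
    and X :: "real \<Rightarrow> 'w \<Rightarrow> real^'d" and Y :: "real \<Rightarrow> 'w \<Rightarrow> real"
    and Z :: "real \<Rightarrow> 'w \<Rightarrow> real^'d" and Z1 :: "nat \<Rightarrow> 'w \<Rightarrow> real^'d"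
  assumes "prob_space M" and "T > 0"
    and "brownian_motion M T W" and "brownian_motion M T B" and "indep_processes M T W B"
    and "class_Cb 3 b" and "class_Cb 3 \<sigma>" and "class_Cb 2 \<phi>"
    and "joint_measurable_coeff M T f" and "joint_measurable_coeff M T g"
    and "\<And>x y z. (\<lambda>s \<omega>. f \<omega> s x y z) \<in> space_M2 M T (sigalg_F M T W B)"
    and "\<And>x y z. (\<lambda>s \<omega>. g \<omega> s x y z) \<in> space_M2 M T (sigalg_F M T W B)"
    and "Lf \<ge> 0" and "Lg \<ge> 0" and "0 \<le> \<alpha>" and "\<alpha> < 1"
    and "\<And>\<omega> s s' x x' y y' z z'. \<omega> \<in> space M \<Longrightarrow> s \<in> {0..T} \<Longrightarrow> s' \<in> {0..T} \<Longrightarrow>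
          \<bar>f \<omega> s x y z - f \<omega> s' x' y' z'\<bar>\<^sup>2
            \<le> Lf * (\<bar>s - s'\<bar> + (norm (x - x'))\<^sup>2 + \<bar>y - y'\<bar>\<^sup>2 + (norm (z - z'))\<^sup>2)"
    and "\<And>\<omega> s s' x x' y y' z z'. \<omega> \<in> space M \<Longrightarrow> s \<in> {0..T} \<Longrightarrow> s' \<in> {0..T} \<Longrightarrow>
          \<bar>g \<omega> s x y z - g \<omega> s' x' y' z'\<bar>\<^sup>2
            \<le> Lg * (\<bar>s - s'\<bar> + (norm (x - x'))\<^sup>2 + \<bar>y - y'\<bar>\<^sup>2) + \<alpha> * (norm (z - z'))\<^sup>2"
    and "\<And>\<omega>. \<omega> \<in> space M \<Longrightarrow> class_C_bdd_derivs 3 {0..T} (\<lambda>s (x, y, z). f \<omega> s x y z)"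
    and "\<And>\<omega>. \<omega> \<in> space M \<Longrightarrow> class_C_bdd_derivs 3 {0..T} (\<lambda>s (x, y, z). g \<omega> s x y z)"
    and "\<And>\<omega>. \<omega> \<in> space M \<Longrightarrow> bdd_above ((\<lambda>r. \<bar>f \<omega> r 0 0 0\<bar>) ` {0..T})"
    and "\<And>\<omega>. \<omega> \<in> space M \<Longrightarrow> bdd_above ((\<lambda>r. \<bar>g \<omega> r 0 0 0\<bar>) ` {0..T})"
    and "\<And>\<omega>. \<omega> \<in> space M \<Longrightarrow> \<exists>c<1. \<forall>s\<in>{0..T}. \<forall>x y z. norm (grad_z g \<omega> s x y z) \<le> c"
    and "subdivision T n t"
    and "coeffs_indep_of_F M T n t W B f g"
    and "euler_X M T n t W b \<sigma> x0 X"
    and "backward_scheme M T n t W B \<phi> f g X Y Z Z1"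
  shows "\<forall>i\<le>n.
      (AE \<omega> in M. Y (t i) \<omega> =
         u_pi M n t W b \<sigma> \<phi> f g i (\<lambda>j. X (t j) \<omega>) (\<lambda>j. dP t B j \<omega>)) \<and>
      (AE \<omega> in M. Z1 i \<omega> =
         v_pi M n t W b \<sigma> \<phi> f g i (\<lambda>j. X (t j) \<omega>) (\<lambda>j. dP t B j \<omega>))"
proof -
  note Mp = assms(1) and T = assms(2) and W = assms(3) and B = assms(4) and WB = assms(5)
    and sd = assms(24) and cind = assms(25) and X = assms(26) and bs = assms(27)
  interpret prob_space M by (rule Mp)
  \<comment> \<open>The sum serves \<open>f\<close> and \<open>g\<close> at once, and the summand 1
    absorbs the constant \<open>\<alpha> < 1\<close> in front of the \<open>z\<close> term of
    \<open>g\<close>.\<close>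
  let ?L = "Lf + Lg + 1"
  have ti: "t i \<in> {0..T}" if "i \<in> {1..n}" for i
    using subdivision_bounds[OF sd, of i] that by auto
  \<comment> \<open>Independence in the sense of \<open>indep_set\<close> includes that its families
    consist of events, so the inclusion is contained in \<open>cind\<close>.\<close>
  have CM: "subalgebra M (coeff_sigalg M t W f g i)" if "i \<in> {1..n}" for i
    using cind that unfolding coeffs_indep_of_F_def indep_sigalg_def indep_sets2_eq subalgebra_def
    by (auto simp: coeff_sigalg_def space_measure_of_conv)
  have coeff: "(\<lambda>\<omega>. f \<omega> (t i) x y z) \<in> borel_measurable M" "(\<lambda>\<omega>. g \<omega> (t i) x y z) \<in> borel_measurable M"
    if i: "i \<in> {1..n}" for i x y z
  proof -
    have "(\<lambda>\<omega>. (\<omega>, t i, x, y, z)) \<in> measurable M (M \<Otimes>\<^sub>M restrict_space borel {0..T} \<Otimes>\<^sub>M borel \<Otimes>\<^sub>M borel \<Otimes>\<^sub>M borel)"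
      using ti[OF i] by (intro measurable_Pair measurable_const) (auto simp: space_restrict_space)
    from measurable_compose[OF this assms(9)[unfolded joint_measurable_coeff_def]]
      measurable_compose[OF this assms(10)[unfolded joint_measurable_coeff_def]]
    show "(\<lambda>\<omega>. f \<omega> (t i) x y z) \<in> borel_measurable M" "(\<lambda>\<omega>. g \<omega> (t i) x y z) \<in> borel_measurable M"
      by simp_all
  qed
  \<comment> \<open>At equal times the term \<open>\<bar>s - s'\<bar>\<close>, the only one that is
    not a square, disappears, which leaves a genuine Lipschitz bound in space.\<close>
  have f2: "\<bar>f \<omega> s x y z - f \<omega> s x' y' z'\<bar>\<^sup>2 \<le> Lf * ((norm (x - x'))\<^sup>2 + \<bar>y - y'\<bar>\<^sup>2 + (norm (z - z'))\<^sup>2)"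
    if "\<omega> \<in> space M" "s \<in> {0..T}" for \<omega> s x x' y y' z z'
    using assms(17)[OF that that(2), of x y z x' y' z'] by simp
  have g2: "\<bar>g \<omega> s x y z - g \<omega> s x' y' z'\<bar>\<^sup>2 \<le> (Lg + 1) * ((norm (x - x'))\<^sup>2 + \<bar>y - y'\<bar>\<^sup>2 + (norm (z - z'))\<^sup>2)"
    if "\<omega> \<in> space M" "s \<in> {0..T}" for \<omega> s x x' y y' z z'
  proof -
    have "\<bar>g \<omega> s x y z - g \<omega> s x' y' z'\<bar>\<^sup>2 \<le> Lg * ((norm (x - x'))\<^sup>2 + \<bar>y - y'\<bar>\<^sup>2) + \<alpha> * (norm (z - z'))\<^sup>2"
      using assms(18)[OF that that(2), of x y z x' y' z'] by simp
    also have "\<dots> \<le> (Lg + 1) * ((norm (x - x'))\<^sup>2 + \<bar>y - y'\<bar>\<^sup>2) + (Lg + 1) * (norm (z - z'))\<^sup>2"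
      using assms(13-16) by (intro add_mono mult_right_mono) auto
    finally show ?thesis by (simp add: distrib_left)
  qed
  have uv: "uv_setting M T n t W b \<sigma> \<phi> f g (sqrt ?L)"
  proof unfold_locales
    show "subdivision T n t" by (rule sd)
    show "b \<in> borel_measurable borel" "\<sigma> \<in> borel_measurable borel" "\<phi> \<in> borel_measurable borel"
      "bounded (range b)" "bounded (range \<sigma>)" "bounded (range \<phi>)"
      using class_Cb_continuous_bounded[OF assms(6)] class_Cb_continuous_bounded[OF assms(7)]
        class_Cb_continuous_bounded[OF assms(8)] by (auto intro: borel_measurable_continuous_onI)
    show "0 \<le> sqrt ?L" using assms(13,14) by simp
    fix i assume i: "i \<in> {1..n}"
    show "subalgebra M (coeff_sigalg M t W f g i)" by (rule CM[OF i])
    show "integrable M (\<lambda>\<omega>. (f \<omega> (t i) 0 0 0)\<^sup>2)"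
    proof (rule space_M2_square_integrable[OF Mp T assms(11) ti[OF i] coeff(1)[OF i] assms(13)])
      fix \<omega> r assume "\<omega> \<in> space M" "r \<in> {0..T}"
      from assms(17)[OF this(1) ti[OF i] this(2), of 0 0 0 0 0 0]
      show "\<bar>f \<omega> (t i) 0 0 0 - f \<omega> r 0 0 0\<bar>\<^sup>2 \<le> Lf * \<bar>t i - r\<bar>" by simp
    qed
    show "integrable M (\<lambda>\<omega>. (g \<omega> (t i) 0 0 0)\<^sup>2)"
    proof (rule space_M2_square_integrable[OF Mp T assms(12) ti[OF i] coeff(2)[OF i] assms(14)])
      fix \<omega> r assume "\<omega> \<in> space M" "r \<in> {0..T}"
      from assms(18)[OF this(1) ti[OF i] this(2), of 0 0 0 0 0 0]
      show "\<bar>g \<omega> (t i) 0 0 0 - g \<omega> r 0 0 0\<bar>\<^sup>2 \<le> Lg * \<bar>t i - r\<bar>" by simp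
    qed
    show "finite_moments M (\<lambda>\<omega>. norm (dP t W i \<omega>))"
      unfolding dP_def using i subdivision_bounds[OF sd, of "i - 1"] subdivision_bounds[OF sd, of i]
        subdivision_less[OF sd, of "i - 1" i]
      by (intro brownian_increment_moments[OF Mp W]) auto
    fix \<omega> x x' y y' z z' assume "\<omega> \<in> space M"
    note * = f2[OF this ti[OF i], of x y z x' y' z'] g2[OF this ti[OF i], of x y z x' y' z']
    show "\<bar>f \<omega> (t i) x y z - f \<omega> (t i) x' y' z'\<bar> \<le> sqrt ?L * (norm (x - x') + \<bar>y - y'\<bar> + norm (z - z'))"
      by (rule lipschitz_of_square_bound[OF *(1)]) (use assms(13,14) in auto)
    show "\<bar>g \<omega> (t i) x y z - g \<omega> (t i) x' y' z'\<bar> \<le> sqrt ?L * (norm (x - x') + \<bar>y - y'\<bar> + norm (z - z'))"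
      by (rule lipschitz_of_square_bound[OF *(2)]) (use assms(13,14) in auto)
  qed
  interpret uv_setting M T n t W b \<sigma> \<phi> f g "sqrt ?L" by (rule uv)
  show ?thesis
  proof (intro allI impI)
    fix i assume "i \<le> n"
    then show "(AE \<omega> in M. Y (t i) \<omega> = u_pi M n t W b \<sigma> \<phi> f g i (\<lambda>j. X (t j) \<omega>) (\<lambda>j. dP t B j \<omega>)) \<and>
      (AE \<omega> in M. Z1 i \<omega> = v_pi M n t W b \<sigma> \<phi> f g i (\<lambda>j. X (t j) \<omega>) (\<lambda>j. dP t B j \<omega>))"
    proof (induction i rule: inc_induct)
      case base
      then show ?case using bs unfolding backward_scheme_def u_n v_n by blast
    next
      case (step i)
      then show ?case
        by (intro backward_step[OF uv W B WB cind X bs]) auto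
    qed
  qed
qed

end
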